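(* Let $\Gamma$ be a word hyperbolic group whose Gromov boundary $\partial_\infty\Gamma$ properly contains a $2$-sphere (i.e. some proper subset of $\partial_\infty\Gamma$ is homeomorphic to $S^2$). Then for every integer $q\geq 0$ there is no $(2q+1)$-Anosov representation $\rho:\Gamma\rightarrow\mathsf{SL}_{4q+2}(\mathbb{C})$.
   Context: Anosov representations: a word hyperbolic group $\Gamma$ is equipped with a left-invariant word metric (with respect to a finite generating set), and $|\gamma|_\Gamma$ is the distance of $\gamma\in\Gamma$ from the identity. For a matrix $g\in\mathsf{SL}_d(\mathbb{C})$, $\sigma_1(g)\geq\cdots\geq\sigma_d(g)$ are its singular values. For an integer $1\leq k\leq d/2$, a representation $\rho:\Gamma\to\mathsf{SL}_d(\mathbb{C})$ is $k$-Anosov if there exist $c,\mu>0$ such that $\frac{\sigma_k(\rho(\gamma))}{\sigma_{k+1}(\rho(\gamma))}\geq c e^{\mu|\gamma|_\Gamma}$ for all $\gamma\in\Gamma$. *)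

theory Defs
  imports
    "HOL-Analysis.Analysis"
    "HOL-Algebra.Generated_Groups"
    "Jordan_Normal_Form.Char_Poly"
    "Jordan_Normal_Form.Schur_Decomposition"
begin

section \<open>Gromov hyperbolic metrics and the sequential boundary\<close>

text \<open>A metric is given by a carrier set \<open>M\<close> and a distance function \<open>d\<close>.\<close>

definition gromov_product :: "('a \<Rightarrow> 'a \<Rightarrow> real) \<Rightarrow> 'a \<Rightarrow> 'a \<Rightarrow> 'a \<Rightarrow> real" where
  "gromov_product d p x y = (d p x + d p y - d x y) / 2"

definition gromov_hyperbolic :: "'a set \<Rightarrow> ('a \<Rightarrow> 'a \<Rightarrow> real) \<Rightarrow> bool" where
  "gromov_hyperbolic M d \<longleftrightarrow>
     (\<exists>\<delta>\<ge>0. \<forall>p\<in>M. \<forall>x\<in>M. \<forall>y\<in>M. \<forall>z\<in>M.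
        gromov_product d p x z \<ge> min (gromov_product d p x y) (gromov_product d p y z) - \<delta>)"

text \<open>Two sequences are related if their mutual Gromov products tend to infinity as both indices
  do; a sequence converges to infinity if it is related to itself in this sense.\<close>

definition gromov_asymptotic ::
    "('a \<Rightarrow> 'a \<Rightarrow> real) \<Rightarrow> 'a \<Rightarrow> (nat \<Rightarrow> 'a) \<Rightarrow> (nat \<Rightarrow> 'a) \<Rightarrow> bool" where
  "gromov_asymptotic d p x y \<longleftrightarrow>
     filterlim (\<lambda>(i, j). gromov_product d p (x i) (y j)) at_top (sequentially \<times>\<^sub>F sequentially)"

definition gromov_sequences ::
    "'a set \<Rightarrow> ('a \<Rightarrow> 'a \<Rightarrow> real) \<Rightarrow> 'a \<Rightarrow> (nat \<Rightarrow> 'a) set" where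
  "gromov_sequences M d p = {x. range x \<subseteq> M \<and> gromov_asymptotic d p x x}"

definition gromov_boundary_points ::
    "'a set \<Rightarrow> ('a \<Rightarrow> 'a \<Rightarrow> real) \<Rightarrow> 'a \<Rightarrow> (nat \<Rightarrow> 'a) set set" where
  "gromov_boundary_points M d p =
     gromov_sequences M d p //
       {(x, y). x \<in> gromov_sequences M d p \<and> y \<in> gromov_sequences M d p \<and>
                gromov_asymptotic d p x y}"

definition gromov_nbhd ::
    "'a set \<Rightarrow> ('a \<Rightarrow> 'a \<Rightarrow> real) \<Rightarrow> 'a \<Rightarrow> (nat \<Rightarrow> 'a) set \<Rightarrow> real \<Rightarrow> (nat \<Rightarrow> 'a) set set" where
  "gromov_nbhd M d p \<xi> r =
     {\<eta> \<in> gromov_boundary_points M d p. \<exists>x\<in>\<xi>. \<exists>y\<in>\<eta>.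
        ereal r \<le> Liminf (sequentially \<times>\<^sub>F sequentially)
                    (\<lambda>(i, j). ereal (gromov_product d p (x i) (y j)))}"

text \<open>The topology in which the sets \<open>gromov_nbhd M d p \<xi> r\<close>, for real \<open>r\<close>, form a basis of
  (not necessarily open) neighbourhoods of \<open>\<xi>\<close>.\<close>

definition gromov_boundary ::
    "'a set \<Rightarrow> ('a \<Rightarrow> 'a \<Rightarrow> real) \<Rightarrow> 'a \<Rightarrow> (nat \<Rightarrow> 'a) set topology" where
  "gromov_boundary M d p =
     topology (\<lambda>U. U \<subseteq> gromov_boundary_points M d p \<and> (\<forall>\<xi>\<in>U. \<exists>r. gromov_nbhd M d p \<xi> r \<subseteq> U))"

lemma gromov_nbhd_antimono:
  assumes "r \<le> s"
  shows "gromov_nbhd M d p \<xi> s \<subseteq> gromov_nbhd M d p \<xi> r"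
proof -
  have "ereal r \<le> ereal s" using assms by simp
  then show ?thesis unfolding gromov_nbhd_def by (blast intro: order_trans)
qed

lemma openin_gromov_boundary:
  "openin (gromov_boundary M d p) U \<longleftrightarrow>
     U \<subseteq> gromov_boundary_points M d p \<and> (\<forall>\<xi>\<in>U. \<exists>r. gromov_nbhd M d p \<xi> r \<subseteq> U)"
proof -
  let ?L = "\<lambda>U. U \<subseteq> gromov_boundary_points M d p \<and> (\<forall>\<xi>\<in>U. \<exists>r. gromov_nbhd M d p \<xi> r \<subseteq> U)"
  have inter: "?L (S \<inter> T)" if S: "?L S" and T: "?L T" for S T
  proof (intro conjI ballI)
    show "S \<inter> T \<subseteq> gromov_boundary_points M d p" using S by blast
  next
    fix \<xi> assume "\<xi> \<in> S \<inter> T"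
    then obtain r s where "gromov_nbhd M d p \<xi> r \<subseteq> S" "gromov_nbhd M d p \<xi> s \<subseteq> T"
      using S T by blast
    then have "gromov_nbhd M d p \<xi> (max r s) \<subseteq> S \<inter> T"
      using gromov_nbhd_antimono[of r "max r s" M d p \<xi>] gromov_nbhd_antimono[of s "max r s" M d p \<xi>]
      by auto
    then show "\<exists>r. gromov_nbhd M d p \<xi> r \<subseteq> S \<inter> T" by blast
  qed
  have union: "?L (\<Union>K)" if K: "\<forall>S\<in>K. ?L S" for K
  proof (intro conjI ballI)
    show "\<Union>K \<subseteq> gromov_boundary_points M d p" using K by blast
  next
    fix \<xi> assume "\<xi> \<in> \<Union>K"
    then obtain T r where "T \<in> K" "gromov_nbhd M d p \<xi> r \<subseteq> T" using K by blast
    then show "\<exists>r. gromov_nbhd M d p \<xi> r \<subseteq> \<Union>K" by blast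
  qed
  have "istopology ?L"
    unfolding istopology_def using inter union by blast
  then show ?thesis
    unfolding gromov_boundary_def by (simp add: topology_inverse')
qed

lemma topspace_gromov_boundary:
  "topspace (gromov_boundary M d p) = gromov_boundary_points M d p"
proof -
  have "gromov_nbhd M d p \<xi> r \<subseteq> gromov_boundary_points M d p" for \<xi> r
    by (auto simp: gromov_nbhd_def)
  then have "openin (gromov_boundary M d p) (gromov_boundary_points M d p)"
    unfolding openin_gromov_boundary by simp
  then have "gromov_boundary_points M d p \<subseteq> topspace (gromov_boundary M d p)"
    by (rule openin_subset)
  moreover have "topspace (gromov_boundary M d p) \<subseteq> gromov_boundary_points M d p"
    using openin_topspace[of "gromov_boundary M d p"] unfolding openin_gromov_boundary
    by (rule conjunct1)
  ultimately show ?thesis by (rule subset_antisym[rotated])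
qed

section \<open>Word metrics and word hyperbolic groups\<close>

definition word_length :: "('g, 'm) monoid_scheme \<Rightarrow> 'g set \<Rightarrow> 'g \<Rightarrow> nat" where
  "word_length G S g =
     (LEAST n. \<exists>w. length w = n \<and> set w \<subseteq> S \<union> m_inv G ` S \<and> foldr (mult G) w (one G) = g)"

definition word_dist :: "('g, 'm) monoid_scheme \<Rightarrow> 'g set \<Rightarrow> 'g \<Rightarrow> 'g \<Rightarrow> real" where
  "word_dist G S x y = real (word_length G S (inv\<^bsub>G\<^esub> x \<otimes>\<^bsub>G\<^esub> y))"

text \<open>Hyperbolicity is required of the word metric of the given generating set \<open>S\<close>; it does not
  depend on the choice of \<open>S\<close>.\<close>

definition word_hyperbolic_group :: "('g, 'm) monoid_scheme \<Rightarrow> 'g set \<Rightarrow> bool" where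
  "word_hyperbolic_group G S \<longleftrightarrow>
     group G \<and> finite S \<and> S \<subseteq> carrier G \<and> generate G S = carrier G \<and>
     gromov_hyperbolic (carrier G) (word_dist G S)"

definition group_boundary :: "('g, 'm) monoid_scheme \<Rightarrow> 'g set \<Rightarrow> (nat \<Rightarrow> 'g) set topology" where
  "group_boundary G S = gromov_boundary (carrier G) (word_dist G S) \<one>\<^bsub>G\<^esub>"

section \<open>Singular values and Anosov representations\<close>

text \<open>Square roots of the eigenvalues of \<open>A\<^sup>* A\<close>, with algebraic multiplicity, in decreasing
  order. These eigenvalues are real and nonnegative, so \<open>Re\<close> loses nothing.\<close>

definition singular_values :: "complex mat \<Rightarrow> real list" where
  "singular_values A =
     rev (sorted_list_of_multiset
       (image_mset (\<lambda>z. sqrt (Re z)) (proots (char_poly (mat_adjoint A * A)))))"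

text \<open>Singular values are indexed from 1.\<close>

definition singular_value :: "nat \<Rightarrow> complex mat \<Rightarrow> real" where
  "singular_value k A = singular_values A ! (k - 1)"

definition SL :: "nat \<Rightarrow> complex mat monoid" where
  "SL d = \<lparr>carrier = {A \<in> carrier_mat d d. Determinant.det A = 1}, mult = (*), one = 1\<^sub>m d\<rparr>"

lemma group_SL: "group (SL d)"
proof (rule groupI)
  fix x assume x: "x \<in> carrier (SL d)"
  then have c: "x \<in> carrier_mat d d" and dt: "Determinant.det x = 1" by (auto simp: SL_def)
  have "x \<in> Units (ring_mat TYPE(complex) d ())"
    using det_non_zero_imp_unit[OF c] dt by simp
  then obtain y where y: "y \<in> carrier_mat d d" "y * x = 1\<^sub>m d"
    by (auto simp: Units_def ring_mat_def)
  have "Determinant.det y = 1" using det_mult[OF y(1) c] y(2) dt by simp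
  then show "\<exists>y\<in>carrier (SL d). y \<otimes>\<^bsub>SL d\<^esub> x = \<one>\<^bsub>SL d\<^esub>" using y by (auto simp: SL_def)
qed (auto simp: SL_def det_mult assoc_mult_mat)

definition anosov_representation ::
    "('g, 'm) monoid_scheme \<Rightarrow> 'g set \<Rightarrow> nat \<Rightarrow> nat \<Rightarrow> ('g \<Rightarrow> complex mat) \<Rightarrow> bool" where
  "anosov_representation G S k d \<rho> \<longleftrightarrow>
     1 \<le> k \<and> 2 * k \<le> d \<and> \<rho> \<in> hom G (SL d) \<and>
     (\<exists>c>0. \<exists>\<mu>>0. \<forall>\<gamma>\<in>carrier G.
        singular_value k (\<rho> \<gamma>) / singular_value (k + 1) (\<rho> \<gamma>)
          \<ge> c * exp (\<mu> * real (word_length G S \<gamma>)))"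

end

theory Submission
  imports Defs
begin

text \<open>
  Put \<open>k = 2 q + 1\<close>. The singular value gap makes the action on the \<open>k\<close>-th exterior power of
  \<open>\<complex>\<^bsup>2k\<^esup>\<close> asymptotically of rank one, and, \<open>k\<close> being odd, the wedge pairing
  \<open>\<Lambda>\<^sup>k \<times> \<Lambda>\<^sup>k \<rightarrow> \<Lambda>\<^bsup>2k\<^esup> = \<complex>\<close> is an invariant \<^emph>\<open>alternating\<close> form \<open>\<omega>\<close>. The dominant lines of
  group elements \<open>g\<close> and \<open>h\<close> are within \<open>C exp (- \<mu> (g|h))\<close> of each other, so they extend to a
  continuous map from the boundary to lines. The lines of distinct boundary points are not
  \<open>\<omega>\<close>-orthogonal: otherwise, along a ray, the line of one point would be contracted exponentially
  relative to the norm of the matrices, while the matrices modulo that line are exponentially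
  small, and a discrete Gronwall argument shows that the two are incompatible.
  Choosing a boundary point \<open>\<eta>\<close> off the sphere, the
  vectors \<open>v\<^sub>x\<close> spanning the lines can be normalised continuously against the line of \<open>\<eta>\<close>, and
  \<open>x \<mapsto> \<omega>(v\<^sub>x, v\<^bsub>-x\<^esub>)\<close> is then an odd continuous map from the 2-sphere to the nonzero complex
  numbers, which does not exist.
\<close>

section \<open>Vectors, matrices and complex lines\<close>

text \<open>A line has no preferred unit vector, so continuity is stated for the matrices
  \<open>line_proj u\<close>, and phases matter only in the last step. There the extra boundary
  point is essential: pairing with it trivialises the line bundle over the sphere. The
  incompatibility behind transversality is this. Let z_j run along a geodesic towards the second
  point, let u span the line of the first, put w_j = \<tau>(z_j^-1) u and let a_j be the quotient of
  the norms of \<tau>(z_j^-1) and w_j. The Gromov product of z_j with the first point stays bounded,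
  so the columns of \<tau>(z_j^-1) are multiples of w_j up to a relative error q^j, q = exp (-
  \<mu>). Columns and w_j are moved by the same left factors, so these multiples change by O(q^j
  a_j) per step. This gives a_j <= const * sum over i <= j of q^i a_i, hence a_j stays bounded. If
  the lines were orthogonal, a_j would be at least const * q^-j. The form replaces the dual
  representation: J \<tau>(g^-1) = \<tau>(g)^T J turns inverses into transposes.\<close>

definition vnorm :: "'i set \<Rightarrow> ('i \<Rightarrow> complex) \<Rightarrow> real" where
  "vnorm I u = (\<Sum>i\<in>I. cmod (u i))"

definition mnorm :: "'i set \<Rightarrow> ('i \<Rightarrow> 'i \<Rightarrow> complex) \<Rightarrow> real" where
  "mnorm I M = (\<Sum>i\<in>I. \<Sum>j\<in>I. cmod (M i j))"

definition mapply :: "'i set \<Rightarrow> ('i \<Rightarrow> 'i \<Rightarrow> complex) \<Rightarrow> ('i \<Rightarrow> complex) \<Rightarrow> 'i \<Rightarrow> complex" where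
  "mapply I M u = (\<lambda>i. \<Sum>j\<in>I. M i j * u j)"

text \<open>The matrix u u^H, for nonzero u a positive multiple of the orthogonal projection onto
  the line of u. It does not see the phase of u, so among vectors of \<open>vnorm\<close> 1 it
  stands for the line.\<close>

definition line_proj :: "('i \<Rightarrow> complex) \<Rightarrow> 'i \<Rightarrow> 'i \<Rightarrow> complex" where
  "line_proj u = (\<lambda>i j. u i * cnj (u j))"

lemma vnorm_nonneg [simp]: "0 \<le> vnorm I u"
  by (simp add: vnorm_def sum_nonneg)

lemma mnorm_nonneg [simp]: "0 \<le> mnorm I M"
  by (simp add: mnorm_def sum_nonneg)

lemma vnorm_scale: "vnorm I (\<lambda>i. c * u i) = cmod c * vnorm I u"
  by (simp add: vnorm_def norm_mult sum_distrib_left)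

lemma vnorm_add: "vnorm I (\<lambda>i. u i + v i) \<le> vnorm I u + vnorm I v"
  unfolding vnorm_def sum.distrib[symmetric] by (intro sum_mono norm_triangle_ineq)

lemma vnorm_diff: "vnorm I (\<lambda>i. u i - v i) \<le> vnorm I u + vnorm I v"
  unfolding vnorm_def sum.distrib[symmetric] by (intro sum_mono norm_triangle_ineq4)

lemma vnorm_diff_triangle:
  "vnorm I (\<lambda>i. u i - w i) \<le> vnorm I (\<lambda>i. u i - v i) + vnorm I (\<lambda>i. v i - w i)"
  using vnorm_add[of I "\<lambda>i. u i - v i" "\<lambda>i. v i - w i"] by simp

lemma vnorm_diff_commute: "vnorm I (\<lambda>i. u i - v i) = vnorm I (\<lambda>i. v i - u i)"
  by (simp add: vnorm_def norm_minus_commute)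

lemma vnorm_diff_ge: "vnorm I u - vnorm I v \<le> vnorm I (\<lambda>i. u i - v i)"
  using vnorm_add[of I "\<lambda>i. u i - v i" v] by simp

lemma mnorm_diff_triangle:
  "mnorm I (\<lambda>i j. M i j - L i j) \<le> mnorm I (\<lambda>i j. M i j - N i j) + mnorm I (\<lambda>i j. N i j - L i j)"
  unfolding mnorm_def sum.distrib[symmetric] 
  by (intro sum_mono) (metis diff_add_cancel add_diff_eq norm_triangle_ineq)

lemma mnorm_diff_commute: "mnorm I (\<lambda>i j. M i j - N i j) = mnorm I (\<lambda>i j. N i j - M i j)"
  by (simp add: mnorm_def norm_minus_commute)

lemma mnorm_diff: "mnorm I (\<lambda>i j. M i j - N i j) \<le> mnorm I M + mnorm I N"
  unfolding mnorm_def sum.distrib[symmetric] by (intro sum_mono norm_triangle_ineq4)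

lemma mnorm_columns: "mnorm I M = (\<Sum>j\<in>I. vnorm I (\<lambda>i. M i j))"
  unfolding mnorm_def vnorm_def by (rule sum.swap)

lemma cmod_le_vnorm:
  assumes "finite I" "i \<in> I" shows "cmod (u i) \<le> vnorm I u"
  unfolding vnorm_def using assms by (intro member_le_sum) auto

lemma vnorm_column_le:
  assumes "finite I" "j \<in> I" shows "vnorm I (\<lambda>i. M i j) \<le> mnorm I M"
  unfolding mnorm_columns using assms by (intro member_le_sum) auto

lemma cmod_le_mnorm:
  assumes "finite I" "i \<in> I" "j \<in> I" shows "cmod (M i j) \<le> mnorm I M"
  using cmod_le_vnorm[OF assms(1,2), of "\<lambda>i. M i j"] vnorm_column_le[OF assms(1,3), of M] by simp

lemma vnorm_mapply: "finite I \<Longrightarrow> vnorm I (mapply I M u) \<le> mnorm I M * vnorm I u"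
proof -
  assume fin: "finite I"
  have "vnorm I (mapply I M u) \<le> (\<Sum>i\<in>I. \<Sum>j\<in>I. cmod (M i j) * cmod (u j))"
    unfolding vnorm_def mapply_def norm_mult[symmetric] by (intro sum_mono norm_sum)
  also have "\<dots> \<le> (\<Sum>i\<in>I. \<Sum>j\<in>I. cmod (M i j) * vnorm I u)"
    by (intro sum_mono mult_left_mono cmod_le_vnorm fin) auto
  finally show ?thesis by (simp add: mnorm_def sum_distrib_right)
qed

lemma mapply_diff: "mapply I M (\<lambda>i. u i - v i) = (\<lambda>i. mapply I M u i - mapply I M v i)"
  by (simp add: mapply_def algebra_simps sum_subtractf)

lemma mapply_scale: "mapply I M (\<lambda>i. c * u i) = (\<lambda>i. c * mapply I M u i)"
  by (simp add: mapply_def sum_distrib_left mult_ac)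

lemma mnorm_mult_le:
  assumes "finite I" "\<And>i j. i \<in> I \<Longrightarrow> j \<in> I \<Longrightarrow> M i j = (\<Sum>l\<in>I. A i l * B l j)"
  shows "mnorm I M \<le> mnorm I A * mnorm I B"
proof -
  have "mnorm I M = (\<Sum>j\<in>I. vnorm I (mapply I A (\<lambda>l. B l j)))"
    unfolding mnorm_columns using assms(2) by (simp add: vnorm_def mapply_def)
  also have "\<dots> \<le> (\<Sum>j\<in>I. mnorm I A * vnorm I (\<lambda>l. B l j))"
    by (intro sum_mono vnorm_mapply assms(1))
  finally show ?thesis by (simp add: mnorm_columns[of I B] sum_distrib_left)
qed

lemma mnorm_line_proj: "mnorm I (line_proj u) = (vnorm I u)\<^sup>2"
  by (simp add: mnorm_def vnorm_def line_proj_def norm_mult power2_eq_square sum_product)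

text \<open>The norms force |c| to be 1 up to \<eta>. Passing from f to c e then costs 3 \<eta>, and
  rescaling c e to e costs the distance of |c|^2 from 1, at most another 3 \<eta>.\<close>

lemma line_proj_close:
  assumes f: "vnorm I f = 1" and e: "vnorm I e = 1" and fe: "vnorm I (\<lambda>i. f i - c * e i) \<le> \<eta>"
  shows "mnorm I (\<lambda>i j. line_proj f i j - line_proj e i j) \<le> 6 * \<eta>"
proof (cases "\<eta> \<le> 1")
  case False
  \<comment> \<open>Both matrices have \<open>mnorm\<close> 1, so their distance is at most
    2.\<close>
  then show ?thesis using mnorm_diff[of I "line_proj f" "line_proj e"] by (simp add: mnorm_line_proj f e)
next
  case True
  have \<eta>: "0 \<le> \<eta>" using fe vnorm_nonneg order_trans by blast
  define g where "g = (\<lambda>i. c * e i)"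
  have g: "vnorm I g = cmod c" by (simp add: g_def vnorm_scale e)
  have c1: "cmod c \<le> 1 + \<eta>" using vnorm_diff_ge[of I g f] fe vnorm_diff_commute[of I f g] g f
    by (simp add: g_def)
  have c2: "1 - \<eta> \<le> cmod c" using vnorm_diff_ge[of I f g] fe g f by (simp add: g_def)
  have "mnorm I (\<lambda>i j. line_proj f i j - line_proj g i j)
      \<le> (\<Sum>i\<in>I. \<Sum>j\<in>I. cmod (f i - g i) * cmod (f j) + cmod (g i) * cmod (f j - g j))"
    unfolding mnorm_def
  proof (intro sum_mono)
    fix i j
    have "line_proj f i j - line_proj g i j = (f i - g i) * cnj (f j) + g i * cnj (f j - g j)"
      by (simp add: line_proj_def algebra_simps)
    then show "cmod (line_proj f i j - line_proj g i j) \<le> cmod (f i - g i) * cmod (f j) + cmod (g i) * cmod (f j - g j)"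
      by (metis norm_triangle_ineq norm_mult complex_mod_cnj)
  qed
  also have "\<dots> = vnorm I (\<lambda>i. f i - g i) * (1 + cmod c)"
    using f g by (simp add: sum.distrib sum_distrib_left[symmetric] sum_distrib_right[symmetric] vnorm_def algebra_simps)
  also have "\<dots> \<le> \<eta> * 3" using fe c1 True \<eta> by (intro mult_mono) (auto simp: g_def)
  finally have 1: "mnorm I (\<lambda>i j. line_proj f i j - line_proj g i j) \<le> \<eta> * 3" .
  have lg: "line_proj g i j - line_proj e i j = of_real ((cmod c)\<^sup>2 - 1) * line_proj e i j" for i j
    unfolding line_proj_def g_def using complex_norm_square[of c]
    by (simp add: algebra_simps)
  have "mnorm I (\<lambda>i j. line_proj g i j - line_proj e i j) = \<bar>(cmod c)\<^sup>2 - 1\<bar> * mnorm I (line_proj e)"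
    unfolding lg by (simp add: mnorm_def norm_mult sum_distrib_left del: of_real_diff of_real_power)
  also have "\<dots> = \<bar>cmod c - 1\<bar> * (cmod c + 1)"
  proof -
    have "(cmod c)\<^sup>2 - 1 = (cmod c - 1) * (cmod c + 1)" by (simp add: power2_eq_square algebra_simps)
    then show ?thesis by (simp only: abs_mult mnorm_line_proj e) simp
  qed
  also have "\<dots> \<le> \<eta> * 3" using c1 c2 True \<eta> by (intro mult_mono) auto
  finally show ?thesis using 1 mnorm_diff_triangle[of I "line_proj f" "line_proj e" "line_proj g"] by simp
qed

lemma obtain_large_coordinate:
  assumes "finite I" "vnorm I f = 1"
  obtains l where "l \<in> I" "1 / real (card I) \<le> cmod (f l)"
proof -
  have "\<exists>l\<in>I. 1 / real (card I) \<le> cmod (f l)"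
  proof (rule ccontr)
    assume "\<not> ?thesis"
    then have *: "\<And>l. l \<in> I \<Longrightarrow> cmod (f l) < 1 / real (card I)" by force
    have "I \<noteq> {}" using assms by (auto simp: vnorm_def)
    then have "vnorm I f < (\<Sum>l\<in>I. 1 / real (card I))"
      unfolding vnorm_def using * assms(1) by (intro sum_strict_mono) auto
    then show False using assms \<open>I \<noteq> {}\<close> by simp
  qed
  then show ?thesis using that by blast
qed

text \<open>Column l of f f^H - e e^H, divided by the conjugate of \<open>f l\<close>, is f minus a
  multiple of e. Some l has |f l| at least 1 / \<open>card I\<close>, whence the factor
  \<open>card I\<close>.\<close>

lemma line_proj_close_converse:
  assumes fin: "finite I" and f: "vnorm I f = 1"
    and fe: "mnorm I (\<lambda>i j. line_proj f i j - line_proj e i j) \<le> \<eta>"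
  obtains c where "vnorm I (\<lambda>i. f i - c * e i) \<le> real (card I) * \<eta>"
proof -
  obtain l where l: "l \<in> I" "1 / real (card I) \<le> cmod (f l)" using obtain_large_coordinate[OF fin f] .
  have D: "0 < card I" using l fin card_gt_0_iff by blast
  then have fl: "0 < cmod (f l)" using l(2) by (smt (verit) divide_pos_pos of_nat_0_less_iff)
  define c where "c = cnj (e l) / cnj (f l)"
  have "vnorm I (\<lambda>i. f i - c * e i) = vnorm I (\<lambda>i. (line_proj f i l - line_proj e i l)) / cmod (f l)"
  proof -
    have "f i - c * e i = inverse (cnj (f l)) * (line_proj f i l - line_proj e i l)" for i
      using fl by (simp add: c_def line_proj_def field_simps)
    then show ?thesis by (simp only: vnorm_scale) (simp add: norm_inverse divide_inverse mult.commute)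
  qed
  also have "\<dots> \<le> \<eta> / cmod (f l)"
    using vnorm_column_le[OF fin l(1), of "\<lambda>i j. line_proj f i j - line_proj e i j"] fe fl
    by (intro divide_right_mono) auto
  also have "\<dots> \<le> real (card I) * \<eta>"
  proof -
    have "0 \<le> \<eta>" using fe mnorm_nonneg order_trans by blast
    moreover have "1 / cmod (f l) \<le> real (card I)" using l(2) fl D by (simp add: field_simps)
    ultimately show ?thesis using mult_left_mono[of "1 / cmod (f l)" "real (card I)" \<eta>] by (simp add: mult.commute)
  qed
  finally show ?thesis using that by blast
qed

text \<open>Hermitian symmetry, vanishing 2 x 2 minors, a nonnegative diagonal and
  \<open>mnorm\<close> 1 all pass to the limit, and together they force Q to be u u^H. The vectors
  \<open>e n\<close> themselves need not converge.\<close>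

lemma line_proj_limit:
  assumes fin: "finite I" and e: "\<And>n. vnorm I (e n) = 1"
    and lim: "\<And>i j. i \<in> I \<Longrightarrow> j \<in> I \<Longrightarrow> (\<lambda>n. line_proj (e n) i j) \<longlonglongrightarrow> Q i j"
  obtains u where "vnorm I u = 1" "\<And>i. i \<notin> I \<Longrightarrow> u i = 0"
    "\<And>i j. i \<in> I \<Longrightarrow> j \<in> I \<Longrightarrow> Q i j = line_proj u i j"
proof -
  have "(\<lambda>n. mnorm I (line_proj (e n))) \<longlonglongrightarrow> mnorm I Q"
    unfolding mnorm_def by (intro tendsto_sum tendsto_norm lim)
  then have "mnorm I Q = 1" using e LIMSEQ_unique[of "\<lambda>n. 1::real"] by (simp add: mnorm_line_proj)
  then obtain p r where pr: "p \<in> I" "r \<in> I" "Q p r \<noteq> 0"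
    unfolding mnorm_def by (metis (no_types, lifting) norm_zero sum.neutral zero_neq_one)
  have minor: "Q i j * Q l m = Q i m * Q l j" if "i \<in> I" "j \<in> I" "l \<in> I" "m \<in> I" for i j l m
  proof (rule LIMSEQ_unique)
    show "(\<lambda>n. line_proj (e n) i j * line_proj (e n) l m) \<longlonglongrightarrow> Q i j * Q l m"
      by (intro tendsto_mult lim that)
    have "(\<lambda>n. line_proj (e n) i m * line_proj (e n) l j) \<longlonglongrightarrow> Q i m * Q l j"
      by (intro tendsto_mult lim that)
    then show "(\<lambda>n. line_proj (e n) i j * line_proj (e n) l m) \<longlonglongrightarrow> Q i m * Q l j"
      by (simp add: line_proj_def mult_ac)
  qed
  have herm: "Q i j = cnj (Q j i)" if "i \<in> I" "j \<in> I" for i j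
  proof (rule LIMSEQ_unique)
    show "(\<lambda>n. line_proj (e n) i j) \<longlonglongrightarrow> Q i j" by (intro lim that)
    have "(\<lambda>n. cnj (line_proj (e n) j i)) \<longlonglongrightarrow> cnj (Q j i)" by (intro tendsto_cnj lim that)
    then show "(\<lambda>n. line_proj (e n) i j) \<longlonglongrightarrow> cnj (Q j i)" by (simp add: line_proj_def mult_ac)
  qed
  \<comment> \<open>The minor at p, r equals Q p p * Q r r - |Q p r|^2, so a nonzero entry forces a
    nonzero diagonal entry; the column through it is rescaled to u.\<close>
  have "Q p p * Q r r = Q p r * cnj (Q p r)" using minor[of p p r r] herm[of r p] pr by simp
  then have pp: "Q p p \<noteq> 0" using pr by auto
  have "Re (Q p p) \<ge> 0"
    using tendsto_Re[OF lim[OF pr(1) pr(1)]] by (rule tendsto_lowerbound) (auto simp: line_proj_def)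
  moreover have "Im (Q p p) = 0" using herm[OF pr(1) pr(1)] by (metis complex_cnj_cancel_iff cnj.simps(2) neg_equal_zero)
  ultimately have pos: "Re (Q p p) > 0" and re: "Q p p = of_real (Re (Q p p))"
    using pp by (auto simp: complex_eq_iff less_le)
  define u where "u i = (if i \<in> I then Q i p / of_real (sqrt (Re (Q p p))) else 0)" for i
  have ul: "Q i j = line_proj u i j" if ij: "i \<in> I" "j \<in> I" for i j
  proof -
    have "line_proj u i j = Q i p * cnj (Q j p) / of_real (sqrt (Re (Q p p)) * sqrt (Re (Q p p)))"
      using ij unfolding of_real_mult by (simp add: line_proj_def u_def)
    also have "\<dots> = Q i p * Q p j / Q p p" using pos re herm[of p j] pr ij by simp
    also have "\<dots> = Q i j" using minor[of i j p p] pp pr ij by (simp add: field_simps)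
    finally show ?thesis by simp
  qed
  have "(vnorm I u)\<^sup>2 = mnorm I Q" using ul by (simp add: mnorm_line_proj[symmetric] mnorm_def)
  then have "vnorm I u = 1" using \<open>mnorm I Q = 1\<close> by (simp add: power2_eq_1_iff) (smt (verit) vnorm_nonneg)
  then show ?thesis using that ul by (auto simp: u_def)
qed


section \<open>A discrete Gronwall argument for matrix orbits\<close>

text \<open>The weights B q^i beyond some N sum to less than 1/2, so a maximal term can be absorbed
  and the sequence is bounded; then a_j q^j decays. The order of quantifiers matters: n depends on
  the constants alone, because in the application the sequence is built only after n is
  known.\<close>

lemma bounded_of_summable_gronwall:
  fixes A B L q c :: real
  assumes A: "0 \<le> A" and B: "0 \<le> B" and L: "1 \<le> L" and q: "0 < q" "q < 1" and c: "0 < c"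
  obtains n where "\<And>a. (\<And>j. 0 \<le> a j) \<Longrightarrow> a 0 \<le> A \<Longrightarrow> (\<And>j. j < n \<Longrightarrow> a (Suc j) \<le> L * a j) \<Longrightarrow>
    (\<And>j. j \<le> n \<Longrightarrow> a j \<le> B * (\<Sum>i\<le>j. q ^ i * a i)) \<Longrightarrow> \<exists>j\<le>n. a j * q ^ j < c"
proof -
  have "(\<lambda>N. B / (1 - q) * q ^ N) \<longlonglongrightarrow> B / (1 - q) * 0"
    using q by (intro tendsto_mult tendsto_const LIMSEQ_realpow_zero) auto
  then have "eventually (\<lambda>N. B / (1 - q) * q ^ N < 1 / 2) sequentially"
    by (intro order_tendstoD(2)) auto
  then obtain N where N: "B / (1 - q) * q ^ N < 1 / 2" by (auto simp: eventually_sequentially)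
  \<comment> \<open>Twice B times the sum of N initial terms, each at most \<open>A * L ^ N\<close>;
    twice, because half of the maximal term is moved to the other side.\<close>
  define M where "M = 2 * B * real N * (A * L ^ N)"
  have "(\<lambda>n. M * q ^ n) \<longlonglongrightarrow> M * 0"
    using q by (intro tendsto_mult tendsto_const LIMSEQ_realpow_zero) auto
  then have "eventually (\<lambda>n. M * q ^ n < c) sequentially" using c by (intro order_tendstoD(2)) auto
  then obtain n where n: "M * q ^ n < c" by (auto simp: eventually_sequentially)
  show ?thesis
  proof (rule that[of n])
    fix a :: "nat \<Rightarrow> real"
    assume pos: "\<And>j. 0 \<le> a j" and a0: "a 0 \<le> A" and step: "\<And>j. j < n \<Longrightarrow> a (Suc j) \<le> L * a j"
      and rec: "\<And>j. j \<le> n \<Longrightarrow> a j \<le> B * (\<Sum>i\<le>j. q ^ i * a i)"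
    have init: "a j \<le> A * L ^ j" if "j \<le> n" for j
      using that
    proof (induction j)
      case (Suc j)
      then have "a (Suc j) \<le> L * (A * L ^ j)" using step[of j] L
        by (smt (verit) Suc_le_eq mult_left_mono less_imp_le_nat)
      then show ?case by (simp add: mult_ac)
    qed (use a0 in simp)
    have "Max (a ` {..n}) \<in> a ` {..n}" by (intro Max_in) auto
    then obtain m where "Max (a ` {..n}) = a m" "m \<in> {..n}" by (rule imageE)
    moreover have "a j \<le> Max (a ` {..n})" if "j \<le> n" for j using that by (intro Max_ge) auto
    ultimately have m: "m \<le> n" "\<And>j. j \<le> n \<Longrightarrow> a j \<le> a m" by simp_all
    \<comment> \<open>The recursion is applied only at the index m of a maximal term. Below N the
      crude growth bound is used, from N on the maximal value.\<close>
    have "(\<Sum>i\<le>m. q ^ i * a i) \<le> (\<Sum>i\<le>m. (if i < N then A * L ^ N else 0) + (if i < N then 0 else q ^ i * a m))"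
    proof (rule sum_mono)
      fix i assume "i \<in> {..m}"
      then have i: "i \<le> n" using m by auto
      have "q ^ i * a i \<le> 1 * a i" using q pos by (intro mult_right_mono power_le_one) auto
      moreover have "a i \<le> A * L ^ N" if "i < N"
        using init[OF i] power_increasing[of i N L] that L A by (smt (verit) mult_left_mono less_imp_le_nat)
      moreover have "q ^ i * a i \<le> q ^ i * a m" using q m(2)[OF i] by (intro mult_left_mono) auto
      ultimately show "q ^ i * a i \<le> (if i < N then A * L ^ N else 0) + (if i < N then 0 else q ^ i * a m)" by auto
    qed
    also have "\<dots> = (\<Sum>i\<in>{..m} \<inter> {..<N}. A * L ^ N) + (\<Sum>i\<in>{..m} - {..<N}. q ^ i) * a m"
      unfolding sum.distrib sum_distrib_right by (intro arg_cong2[of _ _ _ _ "(+)"] sum.mono_neutral_cong) auto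
    also have "\<dots> \<le> real N * (A * L ^ N) + (q ^ N / (1 - q)) * a m"
    proof (intro add_mono mult_right_mono pos)
      have "card ({..m} \<inter> {..<N}) \<le> N" using card_mono[of "{..<N}" "{..m} \<inter> {..<N}"] by simp
      then show "(\<Sum>i\<in>{..m} \<inter> {..<N}. A * L ^ N) \<le> real N * (A * L ^ N)"
        using A L by (simp add: mult_right_mono)
      have "(\<Sum>i\<in>{..m} - {..<N}. q ^ i) \<le> (\<Sum>i\<in>{N..<N + Suc m}. q ^ i)"
        using q by (intro sum_mono2) auto
      also have "\<dots> = q ^ N * (\<Sum>i<Suc m. q ^ i)"
        unfolding sum_distrib_left by (rule sum.reindex_bij_witness[of _ "\<lambda>i. i + N" "\<lambda>i. i - N"]) (auto simp flip: power_add)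
      also have "(\<Sum>i<Suc m. q ^ i) \<le> 1 / (1 - q)" using q
        by (subst geometric_sum) (auto simp: field_simps)
      finally show "(\<Sum>i\<in>{..m} - {..<N}. q ^ i) \<le> q ^ N / (1 - q)" using q by (simp add: mult_left_mono)
    qed
    finally have "B * (\<Sum>i\<le>m. q ^ i * a i) \<le> B * (real N * (A * L ^ N) + (q ^ N / (1 - q)) * a m)"
      using B by (rule mult_left_mono)
    then have "a m \<le> M / 2 + (B / (1 - q) * q ^ N) * a m"
      using rec[OF m(1)] by (simp add: M_def algebra_simps)
    also have "\<dots> \<le> M / 2 + 1 / 2 * a m" using N pos by (intro add_left_mono mult_right_mono) auto
    finally have "a m \<le> M" by simp
    then have "a n \<le> M" using m(2)[of n] by simp
    then have "a n * q ^ n < c" using n q by (smt (verit) mult_right_mono zero_le_power)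
    then show "\<exists>j\<le>n. a j * q ^ j < c" by blast
  qed
qed

text \<open>Write column l of T_j as c_j w_j plus an error of size B q^j
  \<open>mnorm I (T j)\<close>. Columns and w_j are moved by the same matrix, so (c_{j+1} - c_j)
  w_{j+1} is the image of the old error minus the new error. Dividing by the norm of w_{j+1} bounds
  the increments by terms of the form q^j a_j, and their sum bounds the columns of T_k.\<close>

lemma columns_near_orbit_bound:
  fixes T M :: "nat \<Rightarrow> 'i \<Rightarrow> 'i \<Rightarrow> complex" and w :: "nat \<Rightarrow> 'i \<Rightarrow> complex"
  assumes fin: "finite I" and q: "0 \<le> q" and B: "0 \<le> B" and L: "1 \<le> L"
    and T: "\<And>j l. j < n \<Longrightarrow> (\<lambda>i. T (Suc j) i l) = mapply I (M j) (\<lambda>i. T j i l)"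
    and w: "\<And>j. j < n \<Longrightarrow> w (Suc j) = mapply I (M j) (w j)"
    and M: "\<And>j. j < n \<Longrightarrow> mnorm I (M j) \<le> L"
    and wL: "\<And>j. j < n \<Longrightarrow> vnorm I (w j) \<le> L * vnorm I (w (Suc j))"
    and pos: "\<And>j. j \<le> n \<Longrightarrow> 0 < vnorm I (w j)"
    and near: "\<And>j l. j \<le> n \<Longrightarrow> l \<in> I \<Longrightarrow> \<exists>c. vnorm I (\<lambda>i. T j i l - c * w j i) \<le> B * q ^ j * mnorm I (T j)"
    and k: "k \<le> n"
  shows "mnorm I (T k) / vnorm I (w k)
    \<le> real (card I) * (1 + 3 * B + L\<^sup>2 * B) * (\<Sum>i\<le>k. q ^ i * (mnorm I (T i) / vnorm I (w i)))"
proof -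
  define a where "a i = mnorm I (T i) / vnorm I (w i)" for i
  have a0: "0 \<le> a i" for i by (simp add: a_def)
  have Na: "mnorm I (T i) = a i * vnorm I (w i)" if "i \<le> n" for i using pos[OF that] by (simp add: a_def)
  define \<Sigma> where "\<Sigma> = (\<Sum>i\<le>k. q ^ i * a i)"
  have col: "vnorm I (\<lambda>i. T k i l) \<le> (1 + 3 * B + L\<^sup>2 * B) * \<Sigma> * vnorm I (w k)" if l: "l \<in> I" for l
  proof -
    obtain c where c: "\<And>j. j \<le> n \<Longrightarrow> vnorm I (\<lambda>i. T j i l - c j * w j i) \<le> B * q ^ j * mnorm I (T j)"
      using near[OF _ l] by metis
    have c_le: "cmod (c j) \<le> (1 + B) * a 0 + L\<^sup>2 * B * (\<Sum>i<j. q ^ i * a i) + B * (\<Sum>i\<le>j. q ^ i * a i)" if "j \<le> n" for j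
      using that
    proof (induction j)
      case 0
      have "cmod (c 0) * vnorm I (w 0) \<le> vnorm I (\<lambda>i. T 0 i l) + vnorm I (\<lambda>i. T 0 i l - c 0 * w 0 i)"
        using vnorm_diff[of I "\<lambda>i. T 0 i l" "\<lambda>i. T 0 i l - c 0 * w 0 i"] by (simp add: vnorm_scale)
      also have "\<dots> \<le> mnorm I (T 0) + B * mnorm I (T 0)"
        using vnorm_column_le[OF fin l] c[of 0] by (intro add_mono) auto
      also have "\<dots> = (1 + B) * a 0 * vnorm I (w 0)" using Na[of 0] by (simp add: algebra_simps)
      finally have "cmod (c 0) \<le> (1 + B) * a 0" using pos[of 0] by simp
      then show ?case using mult_nonneg_nonneg[OF B a0] by (simp add: add_increasing2)
    next
      case (Suc j)
      then have j: "j < n" "j \<le> n" "Suc j \<le> n" by auto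
      let ?r = "\<lambda>j i. T j i l - c j * w j i"
      have "(\<lambda>i. (c (Suc j) - c j) * w (Suc j) i) = (\<lambda>i. mapply I (M j) (?r j) i - ?r (Suc j) i)"
        using T[OF j(1), of l] w[OF j(1)] unfolding mapply_diff mapply_scale
        by (simp add: fun_eq_iff algebra_simps)
      then have "cmod (c (Suc j) - c j) * vnorm I (w (Suc j)) = vnorm I (\<lambda>i. mapply I (M j) (?r j) i - ?r (Suc j) i)"
        by (metis vnorm_scale)
      also have "\<dots> \<le> mnorm I (M j) * vnorm I (?r j) + vnorm I (?r (Suc j))"
        by (intro order_trans[OF vnorm_diff] add_right_mono vnorm_mapply fin)
      also have "\<dots> \<le> L * (B * q ^ j * mnorm I (T j)) + B * q ^ Suc j * mnorm I (T (Suc j))"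
        using M[OF j(1)] L by (intro add_mono mult_mono c j) auto
      also have "\<dots> = L * B * q ^ j * a j * vnorm I (w j) + B * q ^ Suc j * a (Suc j) * vnorm I (w (Suc j))"
        using Na j by simp
      also have "\<dots> \<le> L * B * q ^ j * a j * (L * vnorm I (w (Suc j))) + B * q ^ Suc j * a (Suc j) * vnorm I (w (Suc j))"
        using wL[OF j(1)] L B q a0 by (intro add_right_mono mult_left_mono) auto
      also have "\<dots> = (L\<^sup>2 * B * (q ^ j * a j) + B * (q ^ Suc j * a (Suc j))) * vnorm I (w (Suc j))"
        by (simp add: algebra_simps power2_eq_square)
      finally have "cmod (c (Suc j) - c j) \<le> L\<^sup>2 * B * (q ^ j * a j) + B * (q ^ Suc j * a (Suc j))"
        using pos[OF j(3)] by simp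
      moreover have "cmod (c (Suc j)) \<le> cmod (c j) + cmod (c (Suc j) - c j)"
        using norm_triangle_sub by blast
      ultimately show ?case using Suc.IH[OF j(2)] by (simp add: algebra_simps)
    qed
    have "a 0 \<le> \<Sigma>" unfolding \<Sigma>_def using q a0
      member_le_sum[of 0 "{..k}" "\<lambda>i. q ^ i * a i"] by simp
    moreover have "(\<Sum>i<k. q ^ i * a i) \<le> \<Sigma>" unfolding \<Sigma>_def using q a0 by (intro sum_mono2) auto
    moreover have "q ^ k * a k \<le> \<Sigma>" unfolding \<Sigma>_def using q a0
      by (intro member_le_sum[of k "{..k}" "\<lambda>i. q ^ i * a i"]) auto
    moreover have "vnorm I (\<lambda>i. T k i l) \<le> (cmod (c k) + B * (q ^ k * a k)) * vnorm I (w k)"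
      using c[OF k] vnorm_add[of I "\<lambda>i. T k i l - c k * w k i" "\<lambda>i. c k * w k i"] Na[OF k]
      by (simp add: vnorm_scale algebra_simps)
    \<comment> \<open>One B comes with \<open>a 0\<close>, one from the increments and one from the
      last error: together the 3 B of the constant.\<close>
    moreover have "cmod (c k) + B * (q ^ k * a k) \<le> (1 + B) * \<Sigma> + L\<^sup>2 * B * \<Sigma> + B * \<Sigma> + B * \<Sigma>"
      using c_le[OF k] calculation(1-3) B
      by (smt (verit) \<Sigma>_def mult_left_mono zero_le_power2 mult_nonneg_nonneg)
    ultimately show ?thesis
      using mult_right_mono[of "cmod (c k) + B * (q ^ k * a k)" _ "vnorm I (w k)"]
      by (smt (verit) vnorm_nonneg distrib_right mult.commute mult.left_commute mult_1)
  qed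
  have "mnorm I (T k) \<le> (\<Sum>l\<in>I. (1 + 3 * B + L\<^sup>2 * B) * \<Sigma> * vnorm I (w k))"
    unfolding mnorm_columns[of I "T k"] by (intro sum_mono col)
  then show ?thesis using pos[OF k] by (simp add: \<Sigma>_def a_def divide_le_eq mult_ac)
qed

section \<open>Word metrics\<close>

locale word_metric = group G for G :: "('g, 'm) monoid_scheme" (structure) +
  fixes S :: "'g set"
  assumes gens_subset: "S \<subseteq> carrier G"
    and gens_generate: "generate G S = carrier G"
begin

abbreviation "letters \<equiv> S \<union> m_inv G ` S"
abbreviation "wprod w \<equiv> foldr (mult G) w \<one>"
abbreviation "wlen g \<equiv> real (word_length G S g)"
abbreviation "wdist \<equiv> word_dist G S"
abbreviation "gprod \<equiv> gromov_product (word_dist G S) \<one>"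

lemma letters_closed: "letters \<subseteq> carrier G"
  using gens_subset by auto

lemma letters_inv: "s \<in> letters \<Longrightarrow> inv s \<in> letters"
  using gens_subset by (auto simp: image_iff)

lemma map_inv_letters:
  assumes "set w \<subseteq> letters" shows "set (map (m_inv G) (rev w)) \<subseteq> letters"
  unfolding set_map set_rev
proof (rule image_subsetI)
  fix s assume "s \<in> set w"
  then have "s \<in> letters" using assms by (rule subsetD[rotated])
  then show "inv s \<in> letters" by (rule letters_inv)
qed

lemma wprod_closed: "set w \<subseteq> letters \<Longrightarrow> wprod w \<in> carrier G"
  using letters_closed by (induction w) auto

lemma wprod_append: "set u \<subseteq> letters \<Longrightarrow> set v \<subseteq> letters \<Longrightarrow> wprod (u @ v) = wprod u \<otimes> wprod v"
  using letters_closed by (induction u) (auto simp: wprod_closed m_assoc subset_iff)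

lemma wprod_inv: "set w \<subseteq> letters \<Longrightarrow> wprod (map (m_inv G) (rev w)) = inv (wprod w)"
proof (induction w)
  case (Cons a w)
  have a: "a \<in> carrier G" "inv a \<in> letters" using Cons.prems letters_inv[of a] letters_closed by auto
  have "set w \<subseteq> letters" using Cons.prems by simp
  then have "set (map (m_inv G) (rev w)) \<subseteq> letters" by (rule map_inv_letters)
  then show ?case using Cons a by (simp add: wprod_append inv_mult_group wprod_closed del: foldr_append)
qed simp

lemma word_exists: "g \<in> carrier G \<Longrightarrow> \<exists>w. set w \<subseteq> letters \<and> wprod w = g"
  unfolding gens_generate[symmetric]
proof (induction rule: generate.induct)
  case one then show ?case by (intro exI[of _ "[]"]) simp
next
  case (incl h) then show ?case using gens_subset by (intro exI[of _ "[h]"]) auto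
next
  case (inv h) then show ?case using gens_subset by (intro exI[of _ "[inv h]"]) auto
next
  case (eng g h)
  then obtain u v where "set u \<subseteq> letters" "wprod u = g" "set v \<subseteq> letters" "wprod v = h" by blast
  then show ?case by (intro exI[of _ "u @ v"]) (simp add: wprod_append del: foldr_append)
qed

lemma word_length_word:
  assumes "g \<in> carrier G"
  obtains w where "length w = word_length G S g" "set w \<subseteq> letters" "wprod w = g"
proof -
  have "\<exists>n w. length w = n \<and> set w \<subseteq> letters \<and> wprod w = g" using word_exists[OF assms] by blast
  from LeastI_ex[OF this] show ?thesis using that unfolding word_length_def by blast
qed

lemma word_length_le: "set w \<subseteq> letters \<Longrightarrow> wprod w = g \<Longrightarrow> word_length G S g \<le> length w"
  unfolding word_length_def by (rule Least_le) blast

lemma word_length_one [simp]: "word_length G S \<one> = 0"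
  using word_length_le[of "[]" \<one>] by simp

lemma word_length_mult:
  assumes "g \<in> carrier G" "h \<in> carrier G"
  shows "word_length G S (g \<otimes> h) \<le> word_length G S g + word_length G S h"
proof -
  obtain u where u: "length u = word_length G S g" "set u \<subseteq> letters" "wprod u = g"
    using word_length_word[OF assms(1)] .
  obtain v where v: "length v = word_length G S h" "set v \<subseteq> letters" "wprod v = h"
    using word_length_word[OF assms(2)] .
  show ?thesis using word_length_le[of "u @ v" "g \<otimes> h"] u v
    by (simp add: wprod_append del: foldr_append)
qed

lemma word_length_inv [simp]:
  assumes "g \<in> carrier G" shows "word_length G S (inv g) = word_length G S g"
proof -
  have le: "word_length G S (inv h) \<le> word_length G S h" if h: "h \<in> carrier G" for h
  proof -
    obtain u where u: "length u = word_length G S h" "set u \<subseteq> letters" "wprod u = h"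
      using word_length_word[OF h] .
    from word_length_le[OF map_inv_letters[OF u(2)] wprod_inv[OF u(2)]] show ?thesis using u by simp
  qed
  show ?thesis using le[OF assms] le[of "inv g"] assms by simp
qed

lemma word_dist_one: "g \<in> carrier G \<Longrightarrow> wdist \<one> g = wlen g"
  by (simp add: word_dist_def)

lemma word_dist_commute: "x \<in> carrier G \<Longrightarrow> y \<in> carrier G \<Longrightarrow> wdist x y = wdist y x"
  using word_length_inv[of "inv x \<otimes> y"] by (simp add: word_dist_def inv_mult_group)

lemma word_dist_triangle:
  assumes "x \<in> carrier G" "y \<in> carrier G" "z \<in> carrier G"
  shows "wdist x z \<le> wdist x y + wdist y z"
proof -
  have "inv x \<otimes> z = (inv x \<otimes> y) \<otimes> (inv y \<otimes> z)"
    using assms by (simp add: m_assoc[symmetric]) (simp add: m_assoc)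
  then show ?thesis using word_length_mult[of "inv x \<otimes> y" "inv y \<otimes> z"] assms
    by (simp add: word_dist_def flip: of_nat_add)
qed

lemma word_dist_left:
  assumes "g \<in> carrier G" "x \<in> carrier G" "y \<in> carrier G"
  shows "wdist (g \<otimes> x) (g \<otimes> y) = wdist x y"
proof -
  have "inv (g \<otimes> x) \<otimes> (g \<otimes> y) = inv x \<otimes> (inv g \<otimes> (g \<otimes> y))"
    using assms by (simp add: inv_mult_group m_assoc)
  also have "inv g \<otimes> (g \<otimes> y) = y" using assms by (simp add: m_assoc[symmetric])
  finally show ?thesis by (simp add: word_dist_def)
qed

lemma gprod_eq:
  "x \<in> carrier G \<Longrightarrow> y \<in> carrier G \<Longrightarrow> gprod x y = (wlen x + wlen y - wdist x y) / 2"
  by (simp add: gromov_product_def word_dist_one)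

lemma gprod_commute: "x \<in> carrier G \<Longrightarrow> y \<in> carrier G \<Longrightarrow> gprod x y = gprod y x"
  using word_dist_commute[of x y] by (simp add: gprod_eq)

lemma wlen_le_dist: "x \<in> carrier G \<Longrightarrow> y \<in> carrier G \<Longrightarrow> wlen y \<le> wlen x + wdist x y"
  using word_dist_triangle[of \<one> x y] by (simp add: word_dist_one)

lemma gprod_le: "x \<in> carrier G \<Longrightarrow> y \<in> carrier G \<Longrightarrow> gprod x y \<le> wlen x"
  using wlen_le_dist[of x y] by (simp add: gprod_eq)

text \<open>If x has bounded product with g and g is long, then translation by g^-1 makes g^-1 and
  g^-1 x close as seen from the identity.\<close>

lemma gprod_translate:
  assumes "g \<in> carrier G" "x \<in> carrier G"
  shows "gprod (inv g) (inv g \<otimes> x) = wlen g - gprod x g"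
proof -
  have "wdist (inv g) (inv g \<otimes> x) = wlen x"
    using word_dist_left[of "inv g" \<one> x] assms by (simp add: word_dist_one)
  moreover have "wlen (inv g \<otimes> x) = wdist g x" by (simp add: word_dist_def)
  ultimately show ?thesis using assms word_dist_commute[of g x] by (simp add: gprod_eq field_simps)
qed

text \<open>Prefixes of a shortest word for x^-1 y. Upper bounds on the two distances suffice: they
  add up to \<open>wdist x y\<close>, so the triangle inequality makes them equalities.\<close>

lemma geodesic:
  assumes x: "x \<in> carrier G" and y: "y \<in> carrier G"
  obtains z n where "wdist x y = real n" "z 0 = x" "z n = y"
    "\<And>i. z i \<in> carrier G" "\<And>i. i < n \<Longrightarrow> \<exists>s\<in>letters. z (Suc i) = z i \<otimes> s"
    "\<And>i. i \<le> n \<Longrightarrow> wdist x (z i) \<le> real i" "\<And>i. i \<le> n \<Longrightarrow> wdist (z i) y \<le> real (n - i)"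
proof -
  obtain w where w: "length w = word_length G S (inv x \<otimes> y)" "set w \<subseteq> letters" "wprod w = inv x \<otimes> y"
    using word_length_word[of "inv x \<otimes> y"] x y by blast
  define n where "n = length w"
  define z where "z i = x \<otimes> wprod (take i w)" for i
  have tk: "set (take i w) \<subseteq> letters" "set (drop i w) \<subseteq> letters" for i
    using w(2) set_take_subset[of i w] set_drop_subset[of i w] by blast+
  note cl = wprod_closed[OF tk(1)] wprod_closed[OF tk(2)]
  have split: "wprod w = wprod (take i w) \<otimes> wprod (drop i w)" for i
    using wprod_append[OF tk] by (metis append_take_drop_id)
  show ?thesis
  proof (rule that[of n z])
    show "wdist x y = real n" using w by (simp add: n_def word_dist_def)
    show "z 0 = x" using x by (simp add: z_def)
    show "z n = y" using x y w(3) by (simp add: z_def n_def m_assoc[symmetric])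
    show zc: "z i \<in> carrier G" for i using x cl by (simp add: z_def)
    show "\<exists>s\<in>letters. z (Suc i) = z i \<otimes> s" if "i < n" for i
    proof (intro bexI)
      show il: "w ! i \<in> letters" using that w(2) nth_mem[of i w] unfolding n_def by blast
      then have ic: "w ! i \<in> carrier G" using letters_closed by blast
      then have "wprod (take (Suc i) w) = wprod (take i w) \<otimes> w ! i"
        using that il wprod_append[OF tk(1)[of i], of "[w ! i]"]
        by (simp add: take_Suc_conv_app_nth n_def del: foldr_append)
      then show "z (Suc i) = z i \<otimes> w ! i"
        using x cl ic by (simp add: z_def m_assoc)
    qed
    show "wdist x (z i) \<le> real i" if "i \<le> n" for i
    proof -
      have "inv x \<otimes> z i = wprod (take i w)" using x cl by (simp add: z_def m_assoc[symmetric])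
      then show ?thesis using word_length_le[OF tk(1) refl, of i] by (simp add: word_dist_def)
    qed
    show "wdist (z i) y \<le> real (n - i)" if "i \<le> n" for i
    proof -
      have "y = x \<otimes> wprod w" using x y w(3) by (simp add: m_assoc[symmetric])
      also have "\<dots> = z i \<otimes> wprod (drop i w)" using x cl by (simp add: z_def split[of i] m_assoc)
      finally have "inv (z i) \<otimes> y = wprod (drop i w)" using zc cl by (simp add: m_assoc[symmetric])
      then show ?thesis using word_length_le[OF tk(2) refl, of i] by (simp add: word_dist_def n_def)
    qed
  qed
qed

text \<open>Along a geodesic from \<open>x\<close> to \<open>y\<close> the word length is at least the Gromov product and grows
  linearly away from the point where it is smallest, so the steps sum to a geometric series.\<close>

lemma dist_le_exp_gprod:
  fixes f :: "'g \<Rightarrow> 'g \<Rightarrow> real"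
  assumes refl: "\<And>x. f x x = 0" and tri: "\<And>x y z. f x z \<le> f x y + f y z"
    and step: "\<And>g s. g \<in> carrier G \<Longrightarrow> s \<in> letters \<Longrightarrow> f g (g \<otimes> s) \<le> C * exp (- \<mu> * wlen g)"
    and C: "0 \<le> C" and \<mu>: "0 < \<mu>" and x: "x \<in> carrier G" and y: "y \<in> carrier G"
  shows "f x y \<le> C / (1 - exp (- \<mu>)) * (1 + exp \<mu>) * exp (- \<mu> * gprod x y)"
proof -
  obtain z n where n: "wdist x y = real n" and z: "z 0 = x" "z n = y" "\<And>i. z i \<in> carrier G"
    and s: "\<And>i. i < n \<Longrightarrow> \<exists>s\<in>letters. z (Suc i) = z i \<otimes> s"
    and dx: "\<And>i. i \<le> n \<Longrightarrow> wdist x (z i) \<le> real i"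
    and dy: "\<And>i. i \<le> n \<Longrightarrow> wdist (z i) y \<le> real (n - i)"
    using geodesic[OF x y] by metis
  \<comment> \<open>The sum of the geometric series with first term C. The relation C = B - B exp (-
    \<mu>) lets both inductions close with one constant.\<close>
  define B where "B = C / (1 - exp (- \<mu>))"
  have q: "0 < 1 - exp (- \<mu>)" using \<mu> by simp
  then have B: "0 \<le> B" and "C = B * (1 - exp (- \<mu>))" using C by (simp_all add: B_def)
  then have CB: "C = B - B * exp (- \<mu>)" by (simp add: algebra_simps)
  have st: "f (z i) (z (Suc i)) \<le> C * exp (- \<mu> * wlen (z i))" if "i < n" for i
    using s[OF that] step[OF z(3)] by metis
  define a b where "a = word_length G S x" and "b = word_length G S y"
  have fwd: "f x (z i) \<le> B * exp (- \<mu> * (real a - real i))" if "i \<le> n" for i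
    using that
  proof (induction i)
    case 0 then show ?case using refl z B by simp
  next
    case (Suc i)
    have "real a - real i \<le> wlen (z i)" using wlen_le_dist[OF z(3)[of i] x] dx[of i] Suc.prems
        word_dist_commute[OF x z(3)] by (simp add: a_def)
    then have "C * exp (- \<mu> * wlen (z i)) \<le> C * exp (- \<mu> * (real a - real i))"
      using \<mu> C by (intro mult_left_mono) auto
    then have "f x (z (Suc i)) \<le> B * exp (- \<mu> * (real a - real i)) + C * exp (- \<mu> * (real a - real i))"
      using tri[of x "z (Suc i)" "z i"] st[of i] Suc by simp
    also have "\<dots> \<le> B * exp (- \<mu> * (real a - real (Suc i)))"
    proof -
      have e: "exp (- \<mu> * (real a - real i)) = exp (- \<mu>) * exp (- \<mu> * (real a - real (Suc i)))"
        by (simp add: exp_add[symmetric] algebra_simps)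
      \<comment> \<open>After substituting C this says B (1 - exp (- \<mu>))^2 >= 0.\<close>
      have "(B + C) * exp (- \<mu>) \<le> B"
      proof -
        have "0 \<le> B * (1 - exp (- \<mu>))\<^sup>2" using B by simp
        then show ?thesis by (simp add: CB power2_eq_square algebra_simps)
      qed
      from mult_right_mono[OF this, of "exp (- \<mu> * (real a - real (Suc i)))"]
      show ?thesis unfolding e by (simp add: algebra_simps)
    qed
    finally show ?case .
  qed
  have bwd: "f (z (n - i)) y \<le> B * exp (- \<mu> * (real b - real i))" if "i \<le> n" for i
    using that
  proof (induction i)
    case 0 then show ?case using refl z B by simp
  next
    case (Suc i)
    define j where "j = n - Suc i"
    have j: "j < n" "Suc j = n - i" "n - j = Suc i" using Suc.prems by (auto simp: j_def)
    have "real b - real (Suc i) \<le> wlen (z j)" using wlen_le_dist[OF z(3)[of j] y] dy[of j] j by (simp add: b_def)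
    then have "C * exp (- \<mu> * wlen (z j)) \<le> C * exp (- \<mu> * (real b - real (Suc i)))"
      using \<mu> C by (intro mult_left_mono) auto
    then have "f (z j) y \<le> B * exp (- \<mu> * (real b - real i)) + C * exp (- \<mu> * (real b - real (Suc i)))"
      using tri[of "z j" y "z (Suc j)"] st[of j] Suc j by simp
    also have "\<dots> = B * exp (- \<mu> * (real b - real (Suc i)))"
    proof -
      have e: "exp (- \<mu> * (real b - real i)) = exp (- \<mu>) * exp (- \<mu> * (real b - real (Suc i)))"
        by (simp add: exp_add[symmetric] algebra_simps)
      show ?thesis unfolding e CB by (simp add: algebra_simps)
    qed
    finally show ?case by (simp add: j_def)
  qed
  have tri1: "b \<le> a + n" "a \<le> b + n" "n \<le> a + b"
    using wlen_le_dist[OF x y] wlen_le_dist[OF y x] word_dist_commute[OF x y] n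
      word_dist_triangle[OF x one_closed y] word_dist_commute[OF x one_closed]
    by (simp_all add: a_def b_def word_dist_one x y)
  \<comment> \<open>Without rounding, a - m and b - (n - m) both equal the Gromov product. Rounding
    down favours the first and costs the second at most 1/2; a cost of 1 is allowed, which is where
    \<open>exp \<mu>\<close> comes from.\<close>
  define m where "m = (n + a - b) div 2"
  have m: "m \<le> n" "2 * m \<le> n + a - b" "n + a - b \<le> 2 * m + 1" using tri1 by (auto simp: m_def)
  have gp: "gprod x y = (real a + real b - real n) / 2" using gprod_eq[OF x y] n by (simp add: a_def b_def)
  have "f x y \<le> B * exp (- \<mu> * (real a - real m)) + B * exp (- \<mu> * (real b - real (n - m)))"
    using tri[of x y "z m"] fwd[of m] bwd[of "n - m"] m by simp
  also have "\<dots> \<le> B * exp (- \<mu> * gprod x y) + B * exp (- \<mu> * (gprod x y - 1))"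
  proof (intro add_mono mult_left_mono B)
    have "gprod x y \<le> real a - real m" "gprod x y - 1 \<le> real b - real (n - m)"
      using m tri1 by (simp_all add: gp field_simps of_nat_diff)
    then show "exp (- \<mu> * (real a - real m)) \<le> exp (- \<mu> * gprod x y)"
      "exp (- \<mu> * (real b - real (n - m))) \<le> exp (- \<mu> * (gprod x y - 1))" using \<mu> by auto
  qed
  also have "\<dots> = B * (1 + exp \<mu>) * exp (- \<mu> * gprod x y)"
  proof -
    have "exp (- \<mu> * (gprod x y - 1)) = exp \<mu> * exp (- \<mu> * gprod x y)"
      by (simp add: exp_add[symmetric] algebra_simps)
    then show ?thesis by (simp only: algebra_simps)
  qed
  finally show ?thesis by (simp add: B_def)
qed

end

section \<open>Sequences converging to infinity\<close>

context word_metric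
begin

abbreviation "seq_asymp \<equiv> gromov_asymptotic (word_dist G S) \<one>"
abbreviation "gseqs \<equiv> gromov_sequences (carrier G) (word_dist G S) \<one>"

lemma asymp_iff: "seq_asymp x y \<longleftrightarrow> (\<forall>r. \<exists>n. \<forall>i\<ge>n. \<forall>j\<ge>n. r \<le> gprod (x i) (y j))"
  unfolding gromov_asymptotic_def filterlim_at_top
  by (simp add: eventually_prod_sequentially case_prod_beta') blast

lemma gseqs_carrier: "x \<in> gseqs \<Longrightarrow> x i \<in> carrier G"
  by (auto simp: gromov_sequences_def)

lemma gseqs_asymp: "x \<in> gseqs \<Longrightarrow> seq_asymp x x"
  by (simp add: gromov_sequences_def)

lemma asymp_commute: "x \<in> gseqs \<Longrightarrow> y \<in> gseqs \<Longrightarrow> seq_asymp x y \<Longrightarrow> seq_asymp y x"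
  unfolding asymp_iff using gprod_commute gseqs_carrier by metis

end

locale hyperbolic_word_metric = word_metric G S for G :: "('g, 'm) monoid_scheme" (structure) and S +
  assumes hyp: "gromov_hyperbolic (carrier G) (word_dist G S)"
begin

lemma hyp_gprod: "\<exists>\<delta>\<ge>0. \<forall>x\<in>carrier G. \<forall>y\<in>carrier G. \<forall>z\<in>carrier G.
    min (gprod x y) (gprod y z) - \<delta> \<le> gprod x z"
  using hyp unfolding gromov_hyperbolic_def by (meson one_closed)

lemma asymp_trans:
  assumes x: "x \<in> gseqs" and y: "y \<in> gseqs" and z: "z \<in> gseqs" and "seq_asymp x y" "seq_asymp y z"
  shows "seq_asymp x z"
  unfolding asymp_iff
proof
  fix r
  obtain \<delta> where d: "\<And>x y z. x \<in> carrier G \<Longrightarrow> y \<in> carrier G \<Longrightarrow> z \<in> carrier G \<Longrightarrow>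
    min (gprod x y) (gprod y z) - \<delta> \<le> gprod x z" using hyp_gprod by blast
  obtain n m where nm: "\<forall>i\<ge>n. \<forall>j\<ge>n. r + \<delta> \<le> gprod (x i) (y j)" "\<forall>i\<ge>m. \<forall>j\<ge>m. r + \<delta> \<le> gprod (y i) (z j)"
    using assms(4,5) unfolding asymp_iff by metis
  show "\<exists>n. \<forall>i\<ge>n. \<forall>j\<ge>n. r \<le> gprod (x i) (z j)"
  proof (intro exI allI impI)
    fix i j assume "max n m \<le> i" "max n m \<le> j"
    then show "r \<le> gprod (x i) (z j)"
      using nm(1)[rule_format, of i "max n m"] nm(2)[rule_format, of "max n m" j]
        d[OF gseqs_carrier[OF x, of i] gseqs_carrier[OF y, of "max n m"] gseqs_carrier[OF z, of j]]
      by (simp add: min_def split: if_splits)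
  qed
qed

text \<open>Two uses of the four-point inequality transfer a large product from one late pair of
  points to every late pair, with loss 2 \<delta>. Since arbitrarily late pairs stay below r, no
  late pair exceeds r + 2 \<delta>.\<close>

lemma not_asymp_bounded:
  assumes x: "x \<in> gseqs" and y: "y \<in> gseqs" and na: "\<not> seq_asymp x y"
  shows "\<exists>R n. \<forall>i\<ge>n. \<forall>j\<ge>n. gprod (x i) (y j) \<le> R"
proof -
  obtain \<delta> where d0: "0 \<le> \<delta>" and d: "\<And>x y z. x \<in> carrier G \<Longrightarrow> y \<in> carrier G \<Longrightarrow> z \<in> carrier G \<Longrightarrow>
    min (gprod x y) (gprod y z) - \<delta> \<le> gprod x z" using hyp_gprod by blast
  obtain r where r: "\<And>n. \<exists>i\<ge>n. \<exists>j\<ge>n. gprod (x i) (y j) < r"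
    using na unfolding asymp_iff by (auto simp: not_le)
  let ?R = "r + 2 * \<delta>"
  obtain n m where nm: "\<forall>i\<ge>n. \<forall>j\<ge>n. ?R \<le> gprod (x i) (x j)" "\<forall>i\<ge>m. \<forall>j\<ge>m. ?R \<le> gprod (y i) (y j)"
    using gseqs_asymp[OF x] gseqs_asymp[OF y] unfolding asymp_iff by metis
  let ?n = "max n m"
  have "gprod (x i) (y j) \<le> ?R" if ij: "?n \<le> i" "?n \<le> j" for i j
  proof (rule ccontr)
    assume c: "\<not> ?thesis"
    obtain i' j' where "?n \<le> i'" "?n \<le> j'" "gprod (x i') (y j') < r" using r by blast
    moreover note gx = gseqs_carrier[OF x] and gy = gseqs_carrier[OF y]
    ultimately show False
      using nm(1)[rule_format, of i' i] nm(2)[rule_format, of j j'] ij c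
        d[OF gx[of i'] gx[of i] gy[of j']] d[OF gx[of i] gy[of j] gy[of j']] d0
      by (simp add: min_def split: if_splits)
  qed
  then show ?thesis by blast
qed

end

section \<open>Proximal representations preserving an alternating form\<close>

text \<open>\<open>\<tau> \<one>\<close> need not be the identity but only an idempotent; the vectors of interest are those
  in its image. The assumption on the \<open>2 \<times> 2\<close> minors says that \<open>\<tau> g\<close> is exponentially close to
  having rank one.\<close>

locale rank_one_rep = hyperbolic_word_metric G S for G :: "('g, 'm) monoid_scheme" (structure) and S +
  fixes I :: "'i set" and \<tau> :: "'g \<Rightarrow> 'i \<Rightarrow> 'i \<Rightarrow> complex" and J :: "'i \<Rightarrow> 'i \<Rightarrow> complex"
    and C\<^sub>0 \<mu> K :: real
  assumes finS: "finite S"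
    and finI: "finite I"
    and tau_support: "i \<notin> I \<or> j \<notin> I \<Longrightarrow> \<tau> g i j = 0"
    and tau_mult: "g \<in> carrier G \<Longrightarrow> h \<in> carrier G \<Longrightarrow> \<tau> (g \<otimes> h) i j = (\<Sum>l\<in>I. \<tau> g i l * \<tau> h l j)"
    and tau_nonzero: "\<exists>i j. \<tau> \<one> i j \<noteq> 0"
    and C0: "0 \<le> C\<^sub>0" and mu: "0 < \<mu>" and K: "0 \<le> K"
    and tau_minors: "g \<in> carrier G \<Longrightarrow> i \<in> I \<Longrightarrow> j \<in> I \<Longrightarrow> p \<in> I \<Longrightarrow> l \<in> I \<Longrightarrow>
      cmod (\<tau> g i j * \<tau> g p l - \<tau> g i l * \<tau> g p j) \<le> C\<^sub>0 * exp (- \<mu> * wlen g) * (mnorm I (\<tau> g))\<^sup>2"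
    and J_invariant: "g \<in> carrier G \<Longrightarrow> i \<in> I \<Longrightarrow> j \<in> I \<Longrightarrow>
      (\<Sum>p\<in>I. \<Sum>r\<in>I. \<tau> g p i * J p r * \<tau> g r j) = J i j"
    and J_antisym: "i \<in> I \<Longrightarrow> j \<in> I \<Longrightarrow> J i j = - J j i"
    and J_nondeg: "i \<in> I \<Longrightarrow> cmod (mapply I (\<tau> \<one>) u i) \<le> K * vnorm I (mapply I J u)"
begin

abbreviation "N g \<equiv> mnorm I (\<tau> g)"
abbreviation "D \<equiv> real (card I)"

lemma tau_mapply_mult:
  assumes "g \<in> carrier G" "h \<in> carrier G"
  shows "mapply I (\<tau> (g \<otimes> h)) u = mapply I (\<tau> g) (mapply I (\<tau> h) u)"
  unfolding mapply_def tau_mult[OF assms] sum_distrib_left sum_distrib_right mult.assoc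
  by (rule ext, rule sum.swap)

lemma tau_column_mult:
  "g \<in> carrier G \<Longrightarrow> h \<in> carrier G \<Longrightarrow> (\<lambda>i. \<tau> (g \<otimes> h) i j) = mapply I (\<tau> g) (\<lambda>i. \<tau> h i j)"
  by (simp add: mapply_def tau_mult)

lemma N_mult_le: "g \<in> carrier G \<Longrightarrow> h \<in> carrier G \<Longrightarrow> N (g \<otimes> h) \<le> N g * N h"
  by (intro mnorm_mult_le finI) (simp add: tau_mult)

lemma card_pos: "0 < D"
  using tau_nonzero tau_support finI card_gt_0_iff by (metis empty_iff of_nat_0_less_iff)

lemma N_pos: assumes g: "g \<in> carrier G" shows "0 < N g"
proof -
  obtain i j where ij: "\<tau> \<one> i j \<noteq> 0" using tau_nonzero by blast
  then have "i \<in> I" "j \<in> I" using tau_support by blast+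
  then have "0 < N \<one>" using cmod_le_mnorm[OF finI, of i j "\<tau> \<one>"] ij by (smt (verit) zero_less_norm_iff)
  also have "N \<one> \<le> N g * N (inv g)" using N_mult_le[of g "inv g"] g by simp
  finally show ?thesis using mnorm_nonneg[of I "\<tau> g"] by (metis less_eq_real_def mult_zero_left less_irrefl)
qed

lemma ex_large_column: "\<exists>j\<in>I. N g \<le> D * vnorm I (\<lambda>i. \<tau> g i j)"
proof (rule ccontr)
  assume "\<not> ?thesis"
  then have *: "\<And>j. j \<in> I \<Longrightarrow> vnorm I (\<lambda>i. \<tau> g i j) < N g / D" using card_pos by (fastforce simp: field_simps)
  have "N g < (\<Sum>j\<in>I. N g / D)"
    unfolding mnorm_columns[of I "\<tau> g"] using * finI card_pos
    by (intro sum_strict_mono) (auto simp: mnorm_columns[symmetric])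
  then show False using card_pos by simp
qed

section \<open>Dominant directions of group elements\<close>

definition pivot :: "'g \<Rightarrow> 'i" where
  "pivot g = (SOME j. j \<in> I \<and> N g \<le> D * vnorm I (\<lambda>i. \<tau> g i j))"

definition top_norm :: "'g \<Rightarrow> real" where
  "top_norm g = vnorm I (\<lambda>i. \<tau> g i (pivot g))"

text \<open>A substitute for the leading left singular vector. Being a rescaled column it lies in
  the image of \<open>\<tau> \<one>\<close>, and \<open>pivot\<close> picks a column of at least
  average norm, so that normalising loses only a factor \<open>D\<close>.\<close>

definition top_dir :: "'g \<Rightarrow> 'i \<Rightarrow> complex" where
  "top_dir g = (\<lambda>i. inverse (of_real (top_norm g)) * \<tau> g i (pivot g))"

lemma pivot: "pivot g \<in> I" "N g \<le> D * top_norm g"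
  using someI_ex[OF ex_large_column[of g, unfolded Bex_def]] unfolding pivot_def top_norm_def by blast+

lemma top_norm_pos: "g \<in> carrier G \<Longrightarrow> 0 < top_norm g"
  using order.strict_trans2[OF N_pos pivot(2)] card_pos by (simp add: zero_less_mult_iff)

lemma pivot_column: "g \<in> carrier G \<Longrightarrow> \<tau> g i (pivot g) = of_real (top_norm g) * top_dir g i"
  using top_norm_pos[of g] by (simp add: top_dir_def field_simps)

lemma vnorm_top_dir [simp]: "g \<in> carrier G \<Longrightarrow> vnorm I (top_dir g) = 1"
  unfolding top_dir_def vnorm_scale using top_norm_pos[of g] by (simp add: top_norm_def norm_inverse)

lemma tau_one_top_dir: "g \<in> carrier G \<Longrightarrow> mapply I (\<tau> \<one>) (top_dir g) = top_dir g"
  unfolding top_dir_def mapply_scale using tau_column_mult[of \<one> g "pivot g"] by simp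

text \<open>Divide a 2 x 2 minor through the pivot column by a large entry of that column: the
  quotient is an entry of column j minus a multiple of the dominant direction. The entry is at least
  \<open>N g\<close> / D^2, and summing over the rows gives the third factor D.\<close>

lemma column_near_top_dir:
  assumes g: "g \<in> carrier G" and j: "j \<in> I"
  obtains c where "vnorm I (\<lambda>i. \<tau> g i j - c * top_dir g i) \<le> D ^ 3 * C\<^sub>0 * exp (- \<mu> * wlen g) * N g"
proof -
  obtain p where p: "p \<in> I" "1 / D \<le> cmod (top_dir g p)"
    using obtain_large_coordinate[OF finI vnorm_top_dir[OF g]] .
  let ?j = "pivot g"
  have piv: "N g / D\<^sup>2 \<le> cmod (\<tau> g p ?j)"
  proof -
    have "N g / D\<^sup>2 \<le> top_norm g * (1 / D)" using pivot(2)[of g] card_pos by (simp add: field_simps power2_eq_square)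
    also have "\<dots> \<le> top_norm g * cmod (top_dir g p)" using p top_norm_pos[OF g] by (intro mult_left_mono) auto
    finally show ?thesis using top_norm_pos[OF g] by (simp add: pivot_column g norm_mult)
  qed
  then have pp: "0 < cmod (\<tau> g p ?j)" using N_pos[OF g] card_pos by (smt (verit) divide_pos_pos zero_less_power)
  define c where "c = \<tau> g p j / \<tau> g p ?j * of_real (top_norm g)"
  have "cmod (\<tau> g i j - c * top_dir g i) \<le> D\<^sup>2 * C\<^sub>0 * exp (- \<mu> * wlen g) * N g" if i: "i \<in> I" for i
  proof -
    have "\<tau> g i j - c * top_dir g i = (\<tau> g i j * \<tau> g p ?j - \<tau> g i ?j * \<tau> g p j) / \<tau> g p ?j"
      using pp by (simp add: c_def pivot_column[OF g, of i] field_simps)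
    also have "cmod \<dots> \<le> C\<^sub>0 * exp (- \<mu> * wlen g) * (N g)\<^sup>2 / cmod (\<tau> g p ?j)"
      unfolding norm_divide by (intro divide_right_mono tau_minors g i j p pivot) auto
    also have "\<dots> \<le> C\<^sub>0 * exp (- \<mu> * wlen g) * (N g)\<^sup>2 / (N g / D\<^sup>2)"
      using piv C0 N_pos[OF g] card_pos pp by (intro divide_left_mono mult_pos_pos divide_pos_pos) auto
    also have "\<dots> = D\<^sup>2 * C\<^sub>0 * exp (- \<mu> * wlen g) * N g"
      using N_pos[OF g] card_pos by (simp add: field_simps power2_eq_square)
    finally show ?thesis .
  qed
  then have "vnorm I (\<lambda>i. \<tau> g i j - c * top_dir g i) \<le> (\<Sum>i\<in>I. D\<^sup>2 * C\<^sub>0 * exp (- \<mu> * wlen g) * N g)"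
    unfolding vnorm_def by (rule sum_mono)
  then show ?thesis using that[of c] by (simp add: power3_eq_cube power2_eq_square mult_ac)
qed

lemma mapply_near_top_dir:
  assumes g: "g \<in> carrier G"
  obtains c where "vnorm I (\<lambda>i. mapply I (\<tau> g) v i - c * top_dir g i)
    \<le> D ^ 3 * C\<^sub>0 * exp (- \<mu> * wlen g) * N g * vnorm I v"
proof -
  let ?B = "D ^ 3 * C\<^sub>0 * exp (- \<mu> * wlen g) * N g"
  have "\<forall>j\<in>I. \<exists>c. vnorm I (\<lambda>i. \<tau> g i j - c * top_dir g i) \<le> ?B"
    using column_near_top_dir[OF g] by metis
  then obtain c where c: "\<And>j. j \<in> I \<Longrightarrow> vnorm I (\<lambda>i. \<tau> g i j - c j * top_dir g i) \<le> ?B" by metis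
  have "vnorm I (\<lambda>i. mapply I (\<tau> g) v i - (\<Sum>j\<in>I. c j * v j) * top_dir g i)
      = vnorm I (\<lambda>i. \<Sum>j\<in>I. (\<tau> g i j - c j * top_dir g i) * v j)"
    unfolding mapply_def left_diff_distrib sum_subtractf sum_distrib_right by (simp only: mult_ac)
  also have "\<dots> \<le> (\<Sum>i\<in>I. \<Sum>j\<in>I. cmod (\<tau> g i j - c j * top_dir g i) * cmod (v j))"
    unfolding vnorm_def norm_mult[symmetric] by (intro sum_mono norm_sum)
  also have "\<dots> = (\<Sum>j\<in>I. vnorm I (\<lambda>i. \<tau> g i j - c j * top_dir g i) * cmod (v j))"
    by (subst sum.swap) (simp add: vnorm_def sum_distrib_right)
  also have "\<dots> \<le> (\<Sum>j\<in>I. ?B * cmod (v j))" by (intro sum_mono mult_right_mono c) auto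
  also have "\<dots> = ?B * vnorm I v" by (simp add: vnorm_def sum_distrib_left)
  finally show ?thesis using that by blast
qed

lemma letters_bound: "\<exists>L\<ge>1. \<forall>s\<in>letters. N s \<le> L"
proof -
  have "finite (N ` letters)" using finS by simp
  then have "N s \<le> Max (insert 1 (N ` letters))" if "s \<in> letters" for s
    using that by (intro Max_ge) auto
  moreover have "1 \<le> Max (insert 1 (N ` letters))" using \<open>finite (N ` letters)\<close> by (intro Max_ge) auto
  ultimately show ?thesis by blast
qed

text \<open>A column of \<open>\<tau> (g \<otimes> s)\<close> is \<open>\<tau> g\<close> applied to
  a vector, hence near the dominant line of g. The error has to be small relative to that column; as
  s is a letter, \<open>N g\<close> exceeds the norm of \<open>\<tau> (g \<otimes> s)\<close> by at
  most a bounded factor.\<close>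

lemma top_dir_step:
  obtains C where "0 \<le> C" "\<And>g s. g \<in> carrier G \<Longrightarrow> s \<in> letters \<Longrightarrow>
    mnorm I (\<lambda>i j. line_proj (top_dir g) i j - line_proj (top_dir (g \<otimes> s)) i j) \<le> C * exp (- \<mu> * wlen g)"
proof -
  obtain L where L: "1 \<le> L" "\<And>s. s \<in> letters \<Longrightarrow> N s \<le> L" using letters_bound by blast
  let ?C = "D * L\<^sup>2 * (D ^ 3 * C\<^sub>0)"
  show ?thesis
  proof (rule that[of "6 * ?C"])
    show "0 \<le> 6 * ?C" using C0 by simp
    fix g s assume g: "g \<in> carrier G" and s: "s \<in> letters"
    have sc: "s \<in> carrier G" using s letters_closed by blast
    then have gs: "g \<otimes> s \<in> carrier G" using g by simp
    define a where "a = top_norm (g \<otimes> s)"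
    have a: "0 < a" using top_norm_pos[OF gs] by (simp add: a_def)
    define v where "v = (\<lambda>i. \<tau> s i (pivot (g \<otimes> s)))"
    have v: "vnorm I v \<le> L" using order_trans[OF vnorm_column_le[OF finI pivot(1)] L(2)[OF s]] by (simp add: v_def)
    obtain c where c: "vnorm I (\<lambda>i. mapply I (\<tau> g) v i - c * top_dir g i)
      \<le> D ^ 3 * C\<^sub>0 * exp (- \<mu> * wlen g) * N g * vnorm I v" using mapply_near_top_dir[OF g] .
    have top: "top_dir (g \<otimes> s) = (\<lambda>i. inverse (of_real a) * mapply I (\<tau> g) v i)"
      using tau_column_mult[OF g sc, of "pivot (g \<otimes> s)"] by (simp add: top_dir_def a_def v_def fun_eq_iff)
    have "vnorm I (\<lambda>i. top_dir (g \<otimes> s) i - (inverse (of_real a) * c) * top_dir g i)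
        = vnorm I (\<lambda>i. inverse (of_real a) * (mapply I (\<tau> g) v i - c * top_dir g i))"
      by (simp add: top algebra_simps)
    also have "\<dots> = inverse a * vnorm I (\<lambda>i. mapply I (\<tau> g) v i - c * top_dir g i)"
      unfolding vnorm_scale using a by (simp add: norm_inverse)
    also have "\<dots> \<le> inverse a * (D ^ 3 * C\<^sub>0 * exp (- \<mu> * wlen g) * N g * L)"
      using a C0 v by (intro mult_left_mono order_trans[OF c]) auto
    also have "\<dots> = (D ^ 3 * C\<^sub>0 * exp (- \<mu> * wlen g) * L) * (inverse a * N g)" by (simp add: mult_ac)
    also have "\<dots> \<le> (D ^ 3 * C\<^sub>0 * exp (- \<mu> * wlen g) * L) * (D * L)"
    proof (intro mult_left_mono)
      have "g = g \<otimes> s \<otimes> inv s" using g sc by (simp add: m_assoc)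
      then have "N g \<le> N (g \<otimes> s) * N (inv s)" using N_mult_le[OF gs, of "inv s"] sc by simp
      also have "\<dots> \<le> (D * a) * L"
        using pivot(2)[of "g \<otimes> s"] L(2)[OF letters_inv[OF s]] a by (intro mult_mono) (auto simp: a_def)
      finally show "inverse a * N g \<le> D * L" using a by (simp add: field_simps)
    qed (use C0 L in auto)
    also have "\<dots> = ?C * exp (- \<mu> * wlen g)" by (simp add: power2_eq_square mult_ac)
    finally have "mnorm I (\<lambda>i j. line_proj (top_dir (g \<otimes> s)) i j - line_proj (top_dir g) i j) \<le> 6 * (?C * exp (- \<mu> * wlen g))"
      using g gs by (intro line_proj_close) auto
    then show "mnorm I (\<lambda>i j. line_proj (top_dir g) i j - line_proj (top_dir (g \<otimes> s)) i j) \<le> 6 * ?C * exp (- \<mu> * wlen g)"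
      by (simp add: mnorm_diff_commute[of I "line_proj (top_dir g)"] mult.assoc)
  qed
qed

definition line_dist :: "('i \<Rightarrow> complex) \<Rightarrow> ('i \<Rightarrow> complex) \<Rightarrow> real" where
  "line_dist u v = mnorm I (\<lambda>i j. line_proj u i j - line_proj v i j)"

lemma line_dist_triangle: "line_dist u w \<le> line_dist u v + line_dist v w"
  unfolding line_dist_def by (rule mnorm_diff_triangle)

lemma line_dist_commute: "line_dist u v = line_dist v u"
  unfolding line_dist_def by (rule mnorm_diff_commute)

lemma line_dist_self [simp]: "line_dist u u = 0"
  by (simp add: line_dist_def mnorm_def)

lemma line_dist_nonneg [simp]: "0 \<le> line_dist u v"
  by (simp add: line_dist_def)

lemma top_dir_gprod:
  obtains C where "0 < C" "\<And>x y. x \<in> carrier G \<Longrightarrow> y \<in> carrier G \<Longrightarrow>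
    line_dist (top_dir x) (top_dir y) \<le> C * exp (- \<mu> * gprod x y)"
proof -
  obtain C where C: "0 \<le> C" "\<And>g s. g \<in> carrier G \<Longrightarrow> s \<in> letters \<Longrightarrow>
    line_dist (top_dir g) (top_dir (g \<otimes> s)) \<le> C * exp (- \<mu> * wlen g)"
    using top_dir_step unfolding line_dist_def by blast
  let ?C = "C / (1 - exp (- \<mu>)) * (1 + exp \<mu>)"
  have "0 \<le> ?C" using C(1) mu by (simp add: add_nonneg_nonneg)
  moreover have "line_dist (top_dir x) (top_dir y) \<le> ?C * exp (- \<mu> * gprod x y)"
    if "x \<in> carrier G" "y \<in> carrier G" for x y
    by (rule dist_le_exp_gprod[where f = "\<lambda>x y. line_dist (top_dir x) (top_dir y)"])
       (use that C mu line_dist_triangle in auto)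
  \<comment> \<open>The summand 1 makes the constant positive, so that \<open>exp_small\<close> may
    divide by it.\<close>
  ultimately show ?thesis using that[of "?C + 1"]
    by (smt (verit) mult_right_mono exp_ge_zero)
qed

text \<open>\<open>\<tau> g\<close> sends the dominant direction of h to a multiple of a column of
  \<open>\<tau> (g \<otimes> h)\<close>, which is close to the dominant line of the product. So
  dominant lines are equivariant up to an error that decays with the length of the product.\<close>

lemma tau_top_dir:
  assumes g: "g \<in> carrier G" and h: "h \<in> carrier G"
  obtains c where "vnorm I (\<lambda>i. mapply I (\<tau> g) (top_dir h) i - c * top_dir (g \<otimes> h) i)
    \<le> D ^ 4 * C\<^sub>0 * N g * exp (- \<mu> * wlen (g \<otimes> h))"
proof -
  have gh: "g \<otimes> h \<in> carrier G" using g h by simp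
  define a where "a = top_norm h"
  have a: "0 < a" using top_norm_pos[OF h] by (simp add: a_def)
  let ?B = "D ^ 3 * C\<^sub>0 * exp (- \<mu> * wlen (g \<otimes> h))"
  obtain c where c: "vnorm I (\<lambda>i. \<tau> (g \<otimes> h) i (pivot h) - c * top_dir (g \<otimes> h) i) \<le> ?B * N (g \<otimes> h)"
    using column_near_top_dir[OF gh pivot(1)] .
  have "mapply I (\<tau> g) (top_dir h) = (\<lambda>i. inverse (of_real a) * \<tau> (g \<otimes> h) i (pivot h))"
    unfolding top_dir_def mapply_scale a_def using tau_column_mult[OF g h, of "pivot h"]
    by (simp add: fun_eq_iff)
  then have "vnorm I (\<lambda>i. mapply I (\<tau> g) (top_dir h) i - (inverse (of_real a) * c) * top_dir (g \<otimes> h) i)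
      = vnorm I (\<lambda>i. inverse (of_real a) * (\<tau> (g \<otimes> h) i (pivot h) - c * top_dir (g \<otimes> h) i))"
    by (simp add: algebra_simps)
  also have "\<dots> = inverse a * vnorm I (\<lambda>i. \<tau> (g \<otimes> h) i (pivot h) - c * top_dir (g \<otimes> h) i)"
    unfolding vnorm_scale using a by (simp add: norm_inverse)
  also have "\<dots> \<le> inverse a * (?B * (N g * N h))"
    using a C0 by (intro mult_left_mono order_trans[OF c] N_mult_le g h) auto
  also have "\<dots> = (?B * N g) * (inverse a * N h)" by (simp add: mult_ac)
  also have "\<dots> \<le> (?B * N g) * D"
    using pivot(2)[of h] a C0 by (intro mult_left_mono) (auto simp: field_simps a_def)
  also have "\<dots> = D ^ 4 * C\<^sub>0 * N g * exp (- \<mu> * wlen (g \<otimes> h))" by (simp add: power4_eq_xxxx power3_eq_cube mult_ac)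
  finally show ?thesis using that by blast
qed

section \<open>The invariant form and inverses\<close>

text \<open>With P = \<open>\<tau> \<one>\<close> the invariance reads J = P^T J P. Since P is
  idempotent, multiplying by P on the right changes nothing.\<close>

lemma J_tau_one: "i \<in> I \<Longrightarrow> j \<in> I \<Longrightarrow> (\<Sum>r\<in>I. J i r * \<tau> \<one> r j) = J i j"
proof -
  assume ij: "i \<in> I" "j \<in> I"
  have "(\<Sum>r\<in>I. J i r * \<tau> \<one> r j) = (\<Sum>r\<in>I. \<Sum>p\<in>I. \<Sum>q\<in>I. \<tau> \<one> p i * J p q * \<tau> \<one> q r * \<tau> \<one> r j)"
    using J_invariant[OF one_closed ij(1)] by (simp flip: sum_distrib_right)
  also have "\<dots> = (\<Sum>p\<in>I. \<Sum>q\<in>I. \<tau> \<one> p i * J p q * (\<Sum>r\<in>I. \<tau> \<one> q r * \<tau> \<one> r j))"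
    unfolding sum_distrib_left mult.assoc by (subst sum.swap, rule sum.cong[OF refl], rule sum.swap)
  also have "\<dots> = J i j" using J_invariant[OF one_closed ij] by (simp flip: tau_mult)
  finally show ?thesis .
qed

text \<open>Multiply \<tau>(g)^T J \<tau>(g) = J by \<tau>(g^-1) on the right; the factor
  \<open>\<tau> \<one>\<close> that appears is absorbed by J.\<close>

lemma J_tau:
  assumes g: "g \<in> carrier G" and ij: "i \<in> I" "j \<in> I"
  shows "(\<Sum>r\<in>I. J i r * \<tau> (inv g) r j) = (\<Sum>p\<in>I. \<tau> g p i * J p j)"
proof -
  have "(\<Sum>r\<in>I. J i r * \<tau> (inv g) r j) = (\<Sum>r\<in>I. \<Sum>p\<in>I. \<Sum>q\<in>I. \<tau> g p i * J p q * \<tau> g q r * \<tau> (inv g) r j)"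
    using J_invariant[OF g ij(1)] by (simp flip: sum_distrib_right)
  also have "\<dots> = (\<Sum>p\<in>I. \<Sum>q\<in>I. \<tau> g p i * J p q * (\<Sum>r\<in>I. \<tau> g q r * \<tau> (inv g) r j))"
    unfolding sum_distrib_left mult.assoc by (subst sum.swap, rule sum.cong[OF refl], rule sum.swap)
  also have "\<dots> = (\<Sum>p\<in>I. \<tau> g p i * (\<Sum>q\<in>I. J p q * \<tau> \<one> q j))"
    using tau_mult[of g "inv g"] g by (simp add: sum_distrib_left mult.assoc)
  also have "\<dots> = (\<Sum>p\<in>I. \<tau> g p i * J p j)" using ij J_tau_one by simp
  finally show ?thesis .
qed

lemma vnorm_tau_one_le: "vnorm I (mapply I (\<tau> \<one>) u) \<le> D * K * vnorm I (mapply I J u)"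
proof -
  have "vnorm I (mapply I (\<tau> \<one>) u) \<le> (\<Sum>i\<in>I. K * vnorm I (mapply I J u))"
    unfolding vnorm_def[of I "mapply I (\<tau> \<one>) u"] by (intro sum_mono J_nondeg)
  then show ?thesis by (simp add: mult.assoc)
qed

text \<open>By \<open>J_tau\<close> the form carries \<open>\<tau> (inv g)\<close> to the transpose
  of \<open>\<tau> g\<close>, and \<open>J_nondeg\<close> undoes the form on the image of
  \<open>\<tau> \<one>\<close>. So an element and its inverse have comparable norms.\<close>

lemma N_inv_le:
  assumes g: "g \<in> carrier G" shows "N (inv g) \<le> D\<^sup>2 * K * mnorm I J * N g"
proof -
  have "vnorm I (\<lambda>i. \<tau> (inv g) i j) \<le> D * K * (N g * mnorm I J)" if j: "j \<in> I" for j
  proof -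
    have "mapply I (\<tau> \<one>) (\<lambda>i. \<tau> (inv g) i j) = (\<lambda>i. \<tau> (inv g) i j)"
      using tau_column_mult[of \<one> "inv g" j] g by simp
    then have "vnorm I (\<lambda>i. \<tau> (inv g) i j) \<le> D * K * vnorm I (mapply I J (\<lambda>i. \<tau> (inv g) i j))"
      using vnorm_tau_one_le by metis
    also have "vnorm I (mapply I J (\<lambda>i. \<tau> (inv g) i j)) = vnorm I (mapply I (\<lambda>i p. \<tau> g p i) (\<lambda>p. J p j))"
      unfolding vnorm_def mapply_def by (intro sum.cong refl arg_cong[of _ _ cmod] J_tau g j)
    also have "\<dots> \<le> mnorm I (\<lambda>i p. \<tau> g p i) * vnorm I (\<lambda>p. J p j)" by (rule vnorm_mapply[OF finI])
    also have "\<dots> \<le> N g * mnorm I J"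
    proof (intro mult_mono)
      have "mnorm I (\<lambda>i p. \<tau> g p i) = N g" unfolding mnorm_def by (rule sum.swap)
      then show "mnorm I (\<lambda>i p. \<tau> g p i) \<le> N g" by simp
      show "vnorm I (\<lambda>p. J p j) \<le> mnorm I J" by (rule vnorm_column_le[OF finI j])
    qed auto
    finally show ?thesis using K by (simp add: mult_left_mono)
  qed
  then have "N (inv g) \<le> (\<Sum>j\<in>I. D * K * (N g * mnorm I J))" unfolding mnorm_columns[of I "\<tau> (inv g)"] by (rule sum_mono)
  then show ?thesis by (simp add: power2_eq_square mult_ac)
qed

end

section \<open>Limit lines and their equivariance\<close>

context rank_one_rep
begin

definition C\<^sub>1 :: real where
  "C\<^sub>1 = (SOME C. 0 < C \<and> (\<forall>x\<in>carrier G. \<forall>y\<in>carrier G.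
    line_dist (top_dir x) (top_dir y) \<le> C * exp (- \<mu> * gprod x y)))"

lemma C1: "0 < C\<^sub>1" "x \<in> carrier G \<Longrightarrow> y \<in> carrier G \<Longrightarrow>
    line_dist (top_dir x) (top_dir y) \<le> C\<^sub>1 * exp (- \<mu> * gprod x y)"
proof -
  have "\<exists>C. 0 < C \<and> (\<forall>x\<in>carrier G. \<forall>y\<in>carrier G.
    line_dist (top_dir x) (top_dir y) \<le> C * exp (- \<mu> * gprod x y))"
    using top_dir_gprod by metis
  from someI_ex[OF this] show "0 < C\<^sub>1" "x \<in> carrier G \<Longrightarrow> y \<in> carrier G \<Longrightarrow>
    line_dist (top_dir x) (top_dir y) \<le> C\<^sub>1 * exp (- \<mu> * gprod x y)"
    unfolding C\<^sub>1_def by blast+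
qed

lemma line_dist_gprod_ge:
  assumes "x \<in> carrier G" "y \<in> carrier G" "r \<le> gprod x y"
  shows "line_dist (top_dir x) (top_dir y) \<le> C\<^sub>1 * exp (- \<mu> * r)"
  using C1 assms mu by (smt (verit) exp_le_cancel_iff mult_left_mono mult_minus_left)

lemma entry_le_line_dist:
  "i \<in> I \<Longrightarrow> j \<in> I \<Longrightarrow> cmod (line_proj u i j - line_proj v i j) \<le> line_dist u v"
  unfolding line_dist_def using cmod_le_mnorm[OF finI, of i j "\<lambda>i j. line_proj u i j - line_proj v i j"] by simp

text \<open>Only the line is determined, not the phase. Being fixed by \<open>\<tau> \<one>\<close>
  makes the vector recoverable from its translates, which therefore never vanish.\<close>

definition limit_dir :: "(nat \<Rightarrow> 'g) \<Rightarrow> ('i \<Rightarrow> complex) \<Rightarrow> bool" where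
  "limit_dir x u \<longleftrightarrow> vnorm I u = 1 \<and> mapply I (\<tau> \<one>) u = u \<and> (\<lambda>n. line_dist (top_dir (x n)) u) \<longlonglongrightarrow> 0"

lemma exp_small: assumes "0 < (e::real)" obtains r where "C\<^sub>1 * exp (- \<mu> * r) < e"
proof
  show "C\<^sub>1 * exp (- \<mu> * (- ln (e / (2 * C\<^sub>1)) / \<mu>)) < e"
    using mu C1(1) assms by simp
qed

lemma limit_dir_exists:
  assumes x: "x \<in> gseqs"
  obtains u where "limit_dir x u"
proof -
  note xc = gseqs_carrier[OF x]
  have cauchy: "Cauchy (\<lambda>n. line_proj (top_dir (x n)) i j)" if ij: "i \<in> I" "j \<in> I" for i j
  proof (rule metric_CauchyI)
    fix e :: real assume "0 < e"
    then obtain r where r: "C\<^sub>1 * exp (- \<mu> * r) < e" by (rule exp_small)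
    obtain n where n: "\<forall>i\<ge>n. \<forall>j\<ge>n. r \<le> gprod (x i) (x j)" using gseqs_asymp[OF x] unfolding asymp_iff by blast
    show "\<exists>n. \<forall>m\<ge>n. \<forall>m'\<ge>n. dist (line_proj (top_dir (x m)) i j) (line_proj (top_dir (x m')) i j) < e"
    proof (intro exI allI impI)
      fix m m' assume "n \<le> m" "n \<le> m'"
      then show "dist (line_proj (top_dir (x m)) i j) (line_proj (top_dir (x m')) i j) < e"
        using line_dist_gprod_ge[OF xc[of m] xc[of m'], of r] n r
          entry_le_line_dist[OF ij, of "top_dir (x m)" "top_dir (x m')"] by (simp add: dist_norm)
    qed
  qed
  define Q where "Q i j = lim (\<lambda>n. line_proj (top_dir (x n)) i j)" for i j
  have lim: "(\<lambda>n. line_proj (top_dir (x n)) i j) \<longlonglongrightarrow> Q i j" if "i \<in> I" "j \<in> I" for i j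
    unfolding Q_def using cauchy[OF that] by (simp add: Cauchy_convergent_iff convergent_LIMSEQ_iff)
  obtain u where u: "vnorm I u = 1" "\<And>i. i \<notin> I \<Longrightarrow> u i = 0"
    "\<And>i j. i \<in> I \<Longrightarrow> j \<in> I \<Longrightarrow> Q i j = line_proj u i j"
    using line_proj_limit[OF finI _ lim] xc by (metis vnorm_top_dir)
  have "mapply I (\<tau> \<one>) u i = u i" for i
  proof (cases "i \<in> I")
    case False then show ?thesis using u(2) by (simp add: mapply_def tau_support)
  next
    case True
    \<comment> \<open>\<open>\<tau> \<one>\<close> fixes the columns of the approximating matrices,
      hence column l of their limit; cancelling the conjugate of \<open>u l\<close> carries this
      over to u.\<close>
    obtain l where l: "l \<in> I" "1 / D \<le> cmod (u l)" using obtain_large_coordinate[OF finI u(1)] .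
    then have ul: "u l \<noteq> 0" using card_pos by auto
    have "(\<lambda>n. \<Sum>j\<in>I. \<tau> \<one> i j * line_proj (top_dir (x n)) j l) \<longlonglongrightarrow> (\<Sum>j\<in>I. \<tau> \<one> i j * Q j l)"
      by (intro tendsto_sum tendsto_mult tendsto_const lim l)
    moreover have "(\<Sum>j\<in>I. \<tau> \<one> i j * line_proj (top_dir (x n)) j l) = line_proj (top_dir (x n)) i l" for n
      using fun_cong[OF tau_one_top_dir[OF xc[of n]], of i]
      by (simp add: mapply_def line_proj_def mult.assoc[symmetric] flip: sum_distrib_right)
    ultimately have "(\<Sum>j\<in>I. \<tau> \<one> i j * Q j l) = Q i l" using LIMSEQ_unique[OF _ lim[OF True l(1)]] by simp
    then have "mapply I (\<tau> \<one>) u i * cnj (u l) = u i * cnj (u l)"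
      using u(3) l True by (simp add: mapply_def line_proj_def sum_distrib_right mult.assoc)
    then show ?thesis using ul by simp
  qed
  moreover have "(\<lambda>n. line_dist (top_dir (x n)) u) \<longlonglongrightarrow> (\<Sum>i\<in>I. \<Sum>j\<in>I. cmod (Q i j - line_proj u i j))"
    unfolding line_dist_def mnorm_def by (intro tendsto_intros lim)
  ultimately have "limit_dir x u" unfolding limit_dir_def using u by auto
  then show ?thesis using that by blast
qed

lemma limit_dir_gprod_point:
  assumes g: "g \<in> carrier G" and y: "y \<in> gseqs" and v: "limit_dir y v" and r: "\<And>j. n \<le> j \<Longrightarrow> r \<le> gprod g (y j)"
  shows "line_dist (top_dir g) v \<le> C\<^sub>1 * exp (- \<mu> * r)"
proof -
  have lim: "(\<lambda>j. C\<^sub>1 * exp (- \<mu> * r) + line_dist (top_dir (y j)) v) \<longlonglongrightarrow> C\<^sub>1 * exp (- \<mu> * r) + 0"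
    using v unfolding limit_dir_def by (intro tendsto_intros) auto
  have ev: "\<forall>\<^sub>F j in sequentially. line_dist (top_dir g) v \<le> C\<^sub>1 * exp (- \<mu> * r) + line_dist (top_dir (y j)) v"
  proof (rule eventually_sequentiallyI[of n])
    fix j assume "n \<le> j"
    then show "line_dist (top_dir g) v \<le> C\<^sub>1 * exp (- \<mu> * r) + line_dist (top_dir (y j)) v"
      using line_dist_gprod_ge[OF g gseqs_carrier[OF y] r] line_dist_triangle[of "top_dir g" v "top_dir (y j)"] by force
  qed
  show ?thesis using tendsto_lowerbound[OF lim ev sequentially_bot] by simp
qed

lemma limit_dir_gprod:
  assumes x: "x \<in> gseqs" and u: "limit_dir x u" and y: "y \<in> gseqs" and v: "limit_dir y v"
    and r: "\<And>i j. n \<le> i \<Longrightarrow> n \<le> j \<Longrightarrow> r \<le> gprod (x i) (y j)"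
  shows "line_dist u v \<le> C\<^sub>1 * exp (- \<mu> * r)"
proof -
  have lim: "(\<lambda>j. C\<^sub>1 * exp (- \<mu> * r) + line_dist (top_dir (x j)) u) \<longlonglongrightarrow> C\<^sub>1 * exp (- \<mu> * r) + 0"
    using u unfolding limit_dir_def by (intro tendsto_intros) auto
  have ev: "\<forall>\<^sub>F j in sequentially. line_dist u v \<le> C\<^sub>1 * exp (- \<mu> * r) + line_dist (top_dir (x j)) u"
  proof (rule eventually_sequentiallyI[of n])
    fix j assume "n \<le> j"
    then show "line_dist u v \<le> C\<^sub>1 * exp (- \<mu> * r) + line_dist (top_dir (x j)) u"
      using limit_dir_gprod_point[OF gseqs_carrier[OF x] y v r] line_dist_triangle[of u v "top_dir (x j)"]
        line_dist_commute by force
  qed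
  show ?thesis using tendsto_lowerbound[OF lim ev sequentially_bot] by simp
qed

text \<open>Makes the boundary map well defined: one vector, phase included, serves all sequences of
  a boundary point.\<close>

lemma limit_dir_asymp:
  assumes x: "x \<in> gseqs" and u: "limit_dir x u" and y: "y \<in> gseqs" and xy: "seq_asymp x y"
  shows "limit_dir y u"
proof -
  obtain v where v: "limit_dir y v" using limit_dir_exists[OF y] .
  have "line_dist v u = 0"
  proof (rule ccontr)
    assume "\<not> ?thesis"
    then have "0 < line_dist v u" using line_dist_nonneg[of v u] by linarith
    then obtain r where r: "C\<^sub>1 * exp (- \<mu> * r) < line_dist v u" by (rule exp_small)
    obtain n where "\<forall>i\<ge>n. \<forall>j\<ge>n. r \<le> gprod (x i) (y j)" using xy unfolding asymp_iff by blast
    then show False using limit_dir_gprod[OF x u y v, of n r] r line_dist_commute[of u v] by simp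
  qed
  then have le: "line_dist (top_dir (y n)) u \<le> line_dist (top_dir (y n)) v" for n
    using line_dist_triangle[of "top_dir (y n)" u v] by simp
  have "(\<lambda>n. line_dist (top_dir (y n)) u) \<longlonglongrightarrow> 0"
    by (rule tendsto_sandwich[OF _ _ tendsto_const]) (use v le in \<open>auto simp: limit_dir_def\<close>)
  then show ?thesis using u by (simp add: limit_dir_def)
qed

definition unitize :: "('i \<Rightarrow> complex) \<Rightarrow> 'i \<Rightarrow> complex" where
  "unitize w = (\<lambda>i. inverse (of_real (vnorm I w)) * w i)"

lemma vnorm_unitize: "0 < vnorm I w \<Longrightarrow> vnorm I (unitize w) = 1"
  unfolding unitize_def vnorm_scale by (simp add: norm_inverse)

lemma tau_inverse_apply:
  "g \<in> carrier G \<Longrightarrow> mapply I (\<tau> \<one>) u = u \<Longrightarrow> mapply I (\<tau> (inv g)) (mapply I (\<tau> g) u) = u"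
  using tau_mapply_mult[of "inv g" g u] by simp

lemma tau_limit_dir_pos:
  assumes "g \<in> carrier G" "limit_dir x u" shows "0 < vnorm I (mapply I (\<tau> g) u)"
proof -
  have "1 = vnorm I (mapply I (\<tau> (inv g)) (mapply I (\<tau> g) u))"
    using tau_inverse_apply[OF assms(1), of u] assms(2) by (simp add: limit_dir_def)
  also have "\<dots> \<le> N (inv g) * vnorm I (mapply I (\<tau> g) u)" by (rule vnorm_mapply[OF finI])
  finally show ?thesis using vnorm_nonneg[of I "mapply I (\<tau> g) u"] by (metis less_eq_real_def mult_zero_right not_one_le_zero)
qed

text \<open>The line of a translated point is the translated line. Approximate u by the dominant
  direction of \<open>x n\<close> and apply \<open>\<tau> g\<close>; the error of
  \<open>tau_top_dir\<close> vanishes because the elements \<open>g \<otimes> x n\<close> become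
  arbitrarily long.\<close>

lemma translate_limit_dir:
  assumes g: "g \<in> carrier G" and x: "x \<in> gseqs" and u: "limit_dir x u"
  shows "(\<lambda>n. line_dist (unitize (mapply I (\<tau> g) u)) (top_dir (g \<otimes> x n))) \<longlonglongrightarrow> 0"
proof -
  note xc = gseqs_carrier[OF x]
  define w where "w = mapply I (\<tau> g) u"
  have w: "0 < vnorm I w" using tau_limit_dir_pos[OF g u] by (simp add: w_def)
  define \<eta> where "\<eta> n = D * line_dist u (top_dir (x n))" for n
  define \<theta> where "\<theta> n = D ^ 4 * C\<^sub>0 * N g * exp (- \<mu> * wlen (g \<otimes> x n))" for n
  have u1: "vnorm I u = 1" using u by (simp add: limit_dir_def)
  have bound: "line_dist (unitize w) (top_dir (g \<otimes> x n)) \<le> 6 * ((N g * \<eta> n + (1 + \<eta> n) * \<theta> n) / vnorm I w)" for n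
  proof -
    have gx: "g \<otimes> x n \<in> carrier G" using g xc by simp
    obtain c where c: "vnorm I (\<lambda>i. u i - c * top_dir (x n) i) \<le> \<eta> n"
      using line_proj_close_converse[OF finI u1 order_refl, of "top_dir (x n)"] unfolding \<eta>_def line_dist_def .
    have cc: "cmod c \<le> 1 + \<eta> n"
      using vnorm_diff_ge[of I "\<lambda>i. c * top_dir (x n) i" u] c vnorm_diff_commute[of I u] xc u1
      by (simp add: vnorm_scale)
    obtain d where d: "vnorm I (\<lambda>i. mapply I (\<tau> g) (top_dir (x n)) i - d * top_dir (g \<otimes> x n) i) \<le> \<theta> n"
      using tau_top_dir[OF g xc[of n]] unfolding \<theta>_def .
    have "vnorm I (\<lambda>i. w i - c * d * top_dir (g \<otimes> x n) i)
        \<le> vnorm I (\<lambda>i. w i - c * mapply I (\<tau> g) (top_dir (x n)) i)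
          + vnorm I (\<lambda>i. c * mapply I (\<tau> g) (top_dir (x n)) i - c * d * top_dir (g \<otimes> x n) i)"
      by (rule vnorm_diff_triangle)
    also have "(\<lambda>i. w i - c * mapply I (\<tau> g) (top_dir (x n)) i) = mapply I (\<tau> g) (\<lambda>i. u i - c * top_dir (x n) i)"
      unfolding w_def mapply_diff mapply_scale ..
    also have "(\<lambda>i. c * mapply I (\<tau> g) (top_dir (x n)) i - c * d * top_dir (g \<otimes> x n) i)
        = (\<lambda>i. c * (mapply I (\<tau> g) (top_dir (x n)) i - d * top_dir (g \<otimes> x n) i))"
      by (simp add: algebra_simps)
    also have "vnorm I (mapply I (\<tau> g) (\<lambda>i. u i - c * top_dir (x n) i)) + vnorm I \<dots> \<le> N g * \<eta> n + (1 + \<eta> n) * \<theta> n"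
      unfolding vnorm_scale using cc
      by (intro add_mono order_trans[OF vnorm_mapply[OF finI]] mult_mono mult_left_mono c d) (auto simp: \<eta>_def)
    finally have *: "vnorm I (\<lambda>i. w i - c * d * top_dir (g \<otimes> x n) i) \<le> N g * \<eta> n + (1 + \<eta> n) * \<theta> n" .
    let ?s = "inverse (of_real (vnorm I w)) :: complex"
    have "vnorm I (\<lambda>i. unitize w i - (?s * (c * d)) * top_dir (g \<otimes> x n) i)
        = vnorm I (\<lambda>i. ?s * (w i - c * d * top_dir (g \<otimes> x n) i))"
      by (simp add: unitize_def algebra_simps)
    also have "\<dots> \<le> (N g * \<eta> n + (1 + \<eta> n) * \<theta> n) / vnorm I w"
      unfolding vnorm_scale using * w by (simp add: norm_inverse divide_inverse mult.commute mult_left_mono)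
    finally show ?thesis unfolding line_dist_def
      by (intro line_proj_close vnorm_unitize w vnorm_top_dir gx)
  qed
  have "(\<lambda>n. line_dist u (top_dir (x n))) \<longlonglongrightarrow> 0"
    using u unfolding limit_dir_def by (subst line_dist_commute) simp
  then have \<eta>0: "\<eta> \<longlonglongrightarrow> 0" unfolding \<eta>_def using tendsto_mult_right_zero by blast
  have "filterlim (\<lambda>n. wlen (g \<otimes> x n)) at_top sequentially"
    unfolding filterlim_at_top
  proof
    fix r
    obtain n where n: "\<forall>i\<ge>n. \<forall>j\<ge>n. r + wlen g \<le> gprod (x i) (x j)"
      using gseqs_asymp[OF x] unfolding asymp_iff by blast
    show "\<forall>\<^sub>F n in sequentially. r \<le> wlen (g \<otimes> x n)"
    proof (rule eventually_sequentiallyI[of n])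
      fix i assume "n \<le> i"
      then have "r + wlen g \<le> wlen (x i)" using n gprod_le[OF xc[of i] xc[of i]] by force
      moreover have "x i = inv g \<otimes> (g \<otimes> x i)" using g xc by (simp add: m_assoc[symmetric])
      ultimately show "r \<le> wlen (g \<otimes> x i)"
        using word_length_mult[of "inv g" "g \<otimes> x i"] g xc[of i] by simp
    qed
  qed
  then have "filterlim (\<lambda>n. - \<mu> * wlen (g \<otimes> x n)) at_bot sequentially"
    using mu by (simp add: filterlim_uminus_at_bot filterlim_tendsto_pos_mult_at_top[OF tendsto_const mu])
  then have "(\<lambda>n. exp (- \<mu> * wlen (g \<otimes> x n))) \<longlonglongrightarrow> 0" by (rule filterlim_compose[OF exp_at_bot])
  then have \<theta>0: "\<theta> \<longlonglongrightarrow> 0" unfolding \<theta>_def using tendsto_mult_right_zero by blast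
  have "(\<lambda>n. 6 * ((N g * \<eta> n + (1 + \<eta> n) * \<theta> n) / vnorm I w)) \<longlonglongrightarrow> 6 * ((N g * 0 + (1 + 0) * 0) / vnorm I w)"
    using w by (intro tendsto_intros \<eta>0 \<theta>0) auto
  then have lim: "(\<lambda>n. 6 * ((N g * \<eta> n + (1 + \<eta> n) * \<theta> n) / vnorm I w)) \<longlonglongrightarrow> 0" by simp
  have "(\<lambda>n. line_dist (unitize w) (top_dir (g \<otimes> x n))) \<longlonglongrightarrow> 0"
    by (rule tendsto_sandwich[OF _ _ tendsto_const lim]) (use bound in auto)
  then show ?thesis by (simp add: w_def)
qed

text \<open>A bound on the product of x and z says that z moves away from the limit of x. By
  \<open>gprod_translate\<close>, z^-1 then has product at least |z| - R with late points of z^-1 x,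
  whose limit line is spanned by \<open>mapply I (\<tau> (inv z)) u\<close>. This is why the columns
  of \<open>\<tau> (inv z)\<close> follow that vector.\<close>

lemma top_dir_inverse_near:
  assumes z: "z \<in> carrier G" and x: "x \<in> gseqs" and u: "limit_dir x u" and R: "\<And>i. n \<le> i \<Longrightarrow> gprod (x i) z \<le> R"
  shows "line_dist (top_dir (inv z)) (unitize (mapply I (\<tau> (inv z)) u)) \<le> C\<^sub>1 * exp (- \<mu> * (wlen z - R))"
proof -
  note xc = gseqs_carrier[OF x]
  let ?w = "unitize (mapply I (\<tau> (inv z)) u)"
  have lim: "(\<lambda>j. C\<^sub>1 * exp (- \<mu> * (wlen z - R)) + line_dist ?w (top_dir (inv z \<otimes> x j))) \<longlonglongrightarrow> C\<^sub>1 * exp (- \<mu> * (wlen z - R)) + 0"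
    using translate_limit_dir[OF inv_closed[OF z] x u] by (intro tendsto_add tendsto_const)
  have ev: "\<forall>\<^sub>F j in sequentially. line_dist (top_dir (inv z)) ?w
    \<le> C\<^sub>1 * exp (- \<mu> * (wlen z - R)) + line_dist ?w (top_dir (inv z \<otimes> x j))"
  proof (rule eventually_sequentiallyI[of n])
    fix j assume "n \<le> j"
    then have "wlen z - R \<le> gprod (inv z) (inv z \<otimes> x j)" using R gprod_translate[OF z xc[of j]] by force
    then show "line_dist (top_dir (inv z)) ?w \<le> C\<^sub>1 * exp (- \<mu> * (wlen z - R)) + line_dist ?w (top_dir (inv z \<otimes> x j))"
      using line_dist_gprod_ge[of "inv z" "inv z \<otimes> x j"] z xc[of j]
        line_dist_triangle[of "top_dir (inv z)" ?w "top_dir (inv z \<otimes> x j)"] line_dist_commute[of ?w] by force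
  qed
  show ?thesis using tendsto_lowerbound[OF lim ev sequentially_bot] by simp
qed

end

section \<open>Odd maps from the 2-sphere\<close>

text \<open>On the simply connected sphere F has a continuous logarithm g. The values of g (- x) - g
  x differ by multiples of 2 pi i, so this difference is constant; it is also odd, hence 0, although
  its exponential is -1.\<close>

lemma no_odd_map_sphere:
  fixes F :: "real ^ 3 \<Rightarrow> complex"
  assumes cont: "continuous_on (sphere 0 1) F" and nz: "\<And>x. x \<in> sphere 0 1 \<Longrightarrow> F x \<noteq> 0"
    and odd: "\<And>x. x \<in> sphere 0 1 \<Longrightarrow> F (- x) = - F x"
  shows False
proof -
  let ?S = "sphere (0 :: real ^ 3) 1"
  have neg: "- x \<in> ?S" if "x \<in> ?S" for x using that by simp
  obtain g where g: "continuous_on ?S g" "\<And>x. x \<in> ?S \<Longrightarrow> F x = exp (g x)"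
    by (rule continuous_logarithm_on_simply_connected[OF cont _ _ nz])
      (auto simp: simply_connected_sphere locally_path_connected_sphere)
  define k where "k x = g (- x) - g x" for x
  have k_exp: "exp (k x) = - 1" if "x \<in> ?S" for x
  proof -
    have "exp (g (- x)) = - exp (g x)" using g(2)[OF that] g(2)[OF neg[OF that]] odd[OF that] by simp
    then show ?thesis by (simp add: k_def exp_diff)
  qed
  have "continuous_on ?S (\<lambda>x. g (- x))"
    by (rule continuous_on_compose2[OF g(1)]) (auto intro!: continuous_intros)
  then have k_cont: "continuous_on ?S k" unfolding k_def using g(1) by (intro continuous_intros)
  have conn: "connected ?S" by (intro connected_sphere) simp
  have "k constant_on ?S"
  proof (rule continuous_discrete_range_constant[OF conn k_cont])
    fix x assume x: "x \<in> ?S"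
    show "\<exists>e>0. \<forall>y. y \<in> ?S \<and> k y \<noteq> k x \<longrightarrow> e \<le> norm (k y - k x)"
    proof (intro exI conjI allI impI)
      show "(0::real) < 2 * pi" by simp
      fix y assume y: "y \<in> ?S \<and> k y \<noteq> k x"
      then have "exp (k y) = exp (k x)" using k_exp x by simp
      then obtain n :: int where n: "k y = k x + (of_int (2 * n) * pi) * \<i>" using exp_eq by blast
      then have "norm (k y - k x) = 2 * pi * \<bar>real_of_int n\<bar>" by (simp add: norm_mult)
      moreover have "n \<noteq> 0" using n y by auto
      then have "1 \<le> \<bar>real_of_int n\<bar>" by linarith
      ultimately show "2 * pi \<le> norm (k y - k x)" by simp
    qed
  qed
  moreover obtain x :: "real ^ 3" where x: "x \<in> ?S"
    using vector_choose_size[of 1] by (metis mem_sphere_0 zero_le_one)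
  ultimately have "k (- x) = k x" unfolding constant_on_def using neg by metis
  moreover have "k x + k (- x) = 0" by (simp add: k_def)
  ultimately have "k x = 0" by simp
  then show False using k_exp[OF x] by simp
qed

section \<open>Transversality of limit lines\<close>

context rank_one_rep
begin

definition pairing :: "('i \<Rightarrow> complex) \<Rightarrow> ('i \<Rightarrow> complex) \<Rightarrow> complex" where
  "pairing u v = (\<Sum>i\<in>I. \<Sum>j\<in>I. u i * J i j * v j)"

lemma pairing_antisym: "pairing u v = - pairing v u"
proof -
  have "pairing u v = (\<Sum>i\<in>I. \<Sum>j\<in>I. - (v j * J j i * u i))"
    unfolding pairing_def
  proof (intro sum.cong refl)
    fix i j assume "i \<in> I" "j \<in> I"
    then show "u i * J i j * v j = - (v j * J j i * u i)" using J_antisym[of i j] by simp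
  qed
  also have "\<dots> = - pairing v u" unfolding pairing_def sum_negf by (subst sum.swap) simp
  finally show ?thesis .
qed

lemma pairing_mapply: "pairing u v = (\<Sum>i\<in>I. u i * mapply I J v i)"
  by (simp add: pairing_def mapply_def sum_distrib_left mult.assoc)

lemma cmod_sum_mult_le: "cmod (\<Sum>i\<in>I. a i * b i) \<le> vnorm I a * vnorm I b"
proof -
  have "cmod (\<Sum>i\<in>I. a i * b i) \<le> (\<Sum>i\<in>I. cmod (a i) * cmod (b i))"
    unfolding norm_mult[symmetric] by (rule norm_sum)
  also have "\<dots> \<le> (\<Sum>i\<in>I. cmod (a i) * vnorm I b)"
    by (intro sum_mono mult_left_mono cmod_le_vnorm finI) auto
  finally show ?thesis by (simp add: vnorm_def sum_distrib_right)
qed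

lemma column_near_line:
  assumes g: "g \<in> carrier G" and l: "l \<in> I" and \<eta>: "line_dist (top_dir g) v \<le> \<eta>"
  shows "\<exists>c. vnorm I (\<lambda>i. \<tau> g i l - c * v i)
    \<le> (D ^ 3 * C\<^sub>0 + (1 + D ^ 3 * C\<^sub>0) * D) * (exp (- \<mu> * wlen g) + \<eta>) * N g"
proof -
  let ?k = "D ^ 3 * C\<^sub>0" and ?e = "exp (- \<mu> * wlen g)"
  have k: "0 \<le> ?k" using C0 by simp
  have \<eta>0: "0 \<le> \<eta>" using \<eta> line_dist_nonneg order_trans by blast
  have e: "?e \<le> 1" using mu by simp
  obtain c where c: "vnorm I (\<lambda>i. \<tau> g i l - c * top_dir g i) \<le> ?k * ?e * N g"
    using column_near_top_dir[OF g l] .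
  have "cmod c = vnorm I (\<lambda>i. c * top_dir g i)" using g by (simp add: vnorm_scale)
  also have "\<dots> \<le> vnorm I (\<lambda>i. \<tau> g i l) + vnorm I (\<lambda>i. \<tau> g i l - c * top_dir g i)"
    using vnorm_diff[of I "\<lambda>i. \<tau> g i l" "\<lambda>i. \<tau> g i l - c * top_dir g i"] by simp
  also have "\<dots> \<le> N g + ?k * 1 * N g"
    using k e by (intro add_mono order_trans[OF c] mult_right_mono mult_left_mono vnorm_column_le finI l) auto
  finally have cc: "cmod c \<le> (1 + ?k) * N g" by (simp add: algebra_simps)
  obtain d where d: "vnorm I (\<lambda>i. top_dir g i - d * v i) \<le> D * \<eta>"
    using line_proj_close_converse[OF finI vnorm_top_dir[OF g] \<eta>[unfolded line_dist_def]] .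
  have "vnorm I (\<lambda>i. \<tau> g i l - (c * d) * v i)
      \<le> vnorm I (\<lambda>i. \<tau> g i l - c * top_dir g i) + vnorm I (\<lambda>i. c * (top_dir g i - d * v i))"
    using vnorm_add[of I "\<lambda>i. \<tau> g i l - c * top_dir g i" "\<lambda>i. c * (top_dir g i - d * v i)"]
    by (simp add: algebra_simps)
  also have "\<dots> \<le> ?k * ?e * N g + ((1 + ?k) * N g) * (D * \<eta>)"
    unfolding vnorm_scale using c d cc k by (intro add_mono mult_mono) auto
  also have "\<dots> \<le> (?k * (?e + \<eta>) + (1 + ?k) * D * (?e + \<eta>)) * N g"
  proof -
    have "?k * ?e + (1 + ?k) * D * \<eta> \<le> ?k * (?e + \<eta>) + (1 + ?k) * D * (?e + \<eta>)"
      using k \<eta>0 by (intro add_mono mult_left_mono) auto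
    from mult_right_mono[OF this mnorm_nonneg[of I "\<tau> g"]] show ?thesis by (simp add: algebra_simps)
  qed
  finally show ?thesis by (intro exI[of _ "c * d"]) (simp add: distrib_right)
qed

text \<open>Entry i of J \<tau>(z^-1) u = \<tau>(z)^T J u pairs column i of \<open>\<tau> z\<close>
  with u. That column is a multiple of v up to a small error, and v contributes nothing to the
  pairing. Nondegeneracy then bounds \<tau>(z^-1) u itself.\<close>

lemma isotropic_contraction:
  "\<exists>B\<ge>0. \<forall>z\<in>carrier G. \<forall>x u v \<eta>. limit_dir x u \<longrightarrow> pairing v u = 0 \<longrightarrow> line_dist (top_dir z) v \<le> \<eta> \<longrightarrow>
    vnorm I (mapply I (\<tau> (inv z)) u) \<le> B * (exp (- \<mu> * wlen z) + \<eta>) * N (inv z)"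
proof -
  define E where "E = D ^ 3 * C\<^sub>0 + (1 + D ^ 3 * C\<^sub>0) * D"
  define m where "m = mnorm I J"
  have m: "0 \<le> m" and E: "0 \<le> E" using C0 by (simp_all add: m_def E_def)
  show ?thesis
  proof (intro exI[of _ "D * K * D * m * E * (D\<^sup>2 * K * m)"] conjI ballI allI impI)
    show "0 \<le> D * K * D * m * E * (D\<^sup>2 * K * m)" using m E K by simp
    fix z x u v \<eta>
    assume z: "z \<in> carrier G" and u: "limit_dir x u" and vu: "pairing v u = 0" and \<eta>: "line_dist (top_dir z) v \<le> \<eta>"
    let ?e = "exp (- \<mu> * wlen z) + \<eta>"
    have e0: "0 \<le> ?e" using \<eta> line_dist_nonneg[of "top_dir z" v] by (smt (verit) exp_ge_zero)
    define w where "w = mapply I (\<tau> (inv z)) u"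
    have ju: "vnorm I (mapply I J u) \<le> m"
      using vnorm_mapply[OF finI, of J u] u by (simp add: limit_dir_def m_def)
    have "cmod (mapply I J w i) \<le> E * ?e * N z * m" if i: "i \<in> I" for i
    proof -
      have "mapply I J w i = (\<Sum>l\<in>I. \<Sum>q\<in>I. (J i l * \<tau> (inv z) l q) * u q)"
        by (simp add: w_def mapply_def sum_distrib_left mult.assoc)
      also have "\<dots> = (\<Sum>q\<in>I. (\<Sum>l\<in>I. J i l * \<tau> (inv z) l q) * u q)"
        unfolding sum_distrib_right by (rule sum.swap)
      also have "\<dots> = (\<Sum>q\<in>I. (\<Sum>p\<in>I. \<tau> z p i * J p q) * u q)"
        by (intro sum.cong refl arg_cong2[of _ _ _ _ "(*)"] J_tau z i)
      also have "\<dots> = (\<Sum>p\<in>I. \<tau> z p i * mapply I J u p)"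
        unfolding sum_distrib_right mapply_def sum_distrib_left mult.assoc by (rule sum.swap)
      finally have 1: "mapply I J w i = (\<Sum>p\<in>I. \<tau> z p i * mapply I J u p)" .
      obtain c where c: "vnorm I (\<lambda>p. \<tau> z p i - c * v p) \<le> E * ?e * N z"
        using column_near_line[OF z i \<eta>] unfolding E_def by blast
      have "(\<Sum>p\<in>I. (\<tau> z p i - c * v p) * mapply I J u p) = mapply I J w i - c * pairing v u"
        unfolding 1 pairing_mapply by (simp add: left_diff_distrib sum_subtractf sum_distrib_left mult.assoc)
      then have "cmod (mapply I J w i) \<le> vnorm I (\<lambda>p. \<tau> z p i - c * v p) * vnorm I (mapply I J u)"
        using cmod_sum_mult_le[of "\<lambda>p. \<tau> z p i - c * v p" "mapply I J u"] vu by simp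
      also have "\<dots> \<le> (E * ?e * N z) * m" using c ju E e0 by (intro mult_mono) auto
      finally show ?thesis .
    qed
    then have "vnorm I (mapply I J w) \<le> (\<Sum>i\<in>I. E * ?e * N z * m)" unfolding vnorm_def by (rule sum_mono)
    then have jw: "vnorm I (mapply I J w) \<le> D * (E * ?e * N z * m)" by simp
    have "mapply I (\<tau> \<one>) w = w" unfolding w_def using tau_mapply_mult[of \<one> "inv z" u] z by simp
    then have "vnorm I w \<le> D * K * vnorm I (mapply I J w)" using vnorm_tau_one_le[of w] by simp
    also have "\<dots> \<le> D * K * (D * (E * ?e * N z * m))" using K by (intro mult_left_mono jw) auto
    also have "\<dots> = (D * K * D * m * E * ?e) * N z" by (simp add: mult_ac)
    \<comment> \<open>\<open>N_inv_le\<close> is applied to \<open>inv z\<close>, since the bound is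
      wanted relative to the norm of the matrix that acts on u.\<close>
    also have "\<dots> \<le> (D * K * D * m * E * ?e) * (D\<^sup>2 * K * m * N (inv z))"
      using N_inv_le[of "inv z"] z K m E e0 by (intro mult_left_mono) (auto simp: m_def)
    also have "\<dots> = D * K * D * m * E * (D\<^sup>2 * K * m) * ?e * N (inv z)" by (simp add: mult_ac)
    finally show "vnorm I (mapply I (\<tau> (inv z)) u) \<le> D * K * D * m * E * (D\<^sup>2 * K * m) * ?e * N (inv z)"
      by (simp add: w_def)
  qed
qed

theorem transverse:
  assumes x: "x \<in> gseqs" and y: "y \<in> gseqs" and na: "\<not> seq_asymp x y"
    and u: "limit_dir x u" and v: "limit_dir y v"
  shows "pairing u v \<noteq> 0"
proof
  assume "pairing u v = 0"
  then have vu: "pairing v u = 0" using pairing_antisym[of v u] by simp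
  obtain R n\<^sub>0 where R: "\<And>i j. n\<^sub>0 \<le> i \<Longrightarrow> n\<^sub>0 \<le> j \<Longrightarrow> gprod (x i) (y j) \<le> R"
    using not_asymp_bounded[OF x y na] by metis
  obtain \<delta> where \<delta>: "0 \<le> \<delta>" "\<And>x y z. x \<in> carrier G \<Longrightarrow> y \<in> carrier G \<Longrightarrow> z \<in> carrier G \<Longrightarrow>
    min (gprod x y) (gprod y z) - \<delta> \<le> gprod x z" using hyp_gprod by blast
  obtain L where L: "1 \<le> L" "\<And>s. s \<in> letters \<Longrightarrow> N s \<le> L" using letters_bound by blast
  obtain B\<^sub>3 where B3: "0 \<le> B\<^sub>3" "\<forall>z\<in>carrier G. \<forall>x u v \<eta>. limit_dir x u \<longrightarrow> pairing v u = 0 \<longrightarrow>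
    line_dist (top_dir z) v \<le> \<eta> \<longrightarrow>
    vnorm I (mapply I (\<tau> (inv z)) u) \<le> B\<^sub>3 * (exp (- \<mu> * wlen z) + \<eta>) * N (inv z)"
    using isotropic_contraction by blast
  define q where "q = exp (- \<mu>)"
  have q: "0 < q" "q < 1" using mu by (simp_all add: q_def)
  have q_pow: "exp (- \<mu> * (real j - r)) = exp (\<mu> * r) * q ^ j" for j r
    by (simp add: q_def exp_of_nat_mult[symmetric] exp_add[symmetric] algebra_simps)
  define E where "E = D ^ 3 * C\<^sub>0 + (1 + D ^ 3 * C\<^sub>0) * D"
  define B where "B = E * (1 + C\<^sub>1 * exp (\<mu> * R))"
  have B: "0 \<le> B" using C0 C1(1) by (simp add: B_def E_def)
  define B' where "B' = B\<^sub>3 * (1 + C\<^sub>1 * exp (\<mu> * \<delta>)) + 1"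
  have B': "0 < B'" using B3(1) C1(1) by (simp add: B'_def add_nonneg_pos)
  \<comment> \<open>The number of steps is fixed before a geodesic is chosen. The threshold 1 / B'
    is the lower bound for a_j q^j that orthogonality will impose.\<close>
  obtain n where n: "\<And>a. (\<And>j. 0 \<le> a j) \<Longrightarrow> a 0 \<le> N \<one> \<Longrightarrow> (\<And>j. j < n \<Longrightarrow> a (Suc j) \<le> L\<^sup>2 * a j) \<Longrightarrow>
    (\<And>j. j \<le> n \<Longrightarrow> a j \<le> (D * (1 + 3 * B + L\<^sup>2 * B)) * (\<Sum>i\<le>j. q ^ i * a i)) \<Longrightarrow> \<exists>j\<le>n. a j * q ^ j < 1 / B'"
  proof (rule bounded_of_summable_gronwall[of "N \<one>" "D * (1 + 3 * B + L\<^sup>2 * B)" "L\<^sup>2" q "1 / B'"])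
    show "1 \<le> L\<^sup>2" using L(1) by simp
  qed (use B q B' in auto)
  obtain M where M: "\<forall>i\<ge>M. \<forall>j\<ge>M. real n \<le> gprod (y i) (y j)"
    using gseqs_asymp[OF y] unfolding asymp_iff by blast
  \<comment> \<open>A point of y late enough for the bound R, and so far out that later points of y
    have product at least n with it. Only the first n steps of a geodesic from the identity to p are
    used; on them it serves as a ray towards the limit of y.\<close>
  define p where "p = y (max M n\<^sub>0)"
  note xc = gseqs_carrier[OF x] and yc = gseqs_carrier[OF y]
  have pc: "p \<in> carrier G" using yc by (simp add: p_def)
  have py: "real n \<le> gprod p (y j)" if "M \<le> j" for j using M that by (simp add: p_def)
  have xp: "gprod (x i) p \<le> R" if "n\<^sub>0 \<le> i" for i using R that by (simp add: p_def)
  obtain z k where k: "wdist \<one> p = real k" and z: "z 0 = \<one>" "\<And>i. z i \<in> carrier G"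
    and zs: "\<And>i. i < k \<Longrightarrow> \<exists>s\<in>letters. z (Suc i) = z i \<otimes> s"
    and z1: "\<And>i. i \<le> k \<Longrightarrow> wdist \<one> (z i) \<le> real i" and zp: "\<And>i. i \<le> k \<Longrightarrow> wdist (z i) p \<le> real (k - i)"
    using geodesic[OF one_closed pc] by metis
  have kp: "wlen p = real k" using k pc by (simp add: word_dist_one)
  have nk: "n \<le> k"
  proof -
    have "real n \<le> gprod p p" using M by (simp add: p_def)
    then show ?thesis using gprod_le[OF pc pc] kp by simp
  qed
  have zlen: "wlen (z j) = real j" if "j \<le> n" for j
  proof -
    have "j \<le> k" using that nk by simp
    then show ?thesis using z1[of j] zp[of j] wlen_le_dist[OF z(2)[of j] pc] kp z(2)[of j]
      by (simp add: word_dist_one)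
  qed
  have zpj: "real j \<le> gprod (z j) p" if "j \<le> n" for j
  proof -
    have "j \<le> k" using that nk by simp
    then show ?thesis using zp[of j] zlen[OF that] kp by (simp add: gprod_eq z(2) pc)
  qed
  \<comment> \<open>Products with a fixed point do not decrease along a geodesic from the identity,
    so the bound at p is inherited by every z_j.\<close>
  have xz: "gprod (x i) (z j) \<le> R" if "j \<le> n" "n\<^sub>0 \<le> i" for i j
  proof -
    have "j \<le> k" using that nk by simp
    then have "gprod (x i) (z j) \<le> gprod (x i) p"
      using word_dist_triangle[OF xc[of i] z(2)[of j] pc] zp[of j] zlen[OF that(1)] kp
      by (simp add: gprod_eq z(2) pc xc)
    then show ?thesis using xp[OF that(2)] by simp
  qed
  have zy: "real j - \<delta> \<le> gprod (z j) (y i)" if "j \<le> n" "M \<le> i" for i j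
    using \<delta>(2)[OF z(2)[of j] pc yc[of i]] zpj[OF that(1)] py[OF that(2)] that(1) by simp
  define w where "w j = mapply I (\<tau> (inv (z j))) u" for j
  have w_pos: "0 < vnorm I (w j)" for j using tau_limit_dir_pos[OF _ u, of "inv (z j)"] z(2) by (simp add: w_def)
  define a where "a j = N (inv (z j)) / vnorm I (w j)" for j
  have zS: "\<exists>s. s \<in> letters \<and> s \<in> carrier G \<and> z (Suc j) = z j \<otimes> s" if "j < n" for j
    using zs[of j] that nk letters_closed by (metis less_le_trans subsetD)
  then obtain s where s: "\<And>j. j < n \<Longrightarrow> s j \<in> letters" "\<And>j. j < n \<Longrightarrow> s j \<in> carrier G"
    "\<And>j. j < n \<Longrightarrow> z (Suc j) = z j \<otimes> s j" by metis
  have invS: "inv (z (Suc j)) = inv (s j) \<otimes> inv (z j)" if "j < n" for j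
    using s(2,3)[OF that] z(2)[of j] by (simp add: inv_mult_group)
  have wS: "w (Suc j) = mapply I (\<tau> (inv (s j))) (w j)" if "j < n" for j
    using tau_mapply_mult[of "inv (s j)" "inv (z j)" u] invS[OF that] s(2)[OF that] z(2)[of j] by (simp add: w_def)
  have Ns: "N (inv (s j)) \<le> L" "N (s j) \<le> L" if "j < n" for j
    using L(2)[OF s(1)[OF that]] L(2)[OF letters_inv[OF s(1)[OF that]]] by auto
  have w_le: "vnorm I (w j) \<le> L * vnorm I (w (Suc j))" if "j < n" for j
  proof -
    have "inv (z j) = s j \<otimes> inv (z (Suc j))" using invS[OF that] s(2)[OF that] z(2)[of j] by (simp add: m_assoc[symmetric])
    then have "w j = mapply I (\<tau> (s j)) (w (Suc j))"
      using tau_mapply_mult[of "s j" "inv (z (Suc j))" u] s(2)[OF that] z(2)[of "Suc j"] by (simp add: w_def)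
    then have "vnorm I (w j) \<le> N (s j) * vnorm I (w (Suc j))" using vnorm_mapply[OF finI] by metis
    also have "\<dots> \<le> L * vnorm I (w (Suc j))" using Ns(2)[OF that] by (intro mult_right_mono) auto
    finally show ?thesis .
  qed
  have near: "\<exists>c. vnorm I (\<lambda>i. \<tau> (inv (z j)) i l - c * w j i) \<le> B * q ^ j * N (inv (z j))"
    if j: "j \<le> n" and l: "l \<in> I" for j l
  proof -
    have zj: "z j \<in> carrier G" "inv (z j) \<in> carrier G" using z(2) by auto
    have "line_dist (top_dir (inv (z j))) (unitize (w j)) \<le> C\<^sub>1 * exp (- \<mu> * (wlen (z j) - R))"
      unfolding w_def by (rule top_dir_inverse_near[OF zj(1) x u]) (rule xz[OF j])
    then have "line_dist (top_dir (inv (z j))) (unitize (w j)) \<le> C\<^sub>1 * (exp (\<mu> * R) * q ^ j)"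
      unfolding zlen[OF j] q_pow .
    from column_near_line[OF zj(2) l this] obtain c where
      c: "vnorm I (\<lambda>i. \<tau> (inv (z j)) i l - c * unitize (w j) i)
        \<le> E * (exp (- \<mu> * wlen (inv (z j))) + C\<^sub>1 * (exp (\<mu> * R) * q ^ j)) * N (inv (z j))"
      unfolding E_def by blast
    have "exp (- \<mu> * wlen (inv (z j))) = q ^ j" using zlen[OF j] zj q_pow[of j 0] by simp
    then have "vnorm I (\<lambda>i. \<tau> (inv (z j)) i l - (c * inverse (of_real (vnorm I (w j)))) * w j i) \<le> B * q ^ j * N (inv (z j))"
      using c by (simp add: unitize_def B_def algebra_simps)
    then show ?thesis by blast
  qed
  have w0: "w 0 = u" using u z(1) by (simp add: w_def limit_dir_def)
  have "\<exists>j\<le>n. a j * q ^ j < 1 / B'"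
  proof (rule n)
    show "0 \<le> a j" for j by (simp add: a_def)
    show "a 0 \<le> N \<one>" using w0 u z(1) by (simp add: a_def limit_dir_def)
    show "a (Suc j) \<le> L\<^sup>2 * a j" if j: "j < n" for j
    proof -
      have "N (inv (z (Suc j))) \<le> N (inv (s j)) * N (inv (z j))"
        unfolding invS[OF j] using s(2)[OF j] z(2)[of j] by (intro N_mult_le) auto
      also have "\<dots> \<le> L * N (inv (z j))" using Ns(1)[OF j] by (intro mult_right_mono) auto
      finally have "a (Suc j) \<le> L * N (inv (z j)) / vnorm I (w (Suc j))"
        unfolding a_def using w_pos by (intro divide_right_mono) auto
      also have "\<dots> \<le> L * N (inv (z j)) / (vnorm I (w j) / L)"
        using w_le[OF j] w_pos[of j] w_pos[of "Suc j"] L(1) by (intro divide_left_mono) (auto simp: field_simps)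
      finally show ?thesis by (simp add: a_def power2_eq_square mult_ac)
    qed
    show "a j \<le> D * (1 + 3 * B + L\<^sup>2 * B) * (\<Sum>i\<le>j. q ^ i * a i)" if j: "j \<le> n" for j
      unfolding a_def
    proof (rule columns_near_orbit_bound[where M = "\<lambda>j. \<tau> (inv (s j))" and n = n])
      show "(\<lambda>i. \<tau> (inv (z (Suc j))) i l) = mapply I (\<tau> (inv (s j))) (\<lambda>i. \<tau> (inv (z j)) i l)" if "j < n" for j l
        unfolding invS[OF that] using s(2)[OF that] z(2)[of j] by (intro tau_column_mult) auto
    qed (use finI q B L Ns wS w_le w_pos near j in auto)
  qed
  then obtain j where j: "j \<le> n" "a j * q ^ j < 1 / B'" by blast
  \<comment> \<open>Orthogonality enters here: the dominant line of z_j approaches v, and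
    \<open>isotropic_contraction\<close> keeps a_j q^j above the threshold for this very j.\<close>
  have "line_dist (top_dir (z j)) v \<le> C\<^sub>1 * exp (- \<mu> * (real j - \<delta>))"
    by (rule limit_dir_gprod_point[OF z(2) y v]) (rule zy[OF j(1)])
  from B3(2)[rule_format, OF z(2) u vu this]
  have "vnorm I (w j) \<le> B\<^sub>3 * (q ^ j + C\<^sub>1 * (exp (\<mu> * \<delta>) * q ^ j)) * N (inv (z j))"
    unfolding w_def zlen[OF j(1)] q_pow using q_pow[of j 0] by simp
  also have "\<dots> = (B\<^sub>3 * (1 + C\<^sub>1 * exp (\<mu> * \<delta>))) * (q ^ j * N (inv (z j)))" by (simp add: algebra_simps)
  also have "\<dots> \<le> B' * (q ^ j * N (inv (z j)))" using q unfolding B'_def by (intro mult_right_mono) auto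
  finally have "1 / B' \<le> a j * q ^ j" using w_pos[of j] B' by (simp add: a_def field_simps)
  then show False using j(2) by simp
qed

end

section \<open>Boundary points as equivalence classes\<close>

context hyperbolic_word_metric
begin

abbreviation "bpoints \<equiv> gromov_boundary_points (carrier G) (word_dist G S) \<one>"

lemma bpoints_iff: "\<xi> \<in> bpoints \<longleftrightarrow> (\<exists>x\<in>gseqs. \<xi> = {y \<in> gseqs. seq_asymp x y})"
  unfolding gromov_boundary_points_def quotient_def by (auto simp: Image_def)

lemma bpoint_seqs: "\<xi> \<in> bpoints \<Longrightarrow> x \<in> \<xi> \<Longrightarrow> x \<in> gseqs"
  unfolding bpoints_iff by auto

lemma bpoint_nonempty: "\<xi> \<in> bpoints \<Longrightarrow> \<exists>x. x \<in> \<xi>"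
  unfolding bpoints_iff using gseqs_asymp by blast

lemma bpoint_eq:
  assumes "\<xi> \<in> bpoints" "x \<in> \<xi>" shows "\<xi> = {y \<in> gseqs. seq_asymp x y}"
proof -
  obtain x' where x': "x' \<in> gseqs" "\<xi> = {y \<in> gseqs. seq_asymp x' y}" using assms(1) unfolding bpoints_iff by blast
  then have x: "x \<in> gseqs" "seq_asymp x' x" using assms(2) by auto
  show ?thesis unfolding x'(2)
    using asymp_trans[OF x(1) x'(1) _ asymp_commute[OF x'(1) x]] asymp_trans[OF x'(1) x(1) _ x(2)] by auto
qed

lemma bpoint_asymp_iff:
  assumes "\<xi> \<in> bpoints" "\<eta> \<in> bpoints" "x \<in> \<xi>" "y \<in> \<eta>"
  shows "seq_asymp x y \<longleftrightarrow> \<xi> = \<eta>"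
proof
  assume "seq_asymp x y"
  then have "y \<in> \<xi>" using bpoint_eq[OF assms(1,3)] bpoint_seqs[OF assms(2,4)] by blast
  then show "\<xi> = \<eta>" using bpoint_eq[OF assms(1), of y] bpoint_eq[OF assms(2,4)] by simp
next
  assume "\<xi> = \<eta>"
  then show "seq_asymp x y" using bpoint_eq[OF assms(1,3)] assms(4) by blast
qed

end

section \<open>The boundary map and the excluded sphere\<close>

context rank_one_rep
begin

text \<open>The phase is an arbitrary choice, so no continuity can be expected of the vector itself;
  it is the entries of \<open>line_proj (boundary_dir \<xi>)\<close> that are continuous.\<close>

definition boundary_dir :: "(nat \<Rightarrow> 'g) set \<Rightarrow> 'i \<Rightarrow> complex" where
  "boundary_dir \<xi> = (SOME u. \<forall>x\<in>\<xi>. limit_dir x u)"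

lemma boundary_dir:
  assumes \<xi>: "\<xi> \<in> bpoints" and x: "x \<in> \<xi>"
  shows "limit_dir x (boundary_dir \<xi>)"
proof -
  obtain u where u: "limit_dir x u" using limit_dir_exists[OF bpoint_seqs[OF \<xi> x]] .
  have "\<forall>y\<in>\<xi>. limit_dir y u"
  proof
    fix y assume "y \<in> \<xi>"
    then show "limit_dir y u"
      using limit_dir_asymp[OF bpoint_seqs[OF \<xi> x] u bpoint_seqs[OF \<xi>]] bpoint_asymp_iff[OF \<xi> \<xi> x] by blast
  qed
  then have "\<exists>u. \<forall>y\<in>\<xi>. limit_dir y u" by blast
  from someI_ex[OF this] show ?thesis using x unfolding boundary_dir_def by blast
qed

lemma boundary_dir_transverse:
  assumes "\<xi> \<in> bpoints" "\<eta> \<in> bpoints" "\<xi> \<noteq> \<eta>"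
  shows "pairing (boundary_dir \<xi>) (boundary_dir \<eta>) \<noteq> 0"
proof -
  obtain x y where xy: "x \<in> \<xi>" "y \<in> \<eta>" using bpoint_nonempty assms by metis
  then have "\<not> seq_asymp x y" using bpoint_asymp_iff assms by blast
  then show ?thesis using transverse[of x y] bpoint_seqs boundary_dir xy assms by metis
qed

lemma gromov_nbhd_line_dist:
  assumes \<xi>: "\<xi> \<in> bpoints" and \<eta>: "\<eta> \<in> gromov_nbhd (carrier G) (word_dist G S) \<one> \<xi> (r + 1)"
  shows "line_dist (boundary_dir \<xi>) (boundary_dir \<eta>) \<le> C\<^sub>1 * exp (- \<mu> * r)"
proof -
  have \<eta>b: "\<eta> \<in> bpoints" using \<eta> by (simp add: gromov_nbhd_def)
  obtain x y where x: "x \<in> \<xi>" and y: "y \<in> \<eta>"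
    and lim: "ereal (r + 1) \<le> Liminf (sequentially \<times>\<^sub>F sequentially) (\<lambda>(i, j). ereal (gprod (x i) (y j)))"
    using \<eta> by (auto simp: gromov_nbhd_def)
  \<comment> \<open>The spare 1 makes the inequality strict, as is needed to pass from the lower
    limit to all late pairs of indices.\<close>
  have "ereal r < ereal (r + 1)" by simp
  also note lim
  finally have "\<forall>\<^sub>F p in sequentially \<times>\<^sub>F sequentially. ereal r < (\<lambda>(i, j). ereal (gprod (x i) (y j))) p"
    by (rule less_LiminfD)
  then obtain n where "\<forall>i\<ge>n. \<forall>j\<ge>n. r < gprod (x j) (y i)"
    unfolding eventually_prod_sequentially by auto
  then have n: "r \<le> gprod (x i) (y j)" if "n \<le> i" "n \<le> j" for i j using that by force
  show ?thesis
    by (rule limit_dir_gprod[OF bpoint_seqs[OF \<xi> x] boundary_dir[OF \<xi> x] bpoint_seqs[OF \<eta>b y] boundary_dir[OF \<eta>b y] n])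
qed

lemma continuous_boundary_dir:
  assumes ij: "i \<in> I" "j \<in> I"
  shows "continuous_map (group_boundary G S) euclidean (\<lambda>\<xi>. line_proj (boundary_dir \<xi>) i j)"
proof -
  let ?f = "\<lambda>\<xi>. line_proj (boundary_dir \<xi>) i j"
  have ts: "topspace (group_boundary G S) = bpoints" by (simp add: group_boundary_def topspace_gromov_boundary)
  have "openin (group_boundary G S) {\<xi> \<in> bpoints. ?f \<xi> \<in> U}" if U: "open U" for U
    unfolding group_boundary_def openin_gromov_boundary
  proof (intro conjI ballI)
    fix \<xi> assume "\<xi> \<in> {\<xi> \<in> bpoints. ?f \<xi> \<in> U}"
    then have \<xi>: "\<xi> \<in> bpoints" "?f \<xi> \<in> U" by auto
    obtain e where e: "0 < e" "ball (?f \<xi>) e \<subseteq> U" using U \<xi>(2) by (meson open_contains_ball)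
    obtain r where r: "C\<^sub>1 * exp (- \<mu> * r) < e" using exp_small[OF e(1)] .
    show "\<exists>r. gromov_nbhd (carrier G) (word_dist G S) \<one> \<xi> r \<subseteq> {\<xi> \<in> bpoints. ?f \<xi> \<in> U}"
    proof (intro exI subsetI)
      fix \<eta> assume \<eta>: "\<eta> \<in> gromov_nbhd (carrier G) (word_dist G S) \<one> \<xi> (r + 1)"
      then have "\<eta> \<in> bpoints" by (simp add: gromov_nbhd_def)
      moreover have "dist (?f \<xi>) (?f \<eta>) < e"
        using entry_le_line_dist[OF ij, of "boundary_dir \<xi>" "boundary_dir \<eta>"] gromov_nbhd_line_dist[OF \<xi>(1) \<eta>] r
        by (simp add: dist_norm)
      ultimately show "\<eta> \<in> {\<xi> \<in> bpoints. ?f \<xi> \<in> U}" using e(2) by auto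
    qed
  qed auto
  then show ?thesis unfolding continuous_map_def ts by simp
qed

theorem no_proper_sphere:
  assumes P: "P \<subset> topspace (group_boundary G S)"
    and homeo: "subtopology (group_boundary G S) P homeomorphic_space top_of_set (sphere (0 :: real ^ 3) 1)"
  shows False
proof -
  let ?X = "group_boundary G S" and ?S = "sphere (0 :: real ^ 3) 1"
  have ts: "topspace ?X = bpoints" by (simp add: group_boundary_def topspace_gromov_boundary)
  obtain \<eta> where \<eta>: "\<eta> \<in> bpoints" "\<eta> \<notin> P" using P ts by auto
  obtain h where h: "homeomorphic_map (top_of_set ?S) (subtopology ?X P) h"
    using homeo homeomorphic_space_sym homeomorphic_space by blast
  have hc: "continuous_map (top_of_set ?S) ?X h" and hP: "\<And>s. s \<in> ?S \<Longrightarrow> h s \<in> P"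
    using homeomorphic_imp_continuous_map[OF h] by (auto simp: continuous_map_in_subtopology image_subset_iff Pi_iff)
  have inj: "inj_on h ?S" using homeomorphic_imp_injective_map[OF h] by simp
  have hb: "h s \<in> bpoints" if "s \<in> ?S" for s using hP[OF that] P ts by auto
  have neg: "- s \<in> ?S" if "s \<in> ?S" for s using that by simp
  define t where "t s = pairing (boundary_dir (h s)) (boundary_dir \<eta>)" for s
  \<comment> \<open>The conjugate of \<open>t s\<close> cancels the arbitrary phase of
    \<open>boundary_dir (h s)\<close>, so v can be written through \<open>line_proj\<close> and is
    continuous. The factor is nonzero on the sphere, since \<open>h s\<close> lies in P and \<eta>
    does not.\<close>
  define v where "v s i = boundary_dir (h s) i * cnj (t s)" for s i
  have v_eq: "v s i = (\<Sum>a\<in>I. line_proj (boundary_dir (h s)) i a * cnj (mapply I J (boundary_dir \<eta>) a))" for s i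
    by (simp add: v_def t_def pairing_mapply line_proj_def sum_distrib_left mult.assoc)
  have v_cont: "continuous_on ?S (\<lambda>s. v s i)" if i: "i \<in> I" for i
  proof -
    have "continuous_on ?S (\<lambda>s. line_proj (boundary_dir (h s)) i a)" if "a \<in> I" for a
      using continuous_map_compose[OF hc continuous_boundary_dir[OF i that]] by (simp add: o_def)
    then show ?thesis unfolding v_eq by (intro continuous_intros) auto
  qed
  have v_cont': "continuous_on ?S (\<lambda>s. v (- s) i)" if i: "i \<in> I" for i
    by (rule continuous_on_compose2[OF v_cont[OF i]]) (auto intro!: continuous_intros)
  define F where "F s = pairing (v s) (v (- s))" for s
  have F_eq: "F s = cnj (t s) * cnj (t (- s)) * pairing (boundary_dir (h s)) (boundary_dir (h (- s)))" for s
    by (simp add: F_def pairing_def v_def sum_distrib_left mult_ac)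
  show False
  proof (rule no_odd_map_sphere[of F])
    show "continuous_on ?S F" unfolding F_def pairing_def
      by (intro continuous_intros v_cont v_cont') auto
    show "F (- s) = - F s" for s using pairing_antisym[of "v s" "v (- s)"] by (simp add: F_def)
    show "F s \<noteq> 0" if s: "s \<in> ?S" for s
    proof -
      have "h s \<noteq> h (- s)"
      proof
        assume "h s = h (- s)"
        then have "s = - s" using inj_onD[OF inj _ s neg[OF s]] by blast
        then have "2 *\<^sub>R s = 0" unfolding scaleR_2 by (simp only: eq_neg_iff_add_eq_0)
        then show False using s by simp
      qed
      moreover have "t r \<noteq> 0" if "r \<in> ?S" for r
        unfolding t_def using boundary_dir_transverse[OF hb[OF that] \<eta>(1)] hP[OF that] \<eta>(2) by metis
      ultimately show ?thesis unfolding F_eq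
        using boundary_dir_transverse[OF hb[OF s] hb[OF neg[OF s]]] s neg[OF s] by simp
    qed
  qed
qed

end

section \<open>Compound matrices on tuples\<close>

text \<open>Extensional functions: the set is finite, and two tuples that agree below k are
  equal.\<close>

definition tuples :: "nat \<Rightarrow> nat \<Rightarrow> (nat \<Rightarrow> nat) set" where
  "tuples k d = {0..<k} \<rightarrow>\<^sub>E {0..<d}"

definition minor :: "nat \<Rightarrow> complex mat \<Rightarrow> (nat \<Rightarrow> nat) \<Rightarrow> (nat \<Rightarrow> nat) \<Rightarrow> complex" where
  "minor k A i j = Determinant.det (Matrix.mat k k (\<lambda>(a, b). A $$ (i a, j b)))"

text \<open>The \<open>k\<close>-th compound, indexed by all \<open>k\<close>-tuples instead of the increasing ones: it is the
  action on the \<open>k\<close>-th tensor power followed by antisymmetrisation. So the compound of the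
  identity is the projection onto antisymmetric tensors, and multiplicativity (Cauchy--Binet)
  needs no ordering of the indices.\<close>

definition compound :: "nat \<Rightarrow> nat \<Rightarrow> complex mat \<Rightarrow> (nat \<Rightarrow> nat) \<Rightarrow> (nat \<Rightarrow> nat) \<Rightarrow> complex" where
  "compound k d A i j = (if i \<in> tuples k d \<and> j \<in> tuples k d then minor k A i j / fact k else 0)"

lemma finite_tuples [simp]: "finite (tuples k d)"
  unfolding tuples_def by (intro finite_PiE) auto

lemma tuples_less: "w \<in> tuples k d \<Longrightarrow> a < k \<Longrightarrow> w a < d"
  unfolding tuples_def by (auto simp: PiE_iff)

lemma restrict_tuples: "(\<And>a. a < k \<Longrightarrow> f a < d) \<Longrightarrow> restrict f {0..<k} \<in> tuples k d"
  by (auto simp: tuples_def)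

lemma tuples_permute:
  assumes w: "w \<in> tuples k d" and p: "p permutes {0..<k}" shows "w \<circ> p \<in> tuples k d"
proof -
  have "p a < k" if "a < k" for a using permutes_in_image[OF p, of a] that by simp
  moreover have "p a = a" if "\<not> a < k" for a using permutes_not_in[OF p, of a] that by simp
  ultimately show ?thesis using w by (auto simp: tuples_def PiE_iff extensional_def)
qed

lemma sum_tuples_permute:
  assumes p: "p permutes {0..<k}"
  shows "(\<Sum>w\<in>tuples k d. f (w \<circ> p)) = (\<Sum>w\<in>tuples k d. f w)"
  by (rule sum.reindex_bij_witness[of _ "\<lambda>w. w \<circ> inv_into UNIV p" "\<lambda>w. w \<circ> p"])
    (auto simp: o_assoc[symmetric] permutes_inv_o[OF p] tuples_permute[OF _ p] tuples_permute[OF _ permutes_inv[OF p]])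

lemma det_mat_eq:
  "Determinant.det (Matrix.mat n n (\<lambda>(a, b). f a b) :: complex mat)
    = (\<Sum>p | p permutes {0..<n}. of_int (sign p) * (\<Prod>a = 0..<n. f a (p a)))"
proof -
  have "p a < n" if "p permutes {0..<n}" "a < n" for p a using permutes_in_image[OF that(1), of a] that by simp
  then show ?thesis by (subst det_def'[of _ n]) (auto intro!: sum.cong prod.cong)
qed

text \<open>Multilinearity in the rows: choosing the summation index of each row independently
  produces exactly the k-tuples, repetitions included.\<close>

lemma det_rows_expand:
  fixes X Y :: "nat \<Rightarrow> nat \<Rightarrow> complex"
  shows "Determinant.det (Matrix.mat k k (\<lambda>(a, b). \<Sum>c = 0..<d. X a c * Y c b))
    = (\<Sum>w\<in>tuples k d. (\<Prod>a = 0..<k. X a (w a)) * Determinant.det (Matrix.mat k k (\<lambda>(a, b). Y (w a) b)))"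
proof -
  have "Determinant.det (Matrix.mat k k (\<lambda>(a, b). \<Sum>c = 0..<d. X a c * Y c b))
    = (\<Sum>p | p permutes {0..<k}. \<Sum>w\<in>tuples k d. of_int (sign p) * ((\<Prod>a = 0..<k. X a (w a)) * (\<Prod>a = 0..<k. Y (w a) (p a))))"
    unfolding det_mat_eq tuples_def by (simp add: prod_sum_PiE prod.distrib sum_distrib_left)
  also have "\<dots> = (\<Sum>w\<in>tuples k d. (\<Prod>a = 0..<k. X a (w a)) * Determinant.det (Matrix.mat k k (\<lambda>(a, b). Y (w a) b)))"
    unfolding det_mat_eq sum_distrib_left by (subst sum.swap) (simp add: mult_ac)
  finally show ?thesis .
qed

lemma det_rows_permute:
  fixes Y :: "nat \<Rightarrow> nat \<Rightarrow> complex"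
  assumes p: "p permutes {0..<k}"
  shows "Determinant.det (Matrix.mat k k (\<lambda>(a, b). Y (p a) b)) = of_int (sign p) * Determinant.det (Matrix.mat k k (\<lambda>(a, b). Y a b))"
proof -
  have "Matrix.mat k k (\<lambda>(a, b). Y (p a) b) = Matrix.mat k k (\<lambda>(a, b). Matrix.mat k k (\<lambda>(a, b). Y a b) $$ (p a, b))"
    using permutes_in_image[OF p] by (intro eq_matI) auto
  then show ?thesis using det_permute_rows[OF mat_carrier p, of "\<lambda>(a, b). Y a b"] by simp
qed

lemma det_mat_transpose:
  "Determinant.det (Matrix.mat k k (\<lambda>(a, b). f b a)) = Determinant.det (Matrix.mat k k (\<lambda>(a, b). f a b) :: complex mat)"
proof -
  have "Matrix.mat k k (\<lambda>(a, b). f b a) = Matrix.transpose_mat (Matrix.mat k k (\<lambda>(a, b). f a b))"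
    by (intro eq_matI) auto
  then show ?thesis using Determinant.det_transpose[OF mat_carrier] by metis
qed

lemma det_columns_permute:
  fixes Y :: "nat \<Rightarrow> nat \<Rightarrow> complex"
  assumes p: "p permutes {0..<k}"
  shows "Determinant.det (Matrix.mat k k (\<lambda>(a, b). Y a (p b))) = of_int (sign p) * Determinant.det (Matrix.mat k k (\<lambda>(a, b). Y a b))"
  using det_rows_permute[OF p, of "\<lambda>a b. Y b a"] det_mat_transpose[of k "\<lambda>b a. Y a (p b)"] det_mat_transpose[of k "\<lambda>b a. Y a b"]
  by simp

lemma of_int_sign_square [simp]: "(of_int (sign p) :: complex) * of_int (sign p) = 1"
  by (simp add: sign_def)

text \<open>In the Leibniz formula, reindexing the tuples by p moves p from the product to f, whose
  sign cancels the sign of p. All \<open>fact k\<close> permutations thus contribute the same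
  term.\<close>

lemma sum_det_antisym:
  fixes X :: "nat \<Rightarrow> nat \<Rightarrow> complex"
  assumes f: "\<And>w p. w \<in> tuples k d \<Longrightarrow> p permutes {0..<k} \<Longrightarrow> f (w \<circ> p) = of_int (sign p) * f w"
  shows "(\<Sum>w\<in>tuples k d. Determinant.det (Matrix.mat k k (\<lambda>(a, b). X a (w b))) * f w)
    = fact k * (\<Sum>w\<in>tuples k d. (\<Prod>a = 0..<k. X a (w a)) * f w)"
proof -
  have "(\<Sum>w\<in>tuples k d. Determinant.det (Matrix.mat k k (\<lambda>(a, b). X a (w b))) * f w)
    = (\<Sum>p | p permutes {0..<k}. \<Sum>w\<in>tuples k d. of_int (sign p) * (\<Prod>a = 0..<k. X a (w (p a))) * f w)"
    unfolding det_mat_eq sum_distrib_right by (rule sum.swap)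
  also have "\<dots> = (\<Sum>p | p permutes {0..<k}. \<Sum>w\<in>tuples k d. (\<Prod>a = 0..<k. X a ((w \<circ> p) a)) * f (w \<circ> p))"
    by (intro sum.cong refl) (simp add: f mult_ac)
  also have "\<dots> = (\<Sum>p | p permutes {0..<k}. \<Sum>w\<in>tuples k d. (\<Prod>a = 0..<k. X a (w a)) * f w)"
    by (intro sum.cong refl sum_tuples_permute) auto
  also have "\<dots> = fact k * (\<Sum>w\<in>tuples k d. (\<Prod>a = 0..<k. X a (w a)) * f w)"
    by (simp add: card_permutations)
  finally show ?thesis .
qed

lemma minor_permute_left: "p permutes {0..<k} \<Longrightarrow> minor k A (i \<circ> p) j = of_int (sign p) * minor k A i j"
  unfolding minor_def using det_rows_permute[of p k "\<lambda>a b. A $$ (i a, j b)"] by simp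

lemma minor_permute_right: "p permutes {0..<k} \<Longrightarrow> minor k A i (j \<circ> p) = of_int (sign p) * minor k A i j"
  unfolding minor_def using det_columns_permute[of p k "\<lambda>a b. A $$ (i a, j b)"] by simp

text \<open>On antisymmetric functions the compound acts like the plain tensor power, the
  \<open>fact k\<close> equal terms cancelling the normalising division.\<close>

lemma sum_minor_antisym:
  assumes f: "\<And>w p. w \<in> tuples k d \<Longrightarrow> p permutes {0..<k} \<Longrightarrow> f (w \<circ> p) = of_int (sign p) * f w"
    and i: "i \<in> tuples k d"
  shows "(\<Sum>w\<in>tuples k d. compound k d A i w * f w) = (\<Sum>w\<in>tuples k d. (\<Prod>a = 0..<k. A $$ (i a, w a)) * f w)"
    and "(\<Sum>w\<in>tuples k d. compound k d A w i * f w) = (\<Sum>w\<in>tuples k d. (\<Prod>a = 0..<k. A $$ (w a, i a)) * f w)"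
proof -
  have "(\<Sum>w\<in>tuples k d. compound k d A i w * f w) = (\<Sum>w\<in>tuples k d. minor k A i w * f w) / fact k"
    unfolding sum_divide_distrib using i by (intro sum.cong refl) (simp add: compound_def)
  then show "(\<Sum>w\<in>tuples k d. compound k d A i w * f w) = (\<Sum>w\<in>tuples k d. (\<Prod>a = 0..<k. A $$ (i a, w a)) * f w)"
    unfolding minor_def using sum_det_antisym[of k d f "\<lambda>a c. A $$ (i a, c)", OF f] by simp
  have "(\<Sum>w\<in>tuples k d. compound k d A w i * f w) = (\<Sum>w\<in>tuples k d. minor k A w i * f w) / fact k"
    unfolding sum_divide_distrib using i by (intro sum.cong refl) (simp add: compound_def)
  then show "(\<Sum>w\<in>tuples k d. compound k d A w i * f w) = (\<Sum>w\<in>tuples k d. (\<Prod>a = 0..<k. A $$ (w a, i a)) * f w)"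
    unfolding minor_def det_mat_transpose[of k "\<lambda>b a. A $$ (w a, i b)" for w]
    using sum_det_antisym[of k d f "\<lambda>a c. A $$ (c, i a)", OF f] by simp
qed

text \<open>Cauchy-Binet over all tuples. The minors of B are antisymmetric in the row tuple, so the
  compound of A may be replaced by products of entries, and these are the coefficients in the row
  expansion of a minor of A B.\<close>

lemma compound_mult:
  assumes A: "A \<in> carrier_mat d d" and B: "B \<in> carrier_mat d d"
  shows "compound k d (A * B) i j = (\<Sum>w\<in>tuples k d. compound k d A i w * compound k d B w j)"
proof (cases "i \<in> tuples k d \<and> j \<in> tuples k d")
  case True
  then have ij: "i \<in> tuples k d" "j \<in> tuples k d" by auto
  have "(\<Sum>w\<in>tuples k d. compound k d A i w * compound k d B w j)
      = (\<Sum>w\<in>tuples k d. compound k d A i w * minor k B w j) / fact k"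
    unfolding sum_divide_distrib using ij by (intro sum.cong refl) (simp add: compound_def)
  also have "(\<Sum>w\<in>tuples k d. compound k d A i w * minor k B w j)
      = (\<Sum>w\<in>tuples k d. (\<Prod>a = 0..<k. A $$ (i a, w a)) * minor k B w j)"
    by (rule sum_minor_antisym(1)[OF minor_permute_left ij(1)])
  also have "\<dots> = Determinant.det (Matrix.mat k k (\<lambda>(a, b). \<Sum>c = 0..<d. A $$ (i a, c) * B $$ (c, j b)))"
    unfolding minor_def by (rule det_rows_expand[symmetric])
  also have "\<dots> = minor k (A * B) i j"
    unfolding minor_def using A B tuples_less[OF ij(1)] tuples_less[OF ij(2)]
    by (intro arg_cong[of _ _ Determinant.det] eq_matI) (auto simp: scalar_prod_def)
  finally show ?thesis using True by (simp add: compound_def)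
qed (auto simp: compound_def)

lemma compound_le_1:
  assumes "\<And>i j. i < d \<Longrightarrow> j < d \<Longrightarrow> cmod (A $$ (i, j)) \<le> 1"
  shows "cmod (compound k d A i j) \<le> 1"
proof (cases "i \<in> tuples k d \<and> j \<in> tuples k d")
  case True
  have "cmod (minor k A i j) \<le> (\<Sum>p | p permutes {0..<k}. cmod (of_int (sign p) * (\<Prod>a = 0..<k. A $$ (i a, j (p a)))))"
    unfolding minor_def det_mat_eq by (rule norm_sum)
  also have "\<dots> \<le> (\<Sum>p | p permutes {0..<k}. 1)"
  proof (rule sum_mono)
    fix p assume "p \<in> {p. p permutes {0..<k}}"
    then have p: "p a < k" if "a < k" for a using permutes_in_image[of p "{0..<k}" a] that by simp
    have "(\<Prod>a = 0..<k. cmod (A $$ (i a, j (p a)))) \<le> 1"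
    proof (intro prod_le_1 conjI)
      fix a assume "a \<in> {0..<k}"
      then have "i a < d" "j (p a) < d" using True p[of a] tuples_less[of i k d a] tuples_less[of j k d "p a"] by auto
      then show "cmod (A $$ (i a, j (p a))) \<le> 1" by (rule assms)
    qed simp
    then show "cmod (of_int (sign p) * (\<Prod>a = 0..<k. A $$ (i a, j (p a)))) \<le> 1"
      by (simp add: norm_mult prod_norm sign_def)
  qed
  also have "\<dots> = fact k" by (simp add: card_permutations)
  finally show ?thesis using True by (simp add: compound_def norm_divide)
qed (auto simp: compound_def)

lemma minor_not_inj_left:
  assumes "\<not> inj_on i {0..<k}" shows "minor k A i j = 0"
proof -
  obtain a b where "a < k" "b < k" "a \<noteq> b" "i a = i b" using assms by (auto simp: inj_on_def)
  then show ?thesis unfolding minor_def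
    by (intro det_identical_rows[of _ k a b]) (auto simp: Matrix.row_def)
qed

lemma minor_not_inj_right:
  assumes "\<not> inj_on j {0..<k}" shows "minor k A i j = 0"
proof -
  obtain a b where ab: "a < k" "b < k" "a \<noteq> b" "j a = j b" using assms by (auto simp: inj_on_def)
  have "minor k A i j = Determinant.det (Matrix.mat k k (\<lambda>(a, b). A $$ (i b, j a)))"
    unfolding minor_def by (rule det_mat_transpose[symmetric])
  also have "\<dots> = 0" using ab by (intro det_identical_rows[of _ k a b]) (auto simp: Matrix.row_def)
  finally show ?thesis .
qed

section \<open>The wedge pairing: antisymmetry, invariance, nondegeneracy\<close>

definition concat_tuple :: "nat \<Rightarrow> (nat \<Rightarrow> nat) \<Rightarrow> (nat \<Rightarrow> nat) \<Rightarrow> nat \<Rightarrow> nat" where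
  "concat_tuple k i j a = (if a < k then i a else j (a - k))"

text \<open>The Levi-Civita symbol of the concatenated tuple, that is, the matrix of the wedge pairing.\<close>

definition levi :: "nat \<Rightarrow> (nat \<Rightarrow> nat) \<Rightarrow> (nat \<Rightarrow> nat) \<Rightarrow> complex" where
  "levi k i j = Determinant.det (Matrix.mat (2 * k) (2 * k) (\<lambda>(a, b). if concat_tuple k i j a = b then 1 else 0))"

lemma levi_permute_left:
  assumes p: "p permutes {0..<k}" shows "levi k (i \<circ> p) j = of_int (sign p) * levi k i j"
proof -
  have p2: "p permutes {0..<2 * k}" using p by (rule permutes_subset) auto
  have "concat_tuple k (i \<circ> p) j a = concat_tuple k i j (p a)" for a
    using permutes_in_image[OF p, of a] permutes_not_in[OF p, of a] by (auto simp: concat_tuple_def)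
  then show ?thesis unfolding levi_def using det_rows_permute[OF p2, of "\<lambda>a b. if concat_tuple k i j a = b then 1 else 0"] by simp
qed

text \<open>Exchanges only the first m entries of two blocks of length k, so that the full exchange
  is reached by induction on m, one transposition at a time.\<close>

definition block_swap :: "nat \<Rightarrow> nat \<Rightarrow> nat \<Rightarrow> nat" where
  "block_swap k m x = (if x < m then x + k else if k \<le> x \<and> x < k + m then x - k else x)"

lemma block_swap: "m \<le> k \<Longrightarrow> block_swap k m permutes {0..<2 * k} \<and> sign (block_swap k m) = (- 1) ^ m"
proof (induction m)
  case 0
  have "block_swap k 0 = id" by (auto simp: block_swap_def)
  then show ?case by (metis permutes_id power_0 sign_id)
next
  case (Suc m)
  have eq: "block_swap k (Suc m) = Transposition.transpose m (m + k) \<circ> block_swap k m"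
    using Suc.prems by (auto simp: block_swap_def Transposition.transpose_def fun_eq_iff)
  have t: "Transposition.transpose m (m + k) permutes {0..<2 * k}" using Suc.prems by (intro permutes_swap_id) auto
  have "permutation (Transposition.transpose m (m + k))" "permutation (block_swap k m)"
    using t Suc permutes_imp_permutation[of "{0..<2 * k}"] by auto
  then have "sign (block_swap k (Suc m)) = sign (Transposition.transpose m (m + k)) * sign (block_swap k m)"
    unfolding eq by (rule sign_compose)
  then have "sign (block_swap k (Suc m)) = (- 1) ^ Suc m" using Suc by (simp add: sign_swap_id)
  moreover have "block_swap k (Suc m) permutes {0..<2 * k}"
    unfolding eq using Suc t by (intro permutes_compose) auto
  ultimately show ?case by blast
qed

text \<open>Exchanging the two tuples permutes the rows by a product of k transpositions, and k is
  odd.\<close>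

lemma levi_antisym:
  assumes "odd k" shows "levi k i j = - levi k j i"
proof -
  have p: "block_swap k k permutes {0..<2 * k}" "sign (block_swap k k) = - 1" using block_swap[of k k] assms by auto
  have "Matrix.mat (2 * k) (2 * k) (\<lambda>(a, b). if concat_tuple k i j a = b then 1 else 0)
      = (Matrix.mat (2 * k) (2 * k) (\<lambda>(a, b). if concat_tuple k j i (block_swap k k a) = b then 1 else 0) :: complex mat)"
    by (intro eq_matI) (auto simp: concat_tuple_def block_swap_def)
  then show ?thesis unfolding levi_def
    using det_rows_permute[OF p(1), of "\<lambda>a b. if concat_tuple k j i a = b then 1 else 0"] p(2) by simp
qed

text \<open>Splits a tuple of length 2 k into halves. \<open>concat_tuple\<close> is not extensional
  from 2 k on, so g has to depend on the entries below 2 k only.\<close>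

lemma sum_concat_tuples:
  fixes g :: "(nat \<Rightarrow> nat) \<Rightarrow> 'b::comm_monoid_add"
  assumes g: "\<And>v w. (\<And>a. a < 2 * k \<Longrightarrow> v a = w a) \<Longrightarrow> g v = g w"
  shows "(\<Sum>p\<in>tuples k d. \<Sum>r\<in>tuples k d. g (concat_tuple k p r)) = (\<Sum>w\<in>tuples (2 * k) d. g w)"
proof -
  have "(\<Sum>p\<in>tuples k d. \<Sum>r\<in>tuples k d. g (concat_tuple k p r)) = (\<Sum>(p, r)\<in>tuples k d \<times> tuples k d. g (concat_tuple k p r))"
    by (simp add: sum.cartesian_product)
  also have "\<dots> = (\<Sum>w\<in>tuples (2 * k) d. g w)"
  proof (rule sum.reindex_bij_witness[of _ "\<lambda>w. (restrict w {0..<k}, restrict (\<lambda>a. w (a + k)) {0..<k})"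
        "\<lambda>(p, r). restrict (concat_tuple k p r) {0..<2 * k}"], goal_cases)
    case (1 x)
    then show ?case by (auto simp: tuples_def concat_tuple_def PiE_iff extensional_def fun_eq_iff)
  next
    case (2 x)
    then obtain p r where x: "x = (p, r)" "p \<in> tuples k d" "r \<in> tuples k d" by auto
    have "concat_tuple k p r a < d" if "a < 2 * k" for a
      using that tuples_less[OF x(2), of a] tuples_less[OF x(3), of "a - k"] by (auto simp: concat_tuple_def)
    then show ?case using restrict_tuples[of "2 * k" "concat_tuple k p r" d] by (simp add: x(1))
  next
    case (3 w)
    then show ?case by (auto simp: tuples_def concat_tuple_def PiE_iff extensional_def fun_eq_iff restrict_def)
  next
    case (4 w)
    have "w a < d" "w (a + k) < d" if "a < k" for a
      using that tuples_less[OF 4, of a] tuples_less[OF 4, of "a + k"] by auto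
    then show ?case using restrict_tuples[of k w d] restrict_tuples[of k "\<lambda>a. w (a + k)" d] by simp
  next
    case (5 x)
    then show ?case by (auto intro!: g)
  qed
  finally show ?thesis .
qed

text \<open>As \<open>levi\<close> is antisymmetric within each of its tuples, both compounds can be
  replaced by products of entries. The double sum becomes the row expansion of det (P A^T), where P
  is the 0/1 matrix with determinant \<open>levi k i j\<close>, and det A = 1.\<close>

lemma levi_invariant:
  assumes k: "odd k" and A: "A \<in> carrier_mat (2 * k) (2 * k)" and det: "Determinant.det A = 1"
    and i: "i \<in> tuples k (2 * k)" and j: "j \<in> tuples k (2 * k)"
  shows "(\<Sum>p\<in>tuples k (2 * k). \<Sum>r\<in>tuples k (2 * k).
    compound k (2 * k) A p i * levi k p r * compound k (2 * k) A r j) = levi k i j"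
proof -
  let ?T = "tuples k (2 * k)" and ?C = "compound k (2 * k) A"
  have levi_right: "levi k p (r \<circ> q) = of_int (sign q) * levi k p r" if "q permutes {0..<k}" for p q r
    using levi_antisym[OF k, of p "r \<circ> q"] levi_antisym[OF k, of r p] levi_permute_left[OF that, of r p] by simp
  define g where "g w = (\<Prod>a = 0..<2 * k. A $$ (w a, concat_tuple k i j a)) *
      Determinant.det (Matrix.mat (2 * k) (2 * k) (\<lambda>(a, b). if w a = b then 1 else 0))" for w
  have g_cong: "g v = g w" if "\<And>a. a < 2 * k \<Longrightarrow> v a = w a" for v w
  proof -
    have "Matrix.mat (2 * k) (2 * k) (\<lambda>(a, b). if v a = b then 1 else 0)
      = (Matrix.mat (2 * k) (2 * k) (\<lambda>(a, b). if w a = b then 1 else 0) :: complex mat)" using that by (intro eq_matI) auto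
    moreover have "(\<Prod>a = 0..<2 * k. A $$ (v a, concat_tuple k i j a)) = (\<Prod>a = 0..<2 * k. A $$ (w a, concat_tuple k i j a))"
      using that by (intro prod.cong) auto
    ultimately show ?thesis by (simp add: g_def)
  qed
  define F where "F p = (\<Sum>r\<in>?T. (\<Prod>a = 0..<k. A $$ (r a, j a)) * levi k p r)" for p
  have F: "F (p \<circ> q) = of_int (sign q) * F p" if "q permutes {0..<k}" for p q
    unfolding F_def using levi_permute_left[OF that] by (simp add: sum_distrib_left mult_ac)
  have "(\<Sum>r\<in>?T. ?C p i * levi k p r * ?C r j) = ?C p i * F p" for p
  proof -
    have "(\<Sum>r\<in>?T. ?C p i * levi k p r * ?C r j) = ?C p i * (\<Sum>r\<in>?T. ?C r j * levi k p r)"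
      by (simp add: sum_distrib_left mult_ac)
    also have "(\<Sum>r\<in>?T. ?C r j * levi k p r) = F p"
      unfolding F_def by (rule sum_minor_antisym(2)[OF levi_right j])
    finally show ?thesis .
  qed
  then have "(\<Sum>p\<in>?T. \<Sum>r\<in>?T. ?C p i * levi k p r * ?C r j) = (\<Sum>p\<in>?T. ?C p i * F p)" by simp
  also have "\<dots> = (\<Sum>p\<in>?T. (\<Prod>a = 0..<k. A $$ (p a, i a)) * F p)"
    by (rule sum_minor_antisym(2)[OF F i])
  also have "\<dots> = (\<Sum>p\<in>?T. \<Sum>r\<in>?T. (\<Prod>a = 0..<k. A $$ (p a, i a)) * (\<Prod>a = 0..<k. A $$ (r a, j a)) * levi k p r)"
    by (simp add: F_def sum_distrib_left mult.assoc)
  also have "\<dots> = (\<Sum>p\<in>?T. \<Sum>r\<in>?T. g (concat_tuple k p r))"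
  proof (intro sum.cong refl)
    fix p r
    have "(\<Prod>a = 0..<2 * k. A $$ (concat_tuple k p r a, concat_tuple k i j a))
        = (\<Prod>a = 0..<k. A $$ (concat_tuple k p r a, concat_tuple k i j a)) * (\<Prod>a = k..<2 * k. A $$ (concat_tuple k p r a, concat_tuple k i j a))"
      by (rule prod.atLeastLessThan_concat[symmetric]) auto
    also have "(\<Prod>a = 0..<k. A $$ (concat_tuple k p r a, concat_tuple k i j a)) = (\<Prod>a = 0..<k. A $$ (p a, i a))"
      by (intro prod.cong) (auto simp: concat_tuple_def)
    also have "(\<Prod>a = k..<2 * k. A $$ (concat_tuple k p r a, concat_tuple k i j a)) = (\<Prod>a = 0..<k. A $$ (r a, j a))"
      by (rule prod.reindex_bij_witness[of _ "\<lambda>a. a + k" "\<lambda>a. a - k"]) (auto simp: concat_tuple_def)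
    finally show "(\<Prod>a = 0..<k. A $$ (p a, i a)) * (\<Prod>a = 0..<k. A $$ (r a, j a)) * levi k p r
      = g (concat_tuple k p r)"
      by (simp add: levi_def g_def)
  qed
  also have "\<dots> = (\<Sum>w\<in>tuples (2 * k) (2 * k). g w)" by (rule sum_concat_tuples) (rule g_cong)
  also have "\<dots> = Determinant.det (Matrix.mat (2 * k) (2 * k)
      (\<lambda>(a, b). \<Sum>c = 0..<2 * k. A $$ (c, concat_tuple k i j a) * (if c = b then 1 else 0)))"
    unfolding g_def by (rule det_rows_expand[symmetric])
  also have "Matrix.mat (2 * k) (2 * k) (\<lambda>(a, b). \<Sum>c = 0..<2 * k. A $$ (c, concat_tuple k i j a) * (if c = b then 1 else 0))
      = Matrix.mat (2 * k) (2 * k) (\<lambda>(a, b). if concat_tuple k i j a = b then 1 else 0) * Matrix.transpose_mat A"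
  proof (intro eq_matI)
    fix a b assume "a < dim_row (Matrix.mat (2 * k) (2 * k) (\<lambda>(a, b). if concat_tuple k i j a = b then 1 else 0 :: complex) * Matrix.transpose_mat A)"
      "b < dim_col (Matrix.mat (2 * k) (2 * k) (\<lambda>(a, b). if concat_tuple k i j a = b then 1 else 0 :: complex) * Matrix.transpose_mat A)"
    then have ab: "a < 2 * k" "b < 2 * k" using A by auto
    have "concat_tuple k i j a < 2 * k" using ab tuples_less[OF i, of a] tuples_less[OF j, of "a - k"] by (auto simp: concat_tuple_def)
    then show "Matrix.mat (2 * k) (2 * k) (\<lambda>(a, b). \<Sum>c = 0..<2 * k. A $$ (c, concat_tuple k i j a) * (if c = b then 1 else 0)) $$ (a, b)
      = (Matrix.mat (2 * k) (2 * k) (\<lambda>(a, b). if concat_tuple k i j a = b then 1 else 0) * Matrix.transpose_mat A) $$ (a, b)"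
      using ab A by (simp add: scalar_prod_def if_distrib[of "\<lambda>x. _ * x"] if_distrib[of "\<lambda>x. x * _"] sum.delta sum.delta' cong: if_cong)
  qed (use A in auto)
  also have "Determinant.det \<dots> = levi k i j"
    using det_mult[of "Matrix.mat (2 * k) (2 * k) (\<lambda>(a, b). if concat_tuple k i j a = b then 1 else 0)" "2 * k" "Matrix.transpose_mat A"]
      A det Determinant.det_transpose[OF A] by (simp add: levi_def)
  finally show ?thesis .
qed

text \<open>Let j enumerate the complement of the range of i. Permuting columns by the permutation
  \<sigma> that i and j form together makes the matrix of \<open>levi k i' j\<close> block upper
  triangular, with the matrix of the minor and the identity as diagonal blocks.\<close>

lemma levi_complement:
  assumes i: "i \<in> tuples k (2 * k)" and inj: "inj_on i {0..<k}"
  shows "\<exists>j\<in>tuples k (2 * k). \<exists>\<sigma> :: nat \<Rightarrow> nat. \<forall>i'\<in>tuples k (2 * k).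
    levi k i' j = of_int (sign \<sigma>) * minor k (1\<^sub>m (2 * k)) i' i"
proof -
  let ?n = "2 * k"
  have im: "i ` {0..<k} \<subseteq> {0..<?n}" using tuples_less[OF i] by auto
  have "card ({0..<?n} - i ` {0..<k}) = card {k..<?n}" using inj im by (simp add: card_Diff_subset card_image)
  then obtain h where h: "bij_betw h {k..<?n} ({0..<?n} - i ` {0..<k})"
    by (metis finite_same_card_bij finite_atLeastLessThan finite_Diff)
  define \<sigma> where "\<sigma> a = (if a < k then i a else if a < ?n then h a else a)" for a
  have "bij_betw \<sigma> {0..<k} (i ` {0..<k})"
    using inj_on_imp_bij_betw[OF inj] by (rule bij_betw_cong[THEN iffD1, rotated]) (simp add: \<sigma>_def)
  moreover have "bij_betw \<sigma> {k..<?n} ({0..<?n} - i ` {0..<k})"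
    using h by (rule bij_betw_cong[THEN iffD1, rotated]) (simp add: \<sigma>_def)
  ultimately have "bij_betw \<sigma> ({0..<k} \<union> {k..<?n}) (i ` {0..<k} \<union> ({0..<?n} - i ` {0..<k}))"
    by (rule bij_betw_combine) auto
  moreover have "{0..<k} \<union> {k..<?n} = {0..<?n}" "i ` {0..<k} \<union> ({0..<?n} - i ` {0..<k}) = {0..<?n}" using im by auto
  ultimately have "bij_betw \<sigma> {0..<?n} {0..<?n}" by simp
  then have \<sigma>: "\<sigma> permutes {0..<?n}" by (rule bij_imp_permutes) (auto simp: \<sigma>_def)
  have \<sigma>_less: "\<sigma> a < ?n" if "a < ?n" for a using permutes_in_image[OF \<sigma>, of a] that by simp
  have \<sigma>_eq: "\<sigma> a = \<sigma> b \<longleftrightarrow> a = b" for a b using permutes_inj[OF \<sigma>] by (auto simp: inj_def)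
  define j where "j = restrict (\<lambda>a. \<sigma> (a + k)) {0..<k}"
  show ?thesis
  proof (intro bexI[of _ j] exI[of _ \<sigma>] ballI)
    show "j \<in> tuples k ?n" unfolding j_def by (rule restrict_tuples) (use \<sigma>_less in auto)
    fix i' assume i': "i' \<in> tuples k ?n"
    let ?X = "Matrix.mat k k (\<lambda>(a, b). if i' a = i b then 1 else 0) :: complex mat"
    let ?Y = "Matrix.mat k k (\<lambda>(a, b). if i' a = \<sigma> (b + k) then 1 else 0) :: complex mat"
    have "of_int (sign \<sigma>) * levi k i' j = Determinant.det (Matrix.mat ?n ?n (\<lambda>(a, b). if concat_tuple k i' j a = \<sigma> b then 1 else 0))"
      unfolding levi_def using det_columns_permute[OF \<sigma>, of "\<lambda>a b. if concat_tuple k i' j a = b then 1 else 0"] by simp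
    also have "Matrix.mat ?n ?n (\<lambda>(a, b). if concat_tuple k i' j a = \<sigma> b then 1 else 0) = four_block_mat ?X ?Y (0\<^sub>m k k) (1\<^sub>m k)"
      by (intro eq_matI) (auto simp: concat_tuple_def j_def \<sigma>_eq, auto simp: \<sigma>_def)
    also have "Determinant.det \<dots> = Determinant.det ?X * Determinant.det (1\<^sub>m k :: complex mat)"
      by (rule det_four_block_mat_lower_left_zero) auto
    also have "\<dots> = minor k (1\<^sub>m ?n) i' i"
      unfolding minor_def using tuples_less[OF i] tuples_less[OF i']
      by (simp, intro arg_cong[of _ _ Determinant.det] eq_matI) auto
    finally have "of_int (sign \<sigma>) * (of_int (sign \<sigma>) * levi k i' j) = of_int (sign \<sigma>) * minor k (1\<^sub>m ?n) i' i" by simp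
    then show "levi k i' j = of_int (sign \<sigma>) * minor k (1\<^sub>m ?n) i' i" unfolding mult.assoc[symmetric] by simp
  qed
qed

lemma minor_one_commute:
  assumes "i \<in> tuples k d" "j \<in> tuples k d"
  shows "minor k (1\<^sub>m d) i j = minor k (1\<^sub>m d) j i"
proof -
  have "minor k (1\<^sub>m d) i j = Determinant.det (Matrix.mat k k (\<lambda>(a, b). 1\<^sub>m d $$ (i b, j a)))"
    unfolding minor_def by (rule det_mat_transpose[of k "\<lambda>a b. 1\<^sub>m d $$ (i b, j a)"])
  also have "\<dots> = minor k (1\<^sub>m d) j i"
    unfolding minor_def using tuples_less[OF assms(1)] tuples_less[OF assms(2)]
    by (intro arg_cong[of _ _ Determinant.det] eq_matI) auto
  finally show ?thesis .
qed

text \<open>The complementary tuple j reads off one coordinate: entry j of the image of u under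
  \<open>levi k\<close> is, up to sign, \<open>fact k\<close> times entry i of the
  antisymmetrisation of u. For a tuple i with repetitions the left side is 0.\<close>

lemma levi_nondegenerate:
  assumes k: "odd k" and i: "i \<in> tuples k (2 * k)"
  shows "cmod (mapply (tuples k (2 * k)) (compound k (2 * k) (1\<^sub>m (2 * k))) u i)
    \<le> 1 * vnorm (tuples k (2 * k)) (mapply (tuples k (2 * k)) (levi k) u)"
proof -
  let ?T = "tuples k (2 * k)" and ?E = "1\<^sub>m (2 * k) :: complex mat"
  have m: "mapply ?T (compound k (2 * k) ?E) u i = (\<Sum>w\<in>?T. minor k ?E i w * u w) / fact k"
    unfolding mapply_def sum_divide_distrib using i by (intro sum.cong refl) (simp add: compound_def)
  show ?thesis
  proof (cases "inj_on i {0..<k}")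
    case False
    then show ?thesis using minor_not_inj_left[OF False] by (simp add: m)
  next
    case True
    obtain j and \<sigma> :: "nat \<Rightarrow> nat" where j: "j \<in> ?T" "\<And>w. w \<in> ?T \<Longrightarrow> levi k w j = of_int (sign \<sigma>) * minor k ?E w i"
      using levi_complement[OF i True] by blast
    have "mapply ?T (levi k) u j = (\<Sum>w\<in>?T. - (of_int (sign \<sigma>) * minor k ?E i w) * u w)"
      unfolding mapply_def
    proof (intro sum.cong refl)
      fix w assume w: "w \<in> ?T"
      show "levi k j w * u w = - (of_int (sign \<sigma>) * minor k ?E i w) * u w"
        using levi_antisym[OF k, of j w] j(2)[OF w] minor_one_commute[OF i w] by simp
    qed
    also have "\<dots> = - of_int (sign \<sigma>) * (\<Sum>w\<in>?T. minor k ?E i w * u w)"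
      by (simp add: sum_distrib_left sum_negf mult.assoc)
    finally have "cmod (\<Sum>w\<in>?T. minor k ?E i w * u w) = cmod (mapply ?T (levi k) u j)"
      by (simp add: norm_mult sign_def)
    also have "\<dots> \<le> vnorm ?T (mapply ?T (levi k) u)" using j(1) by (intro cmod_le_vnorm) auto
    finally have "cmod (\<Sum>w\<in>?T. minor k ?E i w * u w) / fact k \<le> vnorm ?T (mapply ?T (levi k) u) / 1"
      by (intro frac_le) auto
    then show ?thesis by (simp add: m norm_divide)
  qed
qed

section \<open>Singular value decomposition\<close>

lemma mat_adjoint_eq:
  "mat_adjoint (A :: complex mat) = Matrix.mat (dim_col A) (dim_row A) (\<lambda>(i, j). cnj (A $$ (j, i)))"
  unfolding mat_adjoint_def
  by (intro eq_matI) (auto simp: mat_of_rows_def conjugate_vec_def)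

lemma mat_adjoint_carrier [simp]: "A \<in> carrier_mat n m \<Longrightarrow> mat_adjoint (A :: complex mat) \<in> carrier_mat m n"
  by (simp add: mat_adjoint_eq)

lemma mat_adjoint_index [simp]:
  "A \<in> carrier_mat n m \<Longrightarrow> i < m \<Longrightarrow> j < n \<Longrightarrow> mat_adjoint (A :: complex mat) $$ (i, j) = cnj (A $$ (j, i))"
  by (simp add: mat_adjoint_eq)

lemma mat_adjoint_adjoint [simp]: "mat_adjoint (mat_adjoint (A :: complex mat)) = A"
  by (intro eq_matI) (simp_all add: mat_adjoint_eq)

lemma mat_adjoint_mult:
  assumes "A \<in> carrier_mat n m" "B \<in> carrier_mat m l"
  shows "mat_adjoint (A * B :: complex mat) = mat_adjoint B * mat_adjoint A"
  using assms by (intro eq_matI) (auto simp: mat_adjoint_eq scalar_prod_def mult.commute)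

lemma index_mult_mat_sum:
  "A \<in> carrier_mat n m \<Longrightarrow> B \<in> carrier_mat m l \<Longrightarrow> i < n \<Longrightarrow> j < l \<Longrightarrow>
    (A * B) $$ (i, j) = (\<Sum>h = 0..<m. A $$ (i, h) * B $$ (h, j))"
  by (simp add: scalar_prod_def)

text \<open>Gram-Schmidt on a basis that starts with v, then normalisation of the columns; c is the
  reciprocal of the Euclidean length of v.\<close>

lemma unitary_first_column:
  fixes v :: "complex vec"
  assumes v: "v \<in> carrier_vec n" and v0: "v \<noteq> 0\<^sub>v n"
  obtains W c where "W \<in> carrier_mat n n" "mat_adjoint W * W = 1\<^sub>m n" "\<And>i. i < n \<Longrightarrow> W $$ (i, 0) = c * v $ i"
proof -
  interpret cof_vec_space n "TYPE(complex)" .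
  have n: "0 < n" using v v0 by (cases n) auto
  define b where "b = basis_completion v"
  define ws where "ws = gram_schmidt n b"
  from basis_completion[OF v v0, folded b_def]
  have dist_b: "distinct b" and indep: "\<not> lin_dep (set b)" and b: "set b \<subseteq> carrier_vec n" and hdb: "hd b = v"
    and len_b: "length b = n" by auto
  from hdb len_b n obtain vs where bv: "b = v # vs" by (cases b) auto
  from gram_schmidt_result[OF b dist_b indep refl, folded ws_def]
  have ws: "set ws \<subseteq> carrier_vec n" "corthogonal ws" "length ws = n" by (auto simp: len_b)
  have hdws: "hd ws = v" using gram_schmidt_hd[OF v, of vs, folded bv] by (simp add: ws_def)
  have wsc: "ws ! i \<in> carrier_vec n" if "i < n" for i using ws that by (metis nth_mem subsetD)
  define s where "s i j = (\<Sum>l = 0..<n. ws ! i $ l * cnj (ws ! j $ l))" for i j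
  have sp: "ws ! i \<bullet>c ws ! j = s i j" if "i < n" "j < n" for i j
    using wsc[OF that(1)] wsc[OF that(2)] by (auto simp: scalar_prod_def s_def intro!: sum.cong)
  define r where "r i = (\<Sum>l = 0..<n. (cmod (ws ! i $ l))\<^sup>2)" for i
  have sr: "s i i = of_real (r i)" for i by (simp add: s_def r_def flip: complex_norm_square)
  have s0: "s i j = 0 \<longleftrightarrow> i \<noteq> j" if "i < n" "j < n" for i j
    using corthogonalD[OF ws(2), of i j] that ws(3) sp by simp
  have r: "0 < r i" if "i < n" for i
  proof -
    have "0 \<le> r i" by (simp add: r_def sum_nonneg)
    moreover have "r i \<noteq> 0" using s0[OF that that] sr[of i] by auto
    ultimately show ?thesis by simp
  qed
  define W where "W = Matrix.mat n n (\<lambda>(l, i). ws ! i $ l / of_real (sqrt (r i)))"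
  show ?thesis
  proof (rule that[of W])
    show W: "W \<in> carrier_mat n n" by (simp add: W_def)
    show "mat_adjoint W * W = 1\<^sub>m n"
    proof (rule eq_matI)
      fix i j assume "i < dim_row (1\<^sub>m n :: complex mat)" "j < dim_col (1\<^sub>m n :: complex mat)"
      then have ij: "i < n" "j < n" by auto
      have "(mat_adjoint W * W) $$ (i, j) = (\<Sum>l = 0..<n. ws ! j $ l * cnj (ws ! i $ l) / (of_real (sqrt (r i)) * of_real (sqrt (r j))))"
        using ij W by (auto simp: scalar_prod_def mat_adjoint_eq W_def intro!: sum.cong)
      also have "\<dots> = s j i / (of_real (sqrt (r i)) * of_real (sqrt (r j)))"
        by (simp add: s_def sum_divide_distrib)
      also have "\<dots> = (if i = j then 1 else 0)"
      proof (cases "i = j")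
        case True
        have "(of_real (sqrt (r i)) * of_real (sqrt (r i)) :: complex) = of_real (r i)"
          using r[OF ij(1)] by (simp flip: of_real_mult)
        then show ?thesis using True sr[of i] r[OF ij(1)] by simp
      next
        case False then show ?thesis using s0[OF ij(2,1)] by simp
      qed
      finally show "(mat_adjoint W * W) $$ (i, j) = 1\<^sub>m n $$ (i, j)" using ij by simp
    qed (use W in \<open>auto simp: mat_adjoint_eq\<close>)
    show "W $$ (i, 0) = inverse (of_real (sqrt (r 0))) * v $ i" if "i < n" for i
    proof -
      have "ws ! 0 = v" using hdws ws(3) n by (metis hd_conv_nth length_greater_0_conv)
      then show ?thesis using that n by (simp add: W_def divide_inverse mult.commute)
    qed
  qed
qed

lemma diag_block_mult:
  fixes E\<^sub>1 :: "complex mat"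
  assumes E: "E\<^sub>1 \<in> carrier_mat 1 1" "E\<^sub>2 \<in> carrier_mat 1 1" and V: "V\<^sub>1 \<in> carrier_mat m m" "V\<^sub>2 \<in> carrier_mat m m"
  shows "four_block_mat E\<^sub>1 (0\<^sub>m 1 m) (0\<^sub>m m 1) V\<^sub>1 * four_block_mat E\<^sub>2 (0\<^sub>m 1 m) (0\<^sub>m m 1) V\<^sub>2
    = four_block_mat (E\<^sub>1 * E\<^sub>2) (0\<^sub>m 1 m) (0\<^sub>m m 1) (V\<^sub>1 * V\<^sub>2)"
proof -
  have EE: "E\<^sub>1 * E\<^sub>2 \<in> carrier_mat 1 1" and VV: "V\<^sub>1 * V\<^sub>2 \<in> carrier_mat m m"
    by (rule mult_carrier_mat[OF E], rule mult_carrier_mat[OF V])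
  show ?thesis
    unfolding mult_four_block_mat[OF E(1) zero_carrier_mat zero_carrier_mat V(1) E(2) zero_carrier_mat zero_carrier_mat V(2)]
      left_mult_zero_mat[OF zero_carrier_mat] right_mult_zero_mat[OF E(1)] right_mult_zero_mat[OF V(1)]
      left_mult_zero_mat[OF E(2)] left_mult_zero_mat[OF V(2)]
      right_add_zero_mat[OF EE] left_add_zero_mat[OF VV] right_add_zero_mat[OF zero_carrier_mat] ..
qed

text \<open>The spectral theorem with the eigenvalues in a prescribed order, so that they can be
  sorted beforehand. The induction is by deflation: in a unitary basis starting with an eigenvector
  for e the first column is (e, 0, ..., 0), Hermitian symmetry clears the first row, and cancelling
  the factor of e leaves the characteristic polynomial of the remaining block.\<close>

lemma hermitian_unitary_diagonal:
  fixes A :: "complex mat"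
  assumes "A \<in> carrier_mat n n" "mat_adjoint A = A" "char_poly A = (\<Prod>e\<leftarrow>es. [:- e, 1:])"
  shows "\<exists>U\<in>carrier_mat n n. mat_adjoint U * U = 1\<^sub>m n \<and>
    mat_adjoint U * A * U = Matrix.mat n n (\<lambda>(i, j). if i = j then es ! i else 0)"
  using assms
proof (induction es arbitrary: n A)
  case Nil
  then have "n = 0" using degree_monic_char_poly[of A n] by auto
  then show ?case using Nil by (intro bexI[of _ "1\<^sub>m n"]) (auto simp: mat_adjoint_eq)
next
  case (Cons e es)
  note A = Cons.prems(1)
  have n: "n \<noteq> 0"
  proof
    assume "n = 0"
    then have "degree (char_poly A) = 0" using degree_monic_char_poly[OF A] by simp
    moreover have "poly (char_poly A) e = 0" using Cons.prems(3) by simp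
    ultimately show False using degree_monic_char_poly[OF A] by (metis degree_eq_zeroE coeff_pCons_0 degree_pCons_0 lead_coeff_pCons(2) pCons_0_0 poly_const_conv zero_neq_one leading_coeff_0_iff)
  qed
  then obtain m where m: "n = Suc m" by (cases n) auto
  have "eigenvalue A e" unfolding eigenvalue_root_char_poly[OF A] using Cons.prems(3) by simp
  then obtain v where v: "v \<in> carrier_vec n" "v \<noteq> 0\<^sub>v n" "A *\<^sub>v v = e \<cdot>\<^sub>v v"
    using A unfolding eigenvalue_def eigenvector_def by auto
  obtain W c where W: "W \<in> carrier_mat n n" and WW: "mat_adjoint W * W = 1\<^sub>m n" and W0: "\<And>i. i < n \<Longrightarrow> W $$ (i, 0) = c * v $ i"
    using unitary_first_column[OF v(1,2)] by metis
  let ?W = "mat_adjoint W"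
  have Wa: "?W \<in> carrier_mat n n" using W by simp
  have WW': "W * ?W = 1\<^sub>m n" using mat_mult_left_right_inverse[OF Wa W WW] .
  define A' where "A' = ?W * A * W"
  have A': "A' \<in> carrier_mat n n" unfolding A'_def by (rule mult_carrier_mat[OF mult_carrier_mat[OF Wa A] W])
  have herm: "mat_adjoint A' = A'"
    unfolding A'_def using A W Wa Cons.prems(2)
    by (simp add: mat_adjoint_mult[of _ n n _ n] assoc_mult_mat[of _ n n _ n _ n])
  have "similar_mat_wit A' A ?W W"
    by (rule similar_mat_witI[OF WW WW' A'_def A' A Wa W])
  then have "char_poly A' = char_poly A" using char_poly_similar[of A' A] by (auto simp: similar_mat_def)
  have col0: "A' $$ (i, 0) = (if i = 0 then e else 0)" if i: "i < n" for i
  proof -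
    have AW: "(A * W) $$ (l, 0) = e * W $$ (l, 0)" if l: "l < n" for l
    proof -
      have Av: "(A *\<^sub>v v) $ l = (\<Sum>i = 0..<n. A $$ (l, i) * v $ i)"
        using l A v(1) by (simp add: scalar_prod_def)
      have "(A * W) $$ (l, 0) = (\<Sum>i = 0..<n. A $$ (l, i) * (c * v $ i))"
        using l n A W W0 by (simp add: scalar_prod_def)
      also have "\<dots> = c * (A *\<^sub>v v) $ l" unfolding Av by (simp add: sum_distrib_left mult_ac)
      also have "\<dots> = e * W $$ (l, 0)" using l v W0 by simp
      finally show ?thesis .
    qed
    have "A' $$ (i, 0) = (?W * (A * W)) $$ (i, 0)" unfolding A'_def by (simp only: assoc_mult_mat[OF Wa A W])
    also have "\<dots> = (\<Sum>l = 0..<n. ?W $$ (i, l) * (e * W $$ (l, 0)))"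
      using n AW by (subst index_mult_mat_sum[OF Wa mult_carrier_mat[OF A W] i]) (auto intro: sum.cong)
    also have "\<dots> = e * (?W * W) $$ (i, 0)"
      using n by (subst index_mult_mat_sum[OF Wa W i]) (simp_all add: sum_distrib_left mult_ac)
    also have "\<dots> = (if i = 0 then e else 0)" using i n by (simp add: WW)
    finally show ?thesis .
  qed
  have row0: "A' $$ (0, i) = (if i = 0 then e else 0)" if i: "i < n" for i
  proof -
    have "cnj (A' $$ (i, 0)) = A' $$ (0, i)" "cnj (A' $$ (0, 0)) = A' $$ (0, 0)"
      using mat_adjoint_index[OF A', of 0 i] mat_adjoint_index[OF A', of 0 0] i n by (simp_all add: herm)
    then show ?thesis using col0[OF i] col0[of 0] n by (auto split: if_splits)
  qed
  define E where "E = Matrix.mat 1 1 (\<lambda>_. e)"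
  define B where "B = Matrix.mat m m (\<lambda>(i, j). A' $$ (Suc i, Suc j))"
  have E: "E \<in> carrier_mat 1 1" and B: "B \<in> carrier_mat m m" by (auto simp: E_def B_def)
  have block: "A' = four_block_mat E (0\<^sub>m 1 m) (0\<^sub>m m 1) B"
    using A' col0 row0 by (intro eq_matI) (auto simp: E_def B_def m)
  have "char_poly A' = char_poly E * char_poly B"
    unfolding block by (rule char_poly_four_block_zeros_col[OF E _ B]) auto
  moreover have "char_poly E = [:- e, 1:]" by (simp add: E_def char_poly_defs Determinant.det_def sign_def)
  ultimately have "[:- e, 1:] * char_poly B = [:- e, 1:] * (\<Prod>e\<leftarrow>es. [:- e, 1:])"
    using \<open>char_poly A' = char_poly A\<close> Cons.prems(3) by simp
  then have cB: "char_poly B = (\<Prod>e\<leftarrow>es. [:- e, 1:])" by (metis mult_cancel_left pCons_eq_0_iff zero_neq_one)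
  have hB: "mat_adjoint B = B"
  proof (intro eq_matI)
    fix i j assume "i < dim_row B" "j < dim_col B"
    then have ij: "i < m" "j < m" using B by auto
    then show "mat_adjoint B $$ (i, j) = B $$ (i, j)"
      unfolding mat_adjoint_index[OF B ij] using mat_adjoint_index[OF A', of "Suc i" "Suc j"] by (simp add: B_def herm m)
  qed (auto simp: mat_adjoint_eq B_def)
  obtain V where V: "V \<in> carrier_mat m m" and VV: "mat_adjoint V * V = 1\<^sub>m m"
    and VBV: "mat_adjoint V * B * V = Matrix.mat m m (\<lambda>(i, j). if i = j then es ! i else 0)"
    using Cons.IH[OF B hB cB] by blast
  define F where "F = four_block_mat (1\<^sub>m 1) (0\<^sub>m 1 m) (0\<^sub>m m 1) V"
  have F: "F \<in> carrier_mat n n" using V by (auto simp: F_def m)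
  have Fa: "mat_adjoint F = four_block_mat (1\<^sub>m 1) (0\<^sub>m 1 m) (0\<^sub>m m 1) (mat_adjoint V)"
    using V by (intro eq_matI) (auto simp: F_def mat_adjoint_eq)
  have Fac: "mat_adjoint F \<in> carrier_mat n n" using F by simp
  have Va: "mat_adjoint V \<in> carrier_mat m m" using V by simp
  have FF: "mat_adjoint F * F = 1\<^sub>m n"
    unfolding Fa unfolding F_def diag_block_mult[OF one_carrier_mat one_carrier_mat Va V] VV
    by (intro eq_matI) (auto simp: m)
  have FAF: "mat_adjoint F * A' * F = Matrix.mat n n (\<lambda>(i, j). if i = j then (e # es) ! i else 0)"
  proof -
    have 1: "mat_adjoint F * A' = four_block_mat E (0\<^sub>m 1 m) (0\<^sub>m m 1) (mat_adjoint V * B)"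
      unfolding Fa block diag_block_mult[OF one_carrier_mat E Va B] using E by simp
    have 2: "mat_adjoint F * A' * F = four_block_mat E (0\<^sub>m 1 m) (0\<^sub>m m 1) (mat_adjoint V * B * V)"
      unfolding 1 unfolding F_def diag_block_mult[OF E one_carrier_mat mult_carrier_mat[OF Va B] V] using E by simp
    show ?thesis unfolding 2 VBV by (intro eq_matI) (auto simp: E_def m nth_Cons' )
  qed
  show ?case
  proof (intro bexI[of _ "W * F"] conjI)
    have adj: "mat_adjoint (W * F) = mat_adjoint F * ?W" using W F by (rule mat_adjoint_mult)
    have "mat_adjoint (W * F) * (W * F) = mat_adjoint F * ((?W * W) * F)"
      unfolding adj by (simp only: assoc_mult_mat[OF Fac Wa mult_carrier_mat[OF W F]] assoc_mult_mat[OF Wa W F])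
    then show "mat_adjoint (W * F) * (W * F) = 1\<^sub>m n" using F FF by (simp add: WW)
    have "mat_adjoint (W * F) * A * (W * F) = mat_adjoint F * A' * F"
      unfolding adj A'_def
      by (simp only: assoc_mult_mat[OF Fac Wa A] assoc_mult_mat[OF Fac mult_carrier_mat[OF Wa A] mult_carrier_mat[OF W F]]
          assoc_mult_mat[OF Wa A mult_carrier_mat[OF W F]] assoc_mult_mat[OF Wa A W]
          assoc_mult_mat[OF Fac mult_carrier_mat[OF Wa mult_carrier_mat[OF A W]] F]
          assoc_mult_mat[OF Wa mult_carrier_mat[OF A W] F] assoc_mult_mat[OF A W F])
    then show "mat_adjoint (W * F) * A * (W * F) = Matrix.mat n n (\<lambda>(i, j). if i = j then (e # es) ! i else 0)"
      using FAF by simp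
    show "W * F \<in> carrier_mat n n" using W F by simp
  qed
qed

text \<open>U diagonalises A^H A, and W has the columns of A U divided by their lengths. For a
  singular value 0 the division yields a zero column, so orthonormality is claimed only for columns
  with positive singular values.\<close>

lemma singular_value_decomposition:
  assumes A: "A \<in> carrier_mat d d"
  obtains U W where "U \<in> carrier_mat d d" "W \<in> carrier_mat d d" "U * mat_adjoint U = 1\<^sub>m d"
    "\<And>i j. i < d \<Longrightarrow> j < d \<Longrightarrow> (A * U) $$ (i, j) = W $$ (i, j) * of_real (singular_value (Suc j) A)"
    "\<And>i j. i < d \<Longrightarrow> j < d \<Longrightarrow> cmod (U $$ (i, j)) \<le> 1"
    "\<And>i j. i < d \<Longrightarrow> j < d \<Longrightarrow> cmod (W $$ (i, j)) \<le> 1"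
    "\<And>i j. i < d \<Longrightarrow> j < d \<Longrightarrow> 0 < singular_value (Suc i) A \<Longrightarrow> 0 < singular_value (Suc j) A \<Longrightarrow>
      (mat_adjoint W * W) $$ (i, j) = (if i = j then 1 else 0)"
    "\<And>j. j < d \<Longrightarrow> 0 \<le> singular_value (Suc j) A"
    "\<And>i j. i \<le> j \<Longrightarrow> j < d \<Longrightarrow> singular_value (Suc j) A \<le> singular_value (Suc i) A"
proof -
  let ?H = "mat_adjoint A * A"
  let ?f = "\<lambda>z. sqrt (Re z)"
  have Aa: "mat_adjoint A \<in> carrier_mat d d" using A by simp
  have H: "?H \<in> carrier_mat d d" by (rule mult_carrier_mat[OF Aa A])
  have herm: "mat_adjoint ?H = ?H" using mat_adjoint_mult[OF Aa A] by simp
  obtain as where as: "char_poly ?H = (\<Prod>a\<leftarrow>as. [:- a, 1:])" "length as = d"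
    using char_poly_factorized[OF H] by blast
  \<comment> \<open>The eigenvalues are complex and are sorted by their square roots, in decreasing
    order, so that position j carries the singular value with index j + 1.\<close>
  define es where "es = rev (sort_key ?f as)"
  have mset: "mset es = mset as" by (simp add: es_def)
  have len: "length es = d" using as(2) by (simp add: es_def)
  have "(\<Prod>a\<leftarrow>as. [:- a, 1:]) = (\<Prod>a\<leftarrow>es. [:- a, 1:])"
    using mset by (metis mset_map prod_mset_prod_list)
  then have cp: "char_poly ?H = (\<Prod>a\<leftarrow>es. [:- a, 1:])" using as(1) by simp
  have "proots (\<Prod>a\<leftarrow>xs. [:- a, 1:]) = mset xs" for xs :: "complex list"
  proof (induction xs)
    case (Cons a xs)
    have "(\<Prod>a\<leftarrow>xs. [:- a, 1:]) \<noteq> 0" by (auto simp: prod_list_zero_iff)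
    then have "proots ([:- a, 1:] * (\<Prod>a\<leftarrow>xs. [:- a, 1:])) = proots [:- a, 1:] + proots (\<Prod>a\<leftarrow>xs. [:- a, 1:])"
      by (intro proots_mult) auto
    then show ?case using Cons by (simp del: mult_pCons_left)
  qed simp
  then have "singular_values A = rev (sort (map ?f as))"
    unfolding singular_values_def as(1) by (simp flip: mset_map)
  also have "sort (map ?f as) = map ?f (sort_key ?f as)"
    by (rule properties_for_sort) (simp_all only: mset_map mset_sort sorted_sort_key)
  finally have sv: "singular_values A = map ?f es" by (simp add: es_def rev_map)
  then have sv_nth: "singular_value (Suc j) A = ?f (es ! j)" if "j < d" for j
    using that len by (simp add: singular_value_def)
  obtain U where U: "U \<in> carrier_mat d d" and UU: "mat_adjoint U * U = 1\<^sub>m d"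
    and UHU: "mat_adjoint U * ?H * U = Matrix.mat d d (\<lambda>(i, j). if i = j then es ! i else 0)"
    using hermitian_unitary_diagonal[OF H herm cp] by blast
  have Ua: "mat_adjoint U \<in> carrier_mat d d" using U by simp
  define X where "X = A * U"
  have X: "X \<in> carrier_mat d d" using A U by (simp add: X_def)
  have XX: "mat_adjoint X * X = Matrix.mat d d (\<lambda>(i, j). if i = j then es ! i else 0)"
    unfolding UHU[symmetric] X_def mat_adjoint_mult[OF A U]
    by (simp only: assoc_mult_mat[OF Ua Aa mult_carrier_mat[OF A U]] assoc_mult_mat[OF Ua H U] assoc_mult_mat[OF Aa A U])
  have gram: "(mat_adjoint Y * Y) $$ (i, j) = (\<Sum>l = 0..<d. cnj (Y $$ (l, i)) * Y $$ (l, j))"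
    if "Y \<in> carrier_mat d d" "i < d" "j < d" for Y i j
    using that by (auto simp: scalar_prod_def mat_adjoint_eq intro!: sum.cong)
  have col_norm: "(mat_adjoint Y * Y) $$ (j, j) = of_real (\<Sum>l = 0..<d. (cmod (Y $$ (l, j)))\<^sup>2)"
    if "Y \<in> carrier_mat d d" "j < d" for Y j
    unfolding gram[OF that(1,2,2)] by (simp add: mult.commute[of "cnj _"] flip: complex_norm_square)
  have esj: "es ! j = of_real (\<Sum>l = 0..<d. (cmod (X $$ (l, j)))\<^sup>2)" if "j < d" for j
    using col_norm[OF X that] that by (simp add: XX)
  define \<sigma> where "\<sigma> j = singular_value (Suc j) A" for j
  have \<sigma>: "\<sigma> j = sqrt (\<Sum>l = 0..<d. (cmod (X $$ (l, j)))\<^sup>2)" if "j < d" for j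
    using sv_nth[OF that] esj[OF that] by (simp add: \<sigma>_def)
  have \<sigma>0: "0 \<le> \<sigma> j" if "j < d" for j unfolding \<sigma>[OF that] by (simp add: sum_nonneg)
  have X_le: "cmod (X $$ (l, j)) \<le> \<sigma> j" if "l < d" "j < d" for l j
    unfolding \<sigma>[OF that(2)] using that(1)
    by (intro real_le_rsqrt member_le_sum[of l "{0..<d}" "\<lambda>l. (cmod (X $$ (l, j)))\<^sup>2"]) auto
  have es_\<sigma>: "es ! j = of_real (\<sigma> j * \<sigma> j)" if "j < d" for j
    using esj[OF that] \<sigma>[OF that] by (simp add: sum_nonneg)
  define W where "W = Matrix.mat d d (\<lambda>(i, j). X $$ (i, j) / of_real (\<sigma> j))"
  have W: "W \<in> carrier_mat d d" by (simp add: W_def)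
  show ?thesis
  proof (rule that[of U W, folded \<sigma>_def])
    show "U \<in> carrier_mat d d" "W \<in> carrier_mat d d" by (fact U, fact W)
    show "U * mat_adjoint U = 1\<^sub>m d" by (rule mat_mult_left_right_inverse[OF Ua U UU])
    show "(A * U) $$ (i, j) = W $$ (i, j) * of_real (\<sigma> j)" if "i < d" "j < d" for i j
      using that X_le[OF that] by (cases "\<sigma> j = 0") (auto simp: W_def X_def[symmetric])
    show "cmod (U $$ (i, j)) \<le> 1" if "i < d" "j < d" for i j
    proof -
      have "of_real (\<Sum>l = 0..<d. (cmod (U $$ (l, j)))\<^sup>2) = (1 :: complex)"
        using col_norm[OF U that(2)] that by (simp add: UU)
      then have "(\<Sum>l = 0..<d. (cmod (U $$ (l, j)))\<^sup>2) = 1" by (simp only: of_real_eq_1_iff)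
      then have "(cmod (U $$ (i, j)))\<^sup>2 \<le> 1"
        using that(1) member_le_sum[of i "{0..<d}" "\<lambda>l. (cmod (U $$ (l, j)))\<^sup>2"] by simp
      then show ?thesis by (simp add: power2_le_iff_abs_le abs_square_le_1)
    qed
    show "cmod (W $$ (i, j)) \<le> 1" if "i < d" "j < d" for i j
      using that X_le[OF that] \<sigma>0[OF that(2)]
      by (cases "\<sigma> j = 0") (auto simp: W_def norm_divide divide_le_eq)
    show "(mat_adjoint W * W) $$ (i, j) = (if i = j then 1 else 0)" if "i < d" "j < d" "0 < \<sigma> i" "0 < \<sigma> j" for i j
    proof -
      have "(mat_adjoint W * W) $$ (i, j) = (\<Sum>l = 0..<d. cnj (X $$ (l, i)) * X $$ (l, j) / (of_real (\<sigma> i) * of_real (\<sigma> j)))"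
        unfolding gram[OF W that(1,2)] using that by (intro sum.cong) (auto simp: W_def)
      also have "\<dots> = (mat_adjoint X * X) $$ (i, j) / (of_real (\<sigma> i) * of_real (\<sigma> j))"
        unfolding gram[OF X that(1,2)] by (simp add: sum_divide_distrib)
      also have "\<dots> = (if i = j then 1 else 0)" unfolding XX using that es_\<sigma>[OF that(1)] es_\<sigma>[OF that(2)] by simp
      finally show ?thesis .
    qed
    show "0 \<le> \<sigma> j" if "j < d" for j by (rule \<sigma>0[OF that])
    show "\<sigma> j \<le> \<sigma> i" if "i \<le> j" "j < d" for i j
    proof -
      have "sorted (map ?f (sort_key ?f as))" by simp
      moreover have "map ?f (sort_key ?f as) = rev (map ?f es)" by (simp add: es_def rev_map)
      ultimately have "sorted (rev (map ?f es))" by simp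
      then have "map ?f es ! j \<le> map ?f es ! i"
        using that len by (intro sorted_rev_nth_mono) auto
      then show ?thesis using that len sv_nth by (simp add: \<sigma>_def)
    qed
  qed
qed

section \<open>From the singular value gap to nearly rank one compounds\<close>

text \<open>Exchange the elements of X from k on for the equally many missing ones below k. Each
  exchange replaces a factor at most f (k - 1) by one at least f (k - 1). At least one exchanged
  factor is even at most f k, which gains r; it exists because X is not the initial segment.\<close>

lemma prod_exchange_le:
  fixes f :: "nat \<Rightarrow> real"
  assumes f0: "\<And>j. j < d \<Longrightarrow> 0 \<le> f j" and mono: "\<And>i j. i \<le> j \<Longrightarrow> j < d \<Longrightarrow> f j \<le> f i"
    and k: "1 \<le> k" "k < d" and r: "0 \<le> r" "r * f k \<le> f (k - 1)"
    and X: "X \<subseteq> {0..<d}" "card X = k" "X \<noteq> {0..<k}"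
  shows "r * prod f X \<le> prod f {0..<k}"
proof -
  let ?Z = "{0..<k}"
  have fin: "finite X" using X(1) finite_subset by blast
  define Y where "Y = X - ?Z"
  define Y' where "Y' = ?Z - X"
  have finY: "finite Y" "finite Y'" using fin by (auto simp: Y_def Y'_def)
  have "card Y = card X - card (X \<inter> ?Z)" unfolding Y_def using card_Diff_subset_Int[of X ?Z] fin by simp
  moreover have "card Y' = card ?Z - card (X \<inter> ?Z)" unfolding Y'_def using card_Diff_subset_Int[of ?Z X] by (simp add: Int_commute)
  ultimately have cards: "card Y' = card Y" using X(2) by simp
  have "Y \<noteq> {}"
  proof
    assume "Y = {}"
    then have "X \<subseteq> ?Z" by (auto simp: Y_def)
    then show False using X(2,3) card_subset_eq[of ?Z X] by simp
  qed
  then obtain y where y: "y \<in> Y" by blast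
  then have yk: "k \<le> y" "y < d" using X(1) by (auto simp: Y_def)
  have g0: "0 \<le> f (k - 1)" and fk0: "0 \<le> f k" using f0 k by auto
  have "prod f (Y - {y}) \<le> (\<Prod>x\<in>Y - {y}. f (k - 1))"
    using X(1) f0 mono by (intro prod_mono) (auto simp: Y_def)
  also have "\<dots> = f (k - 1) ^ (card Y - 1)" using y finY by simp
  finally have 1: "prod f Y \<le> f k * f (k - 1) ^ (card Y - 1)"
    unfolding prod.remove[OF finY(1) y] using mono[OF yk] fk0 X(1) f0
    by (intro mult_mono) (auto simp: Y_def intro!: prod_nonneg)
  have "f (k - 1) ^ card Y = (\<Prod>x\<in>Y'. f (k - 1))" by (simp add: cards)
  also have "\<dots> \<le> prod f Y'" using mono k g0 by (intro prod_mono) (auto simp: Y'_def)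
  finally have 2: "f (k - 1) ^ card Y \<le> prod f Y'" .
  have cY: "card Y = Suc (card Y - 1)" using y finY by (metis Suc_pred card_gt_0_iff empty_iff One_nat_def)
  have "r * prod f Y \<le> (r * f k) * f (k - 1) ^ (card Y - 1)" using mult_left_mono[OF 1 r(1)] by (simp add: mult.assoc)
  also have "\<dots> \<le> f (k - 1) * f (k - 1) ^ (card Y - 1)" using r(2) g0 by (intro mult_right_mono) auto
  also have "\<dots> = f (k - 1) ^ card Y" using cY by (metis power_Suc)
  finally have 3: "r * prod f Y \<le> prod f Y'" using 2 by simp
  have "prod f X = prod f (X \<inter> ?Z) * prod f Y" unfolding Y_def using fin prod.Int_Diff by blast
  moreover have "prod f ?Z = prod f (X \<inter> ?Z) * prod f Y'" unfolding Y'_def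
    using prod.Int_Diff[of ?Z f X] by (simp add: Int_commute)
  moreover have "0 \<le> prod f (X \<inter> ?Z)" using X(1) f0 by (intro prod_nonneg) auto
  ultimately show ?thesis using mult_left_mono[OF 3, of "prod f (X \<inter> ?Z)"] by (simp add: mult_ac)
qed

definition first_tuple :: "nat \<Rightarrow> nat \<Rightarrow> nat" where
  "first_tuple k = restrict (\<lambda>a. a) {0..<k}"

lemma first_tuple: "k \<le> d \<Longrightarrow> first_tuple k \<in> tuples k d"
  unfolding first_tuple_def by (rule restrict_tuples) auto

lemma minor_first_tuple_one:
  assumes "\<And>a b. a < k \<Longrightarrow> b < k \<Longrightarrow> A $$ (a, b) = (if a = b then 1 else 0)"
  shows "minor k A (first_tuple k) (first_tuple k) = 1"
proof -
  have "Matrix.mat k k (\<lambda>(a, b). A $$ (first_tuple k a, first_tuple k b)) = 1\<^sub>m k"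
    using assms by (intro eq_matI) (auto simp: first_tuple_def)
  then show ?thesis by (simp add: minor_def)
qed

lemma permutation_of_first_tuple:
  assumes x: "x \<in> tuples k d" and inj: "inj_on x {0..<k}" and im: "x ` {0..<k} = {0..<k}"
  obtains p where "p permutes {0..<k}" "x = first_tuple k \<circ> p"
proof
  let ?p = "\<lambda>a. if a < k then x a else a"
  have "bij_betw x {0..<k} {0..<k}" using inj im by (simp add: bij_betw_def)
  then have "bij_betw ?p {0..<k} {0..<k}" by (rule bij_betw_cong[THEN iffD1, rotated]) simp
  then show "?p permutes {0..<k}" by (rule bij_imp_permutes) auto
  have "x a < k" if "a < k" for a using im that by auto
  then show "x = first_tuple k \<circ> ?p"
    using x by (auto simp: fun_eq_iff first_tuple_def tuples_def PiE_iff extensional_def)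
qed

text \<open>The compound of A is that of A U times that of U^H. Column y of the former is bounded by
  the product of the singular values indexed by y: by s for the k leading ones, by s / r for other
  index sets. In a 2 x 2 minor two leading columns are proportional and cancel, so every surviving
  product has a factor at most s / r. Finally s is at most a constant times
  \<open>mnorm T M\<close>.\<close>

lemma compound_minors_le:
  assumes A: "A \<in> carrier_mat d d" and k: "1 \<le> k" "k < d"
    and r: "0 < r" "r \<le> singular_value k A / singular_value (k + 1) A"
    and ij: "i \<in> tuples k d" "j \<in> tuples k d" "p \<in> tuples k d" "l \<in> tuples k d"
  defines "M \<equiv> compound k d A" and "T \<equiv> tuples k d"
  shows "cmod (M i j * M p l - M i l * M p j)
    \<le> 2 * (real (card T))\<^sup>2 * (fact k * (real (card T))\<^sup>2)\<^sup>2 / r * (mnorm T M)\<^sup>2"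
proof -
  let ?D = "real (card T)"
  define f where "f m = singular_value (Suc m) A" for m
  obtain U W where U: "U \<in> carrier_mat d d" and W: "W \<in> carrier_mat d d" and UU: "U * mat_adjoint U = 1\<^sub>m d"
    and AU: "\<And>i j. i < d \<Longrightarrow> j < d \<Longrightarrow> (A * U) $$ (i, j) = W $$ (i, j) * of_real (f j)"
    and U1: "\<And>i j. i < d \<Longrightarrow> j < d \<Longrightarrow> cmod (U $$ (i, j)) \<le> 1"
    and W1: "\<And>i j. i < d \<Longrightarrow> j < d \<Longrightarrow> cmod (W $$ (i, j)) \<le> 1"
    and WW: "\<And>i j. i < d \<Longrightarrow> j < d \<Longrightarrow> 0 < f i \<Longrightarrow> 0 < f j \<Longrightarrow> (mat_adjoint W * W) $$ (i, j) = (if i = j then 1 else 0)"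
    and f0: "\<And>j. j < d \<Longrightarrow> 0 \<le> f j" and mono: "\<And>i j. i \<le> j \<Longrightarrow> j < d \<Longrightarrow> f j \<le> f i"
    unfolding f_def by (rule singular_value_decomposition[OF A]) blast
  have Ua: "mat_adjoint U \<in> carrier_mat d d" and Wa: "mat_adjoint W \<in> carrier_mat d d" using U W by simp_all
  have r': "r \<le> f (k - 1) / f k" using r(2) k by (simp add: f_def)
  \<comment> \<open>Since x / 0 = 0, a positive lower bound for the quotient excludes a zero
    denominator.\<close>
  have fk: "0 < f k" using r' r(1) f0[OF k(2)] by (cases "f k = 0") auto
  have rf: "r * f k \<le> f (k - 1)" using r' fk by (simp add: field_simps)
  have fpos: "0 < f m" if "m \<le> k" for m using mono[OF that k(2)] fk by simp
  define s where "s = prod f {0..<k}"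
  have s: "0 < s" unfolding s_def by (intro prod_pos) (auto intro: fpos)
  define N where "N = compound k d (A * U)"
  have N_eq: "N x y = of_real (\<Prod>b = 0..<k. f (y b)) * compound k d W x y" for x y
  proof (cases "x \<in> T \<and> y \<in> T")
    case True
    have lt: "x a < d" "y a < d" if "a < k" for a using True that tuples_less by (auto simp: T_def)
    have "minor k (A * U) x y = (\<Sum>p | p permutes {0..<k}. of_int (sign p) * (\<Prod>a = 0..<k. W $$ (x a, y (p a)) * of_real (f (y (p a)))))"
      unfolding minor_def det_mat_eq
    proof (intro sum.cong refl arg_cong2[of _ _ _ _ "(*)"] prod.cong)
      fix p a assume "p \<in> {p. p permutes {0..<k}}" "a \<in> {0..<k}"
      then show "(A * U) $$ (x a, y (p a)) = W $$ (x a, y (p a)) * of_real (f (y (p a)))"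
        using permutes_in_image[of p "{0..<k}" a] by (intro AU lt) auto
    qed
    also have "\<dots> = (\<Sum>p | p permutes {0..<k}. of_real (\<Prod>b = 0..<k. f (y b)) * (of_int (sign p) * (\<Prod>a = 0..<k. W $$ (x a, y (p a)))))"
    proof (intro sum.cong refl)
      fix p assume "p \<in> {p. p permutes {0..<k}}"
      then have "(\<Prod>a = 0..<k. f (y (p a))) = (\<Prod>b = 0..<k. f (y b))"
        using prod.permute[of p "{0..<k}" "\<lambda>b. f (y b)"] by (simp add: o_def)
      then show "of_int (sign p) * (\<Prod>a = 0..<k. W $$ (x a, y (p a)) * of_real (f (y (p a)))) =
        of_real (\<Prod>b = 0..<k. f (y b)) * (of_int (sign p) * (\<Prod>a = 0..<k. W $$ (x a, y (p a))))"
        by (simp add: prod.distrib mult_ac flip: of_real_prod)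
    qed
    also have "\<dots> = of_real (\<Prod>b = 0..<k. f (y b)) * minor k W x y"
      unfolding minor_def det_mat_eq by (simp add: sum_distrib_left)
    finally show ?thesis using True by (simp add: N_def compound_def T_def)
  qed (auto simp: N_def compound_def T_def)
  have N0: "N x y = 0" if "\<not> inj_on y {0..<k}" for x y
    using minor_not_inj_right[OF that] by (simp add: N_def compound_def)
  have N_le: "cmod (N x y) \<le> prod f (y ` {0..<k})" if y: "y \<in> T" "inj_on y {0..<k}" for x y
  proof -
    have "(\<Prod>b = 0..<k. f (y b)) = prod f (y ` {0..<k})" using y(2) by (simp add: prod.reindex)
    moreover have "0 \<le> prod f (y ` {0..<k})"
      using y(1) tuples_less f0 by (intro prod_nonneg) (auto simp: T_def)
    moreover have "cmod (compound k d W x y) \<le> 1" by (rule compound_le_1[OF W1])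
    ultimately show ?thesis unfolding N_eq norm_mult norm_of_real
      using mult_left_mono[of "cmod (compound k d W x y)" 1 "prod f (y ` {0..<k})"] by simp
  qed
  have im: "y ` {0..<k} \<subseteq> {0..<d}" "card (y ` {0..<k}) = k" if "y \<in> T" "inj_on y {0..<k}" for y
    using that tuples_less by (auto simp: T_def card_image)
  \<comment> \<open>The exchange estimate with r = 1: the leading product is the largest.\<close>
  have f_le: "1 * f k \<le> f (k - 1)" using mono[of "k - 1" k] k by simp
  have N_s: "cmod (N x y) \<le> s" if y: "y \<in> T" "inj_on y {0..<k}" for x y
    using N_le[OF y, of x] prod_exchange_le[OF f0 mono k _ f_le im[OF y]]
    by (cases "y ` {0..<k} = {0..<k}") (auto simp: s_def)
  have N_r: "cmod (N x y) \<le> s / r" if y: "y \<in> T" "inj_on y {0..<k}" "y ` {0..<k} \<noteq> {0..<k}" for x y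
  proof -
    have "r * prod f (y ` {0..<k}) \<le> s"
      unfolding s_def using r(1) by (intro prod_exchange_le[OF f0 mono k _ rf im[OF y(1,2)] y(3)]) auto
    then show ?thesis using N_le[OF y(1,2), of x] r(1) by (simp add: field_simps) (smt (verit) mult_left_mono)
  qed
  have key: "cmod (N i x * N p y - N i y * N p x) \<le> 2 * s\<^sup>2 / r" if xy: "x \<in> T" "y \<in> T" for x y
  proof -
    consider "\<not> inj_on x {0..<k} \<or> \<not> inj_on y {0..<k}"
      | "inj_on x {0..<k}" "inj_on y {0..<k}" "x ` {0..<k} = {0..<k}" "y ` {0..<k} = {0..<k}"
      | "inj_on x {0..<k}" "inj_on y {0..<k}" "x ` {0..<k} \<noteq> {0..<k} \<or> y ` {0..<k} \<noteq> {0..<k}"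
      by blast
    then show ?thesis
    proof cases
      case 1
      then have "N i x * N p y - N i y * N p x = 0" using N0 by auto
      then show ?thesis using r(1) by simp
    next
      case 2
      have perm: "\<exists>e. \<forall>v. N v z = e * N v (first_tuple k)" if z: "z \<in> T" "inj_on z {0..<k}" "z ` {0..<k} = {0..<k}" for z
      proof -
        obtain q where "q permutes {0..<k}" "z = first_tuple k \<circ> q"
          using permutation_of_first_tuple z unfolding T_def by metis
        then have "N v z = of_int (sign q) * N v (first_tuple k)" for v
          using z(1) first_tuple[of k d] k minor_permute_right[of q k "A * U" v "first_tuple k"]
          by (simp add: N_def compound_def T_def)
        then show ?thesis by blast
      qed
      obtain e where "\<And>v. N v x = e * N v (first_tuple k)" using perm 2 xy by metis
      moreover obtain e' where "\<And>v. N v y = e' * N v (first_tuple k)" using perm 2 xy by metis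
      ultimately have "N i x * N p y - N i y * N p x = 0" by simp
      then show ?thesis using r(1) by simp
    next
      case 3
      have "cmod (N v x) * cmod (N w y) \<le> s\<^sup>2 / r" for v w
      proof (cases "x ` {0..<k} = {0..<k}")
        case True
        then have "cmod (N v x) * cmod (N w y) \<le> s * (s / r)"
          using 3 xy s by (intro mult_mono N_s N_r) auto
        then show ?thesis by (simp add: power2_eq_square)
      next
        case False
        then have "cmod (N v x) * cmod (N w y) \<le> (s / r) * s"
          using 3 xy s r(1) by (intro mult_mono N_s N_r) auto
        then show ?thesis by (simp add: power2_eq_square)
      qed
      from this[of i p] this[of p i]
      have "cmod (N i x * N p y) + cmod (N i y * N p x) \<le> 2 * s\<^sup>2 / r" by (simp add: norm_mult mult.commute)
      then show ?thesis using norm_triangle_ineq4[of "N i x * N p y" "N i y * N p x"] by simp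
    qed
  qed
  define V where "V = compound k d (mat_adjoint U)"
  have V1: "cmod (V x y) \<le> 1" for x y
    unfolding V_def by (rule compound_le_1) (use U U1 in simp)
  have "A = (A * U) * mat_adjoint U"
    using assoc_mult_mat[OF A U Ua] A by (simp add: UU)
  then have M_eq: "M x y = (\<Sum>z\<in>T. N x z * V z y)" for x y
    unfolding M_def N_def V_def T_def using compound_mult[OF mult_carrier_mat[OF A U] Ua] by metis
  have "M i j * M p l = (\<Sum>x\<in>T. \<Sum>y\<in>T. N i x * N p y * (V x j * V y l))"
    unfolding M_eq sum_product by (simp add: mult_ac)
  \<comment> \<open>Swapping the two summation variables gives this product the same coefficients
    \<open>V x j * V y l\<close> as the first, so the difference is a combination of minors of
    N.\<close>
  moreover have "M i l * M p j = (\<Sum>x\<in>T. \<Sum>y\<in>T. N i y * N p x * (V x j * V y l))"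
    unfolding M_eq sum_product by (subst sum.swap) (simp add: mult_ac)
  ultimately have minors: "M i j * M p l - M i l * M p j = (\<Sum>x\<in>T. \<Sum>y\<in>T. (N i x * N p y - N i y * N p x) * (V x j * V y l))"
    by (simp add: sum_subtractf left_diff_distrib)
  have "cmod (M i j * M p l - M i l * M p j) \<le> (\<Sum>x\<in>T. \<Sum>y\<in>T. cmod ((N i x * N p y - N i y * N p x) * (V x j * V y l)))"
    unfolding minors by (rule order_trans[OF norm_sum]) (rule sum_mono[OF norm_sum])
  also have "\<dots> \<le> (\<Sum>x\<in>T. \<Sum>y\<in>T. 2 * s\<^sup>2 / r)"
  proof (intro sum_mono)
    fix x y assume xy: "x \<in> T" "y \<in> T"
    have "cmod (V x j) * cmod (V y l) \<le> 1" using V1 by (intro mult_le_one) auto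
    then show "cmod ((N i x * N p y - N i y * N p x) * (V x j * V y l)) \<le> 2 * s\<^sup>2 / r"
      unfolding norm_mult using mult_mono[OF key[OF xy], of "cmod (V x j) * cmod (V y l)" 1] r(1) by simp
  qed
  also have "\<dots> = 2 * ?D\<^sup>2 * s\<^sup>2 / r" by (simp add: power2_eq_square)
  finally have bound: "cmod (M i j * M p l - M i l * M p j) \<le> 2 * ?D\<^sup>2 * s\<^sup>2 / r" .
  have finT: "finite T" by (simp add: T_def)
  have t: "first_tuple k \<in> T" using first_tuple[of k d] k by (simp add: T_def)
  \<comment> \<open>The leading column of the compound of W cannot be small: the first k columns of
    W are orthonormal, so the compound of W^H W has the entry 1 / \<open>fact k\<close> at the
    leading tuple.\<close>
  have "1 / fact k = compound k d (mat_adjoint W * W) (first_tuple k) (first_tuple k)"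
    using t WW k fpos by (simp add: compound_def T_def minor_first_tuple_one)
  also have "\<dots> = (\<Sum>x\<in>T. compound k d (mat_adjoint W) (first_tuple k) x * compound k d W x (first_tuple k))"
    unfolding T_def by (rule compound_mult[OF Wa W])
  finally have "1 / fact k = cmod (\<Sum>x\<in>T. compound k d (mat_adjoint W) (first_tuple k) x * compound k d W x (first_tuple k))"
    by (metis norm_divide norm_one norm_fact)
  also have "\<dots> \<le> (\<Sum>x\<in>T. cmod (compound k d (mat_adjoint W) (first_tuple k) x * compound k d W x (first_tuple k)))"
    by (rule norm_sum)
  also have "\<dots> \<le> (\<Sum>x\<in>T. 1 * cmod (compound k d W x (first_tuple k)))"
    unfolding norm_mult by (intro sum_mono mult_right_mono compound_le_1) (use W W1 in auto)
  finally have "s * (1 / fact k) \<le> s * (\<Sum>x\<in>T. cmod (compound k d W x (first_tuple k)))"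
    using s by (intro mult_left_mono) auto
  also have "\<dots> = vnorm T (\<lambda>x. N x (first_tuple k))"
  proof -
    have "(\<Prod>b = 0..<k. f (first_tuple k b)) = s" unfolding s_def by (intro prod.cong) (auto simp: first_tuple_def)
    then show ?thesis using s by (simp add: vnorm_def N_eq norm_mult sum_distrib_left)
  qed
  also have "\<dots> \<le> mnorm T N" by (rule vnorm_column_le[OF finT t])
  also have "\<dots> \<le> mnorm T M * mnorm T (compound k d U)"
    by (rule mnorm_mult_le[OF finT]) (simp add: N_def M_def T_def compound_mult[OF A U])
  also have "\<dots> \<le> mnorm T M * ?D\<^sup>2"
  proof (intro mult_left_mono)
    have "mnorm T (compound k d U) \<le> (\<Sum>x\<in>T. \<Sum>y\<in>T. 1)"
      unfolding mnorm_def by (intro sum_mono compound_le_1 U1)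
    then show "mnorm T (compound k d U) \<le> ?D\<^sup>2" by (simp add: power2_eq_square)
  qed simp
  finally have "s \<le> (fact k * ?D\<^sup>2) * mnorm T M" by (simp add: field_simps)
  then have "s\<^sup>2 \<le> ((fact k * ?D\<^sup>2) * mnorm T M)\<^sup>2" using s by (intro power_mono) auto
  then have "2 * ?D\<^sup>2 * s\<^sup>2 / r \<le> 2 * ?D\<^sup>2 * ((fact k * ?D\<^sup>2) * mnorm T M)\<^sup>2 / r"
    using r(1) by (intro divide_right_mono mult_left_mono) auto
  then show ?thesis using bound by (simp add: power_mult_distrib mult_ac)
qed

section \<open>Anosov representations as nearly rank one representations\<close>

lemma anosov_rank_one_rep:
  fixes G :: "('g, 'm) monoid_scheme" and S :: "'g set"
  assumes whg: "word_hyperbolic_group G S" and k: "odd k" and anosov: "anosov_representation G S k (2 * k) \<rho>"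
  shows "\<exists>C \<mu>. rank_one_rep G S (tuples k (2 * k)) (\<lambda>g. compound k (2 * k) (\<rho> g)) (levi k) C \<mu> 1"
proof -
  interpret group G using whg by (simp add: word_hyperbolic_group_def)
  interpret hyperbolic_word_metric G S
    by unfold_locales (use whg in \<open>auto simp: word_hyperbolic_group_def\<close>)
  let ?T = "tuples k (2 * k)" and ?\<tau> = "\<lambda>g. compound k (2 * k) (\<rho> g)"
  let ?D = "real (card ?T)"
  have k1: "1 \<le> k" and hom: "\<rho> \<in> hom G (SL (2 * k))" using anosov by (auto simp: anosov_representation_def)
  obtain c \<mu> where c: "0 < c" and \<mu>: "0 < \<mu>" and gap: "\<And>g. g \<in> carrier G \<Longrightarrow>
      c * exp (\<mu> * wlen g) \<le> singular_value k (\<rho> g) / singular_value (k + 1) (\<rho> g)"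
    using anosov unfolding anosov_representation_def by metis
  interpret \<rho>: group_hom G "SL (2 * k)" \<rho>
    by (intro group_hom.intro is_group group_SL) (simp add: group_hom_axioms_def hom)
  have \<rho>c: "\<rho> g \<in> carrier_mat (2 * k) (2 * k)" and \<rho>det: "Determinant.det (\<rho> g) = 1" if "g \<in> carrier G" for g
    using \<rho>.hom_closed[OF that] by (auto simp: SL_def)
  have \<rho>mult: "\<rho> (g \<otimes>\<^bsub>G\<^esub> h) = \<rho> g * \<rho> h" if "g \<in> carrier G" "h \<in> carrier G" for g h
    using \<rho>.hom_mult[OF that] by (simp add: SL_def)
  have \<rho>one: "\<rho> \<one>\<^bsub>G\<^esub> = 1\<^sub>m (2 * k)" using \<rho>.hom_one by (simp add: SL_def)
  \<comment> \<open>\<open>compound_minors_le\<close> is used with r = c exp (\<mu> |g|): the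
    exponential becomes the decay rate, and 1 / c goes into the constant.\<close>
  define C where "C = 2 * ?D\<^sup>2 * (fact k * ?D\<^sup>2)\<^sup>2 / c"
  have "rank_one_rep G S ?T ?\<tau> (levi k) C \<mu> 1"
  proof (intro rank_one_rep.intro rank_one_rep_axioms.intro)
    show "hyperbolic_word_metric G S" by (rule hyperbolic_word_metric_axioms)
    show "finite S" using whg by (simp add: word_hyperbolic_group_def)
    show "finite ?T" by simp
    show "?\<tau> g i j = 0" if "i \<notin> ?T \<or> j \<notin> ?T" for i j g using that by (auto simp: compound_def)
    show "?\<tau> (g \<otimes>\<^bsub>G\<^esub> h) i j = (\<Sum>l\<in>?T. ?\<tau> g i l * ?\<tau> h l j)" if "g \<in> carrier G" "h \<in> carrier G" for g h i j
      unfolding \<rho>mult[OF that] by (rule compound_mult[OF \<rho>c[OF that(1)] \<rho>c[OF that(2)]])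
    have "?\<tau> \<one>\<^bsub>G\<^esub> (first_tuple k) (first_tuple k) \<noteq> 0"
      unfolding \<rho>one using first_tuple[of k "2 * k"] minor_first_tuple_one[of k "1\<^sub>m (2 * k)"]
      by (simp add: compound_def)
    then show "\<exists>i j. ?\<tau> \<one>\<^bsub>G\<^esub> i j \<noteq> 0" by blast
    show "0 \<le> C" using c by (simp add: C_def)
    show "0 < \<mu>" by (rule \<mu>)
    show "(0::real) \<le> 1" by simp
    show "cmod (?\<tau> g i j * ?\<tau> g p l - ?\<tau> g i l * ?\<tau> g p j) \<le> C * exp (- \<mu> * wlen g) * (mnorm ?T (?\<tau> g))\<^sup>2"
      if g: "g \<in> carrier G" and ij: "i \<in> ?T" "j \<in> ?T" "p \<in> ?T" "l \<in> ?T" for g i j p l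
    proof -
      have "C * exp (- \<mu> * wlen g) = 2 * ?D\<^sup>2 * (fact k * ?D\<^sup>2)\<^sup>2 / (c * exp (\<mu> * wlen g))"
        by (simp add: C_def exp_minus divide_inverse mult_ac)
      then show ?thesis
        using compound_minors_le[OF \<rho>c[OF g] k1 _ _ gap[OF g] ij] c k1 by simp
    qed
    show "(\<Sum>p\<in>?T. \<Sum>r\<in>?T. ?\<tau> g p i * levi k p r * ?\<tau> g r j) = levi k i j"
      if "g \<in> carrier G" "i \<in> ?T" "j \<in> ?T" for g i j
      by (rule levi_invariant[OF k \<rho>c[OF that(1)] \<rho>det[OF that(1)] that(2,3)])
    show "levi k i j = - levi k j i" for i j by (rule levi_antisym[OF k])
    show "cmod (mapply ?T (?\<tau> \<one>\<^bsub>G\<^esub>) u i) \<le> 1 * vnorm ?T (mapply ?T (levi k) u)" if "i \<in> ?T" for i u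
      unfolding \<rho>one by (rule levi_nondegenerate[OF k that])
  qed
  then show ?thesis by blast
qed

theorem corollary1p4:
  fixes G :: "('g, 'm) monoid_scheme" and S :: "'g set"
  assumes "word_hyperbolic_group G S"
    and "\<exists>P. P \<subset> topspace (group_boundary G S) \<and>
           subtopology (group_boundary G S) P homeomorphic_space top_of_set (sphere (0 :: real ^ 3) 1)"
  shows "\<forall>q::nat. \<nexists>\<rho>. anosov_representation G S (2 * q + 1) (4 * q + 2) \<rho>"
proof (intro allI notI)
  fix q :: nat
  assume "\<exists>\<rho>. anosov_representation G S (2 * q + 1) (4 * q + 2) \<rho>"
  then obtain \<rho> where "anosov_representation G S (2 * q + 1) (2 * (2 * q + 1)) \<rho>" by auto
  moreover have "odd (2 * q + 1)" by simp
  ultimately obtain C \<mu> where rep: "rank_one_rep G S (tuples (2 * q + 1) (2 * (2 * q + 1)))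
      (\<lambda>g. compound (2 * q + 1) (2 * (2 * q + 1)) (\<rho> g)) (levi (2 * q + 1)) C \<mu> 1"
    using anosov_rank_one_rep[OF assms(1)] by blast
  show False using assms(2) rank_one_rep.no_proper_sphere[OF rep] by blast
qed

end
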